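(* Let $C_*=1.2\cdot 10^5$. For all integers $n\ge 0$, all real $\alpha,\beta\ge -1/2$ and all $x\in[-1,1]$, with $S=\alpha+\beta+1$, $$F_{n,\alpha,\beta}(x)\le C_*\,\mathcal{E}_n(S).$$ Equivalently, $$F_{n,\alpha,\beta}(x)^2\le C_*^2\max\left\{1,\;S^{1/3},\;\frac{S^{1/2}}{(n+1)^{1/6}}\right\}.$$
   Context: For real $\alpha,\beta\ge-1/2$ put $w_{\alpha,\beta}(x)=(1-x)^\alpha(1+x)^\beta$, $-1<x<1$. For an integer $n\ge0$, $p_n^{(\alpha,\beta)}$ denotes the (Jacobi) polynomial of degree $n$ orthonormal in $L^2([-1,1],w_{\alpha,\beta}\,dx)$ (unique up to sign). Define, for $-1<x<1$, $$F_{n,\alpha,\beta}(x)=(1-x^2)^{1/4}\,w_{\alpha,\beta}(x)^{1/2}\,|p_n^{(\alpha,\beta)}(x)|,$$ so that $F_{n,\alpha,\beta}(x)^2=(1-x)^{\alpha+1/2}(1+x)^{\beta+1/2}|p_n^{(\alpha,\beta)}(x)|^2$. Values at $x=\pm1$ are understood as one-sided limits from $(-1,1)$ (these exist and are finite). For $S\ge0$ and an integer $n\ge 0$, $$\Phi_n(S)=\max\left\{1,S^{1/3},\frac{S^{1/2}}{(n+1)^{1/6}}\right\},\qquad \mathcal{E}_n(S)=\Phi_n(S)^{1/2}.$$ *)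

theory Defs
  imports "HOL-Analysis.Analysis" "HOL-Computational_Algebra.Polynomial"
begin

definition jacobi_weight :: "real \<Rightarrow> real \<Rightarrow> real \<Rightarrow> real" where
  "jacobi_weight \<alpha> \<beta> x = (1 - x) powr \<alpha> * (1 + x) powr \<beta>"

text \<open>The convention \<open>0 powr a = 0\<close> affects the weight only at the two endpoints, a null set,
  so integrating over the closed interval is harmless.\<close>

definition jacobi_inner :: "real \<Rightarrow> real \<Rightarrow> real poly \<Rightarrow> real poly \<Rightarrow> real" where
  "jacobi_inner \<alpha> \<beta> p q =
     (LINT x:{-1..1}|lborel. poly p x * poly q x * jacobi_weight \<alpha> \<beta> x)"

text \<open>The orthonormal polynomials are unique only up to sign, hence a predicate on sequences of
  polynomials. No integrability clause is needed: the Bochner integral of a non-integrable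
  function is \<open>0\<close>, so the normalisation forces integrability of \<open>(p n)\<^sup>2 w\<close> for every \<open>n\<close>.\<close>

definition orthonormal_jacobi :: "real \<Rightarrow> real \<Rightarrow> (nat \<Rightarrow> real poly) \<Rightarrow> bool" where
  "orthonormal_jacobi \<alpha> \<beta> p \<longleftrightarrow>
     (\<forall>n. degree (p n) = n) \<and>
     (\<forall>m n. jacobi_inner \<alpha> \<beta> (p m) (p n) = (if m = n then 1 else 0))"

definition jacobi_F_open :: "real \<Rightarrow> real \<Rightarrow> real poly \<Rightarrow> real \<Rightarrow> real" where
  "jacobi_F_open \<alpha> \<beta> q x =
     (1 - x\<^sup>2) powr (1/4) * (jacobi_weight \<alpha> \<beta> x) powr (1/2) * \<bar>poly q x\<bar>"

text \<open>At \<open>x = 1\<close> and \<open>x = -1\<close> the formula above evaluates to \<open>0\<close>, which is not its limit when the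
  corresponding exponent is \<open>-1/2\<close>; the endpoint values are therefore set to the one-sided limits,
  whose existence is shown below.\<close>

definition jacobi_F :: "real \<Rightarrow> real \<Rightarrow> real poly \<Rightarrow> real \<Rightarrow> real" where
  "jacobi_F \<alpha> \<beta> q x =
     (if x = 1 then Lim (at_left 1) (jacobi_F_open \<alpha> \<beta> q)
      else if x = -1 then Lim (at_right (-1)) (jacobi_F_open \<alpha> \<beta> q)
      else jacobi_F_open \<alpha> \<beta> q x)"

definition Phi :: "nat \<Rightarrow> real \<Rightarrow> real" where
  "Phi n S = Max {1, S powr (1/3), S powr (1/2) / (real n + 1) powr (1/6)}"

definition E_bound :: "nat \<Rightarrow> real \<Rightarrow> real" where
  "E_bound n S = Phi n S powr (1/2)"

lemma jacobi_F_open_eq: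
  assumes "-1 < x" "x < 1"
  shows "jacobi_F_open \<alpha> \<beta> q x =
    (1 - x) powr (\<alpha>/2 + 1/4) * (1 + x) powr (\<beta>/2 + 1/4) * \<bar>poly q x\<bar>"
proof -
  have "1 - x\<^sup>2 = (1 - x) * (1 + x)" by (simp add: power2_eq_square algebra_simps)
  then show ?thesis
    using assms
    by (simp add: jacobi_F_open_def jacobi_weight_def powr_mult powr_powr powr_add)
qed

lemma jacobi_F_open_square:
  assumes "-1 < x" "x < 1"
  shows "(jacobi_F_open \<alpha> \<beta> q x)\<^sup>2 =
    (1 - x) powr (\<alpha> + 1/2) * (1 + x) powr (\<beta> + 1/2) * \<bar>poly q x\<bar>\<^sup>2"
proof -
  have sq: "(y powr (a/2 + 1/4))\<^sup>2 = y powr (a + 1/2)" if "y > 0" for a y :: real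
    using that by (simp add: power2_eq_square flip: powr_add)
  show ?thesis
    using assms by (simp add: jacobi_F_open_eq power_mult_distrib sq)
qed

lemma tendsto_powr_nonneg_exponent:
  fixes f :: "real \<Rightarrow> real"
  assumes "(f \<longlongrightarrow> 0) F" "\<forall>\<^sub>F x in F. f x > 0" "a \<ge> 0"
  shows "((\<lambda>x. f x powr a) \<longlongrightarrow> (if a = 0 then 1 else 0)) F"
proof (cases "a = 0")
  case True
  have "\<forall>\<^sub>F x in F. f x powr a = 1"
    using assms(2) by eventually_elim (simp add: True)
  then show ?thesis using True by (simp add: tendsto_eventually)
next
  case False
  have "\<forall>\<^sub>F x in F. f x \<ge> 0"
    using assms(2) by eventually_elim simp
  then have "((\<lambda>x. f x powr a) \<longlongrightarrow> 0 powr a) F"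
    using assms False by (intro tendsto_powr') auto
  then show ?thesis using False by simp
qed

lemma jacobi_F_endpoints:
  assumes "\<alpha> \<ge> -1/2" "\<beta> \<ge> -1/2"
  shows "(jacobi_F_open \<alpha> \<beta> q \<longlongrightarrow> jacobi_F \<alpha> \<beta> q 1) (at_left 1)"
    and "(jacobi_F_open \<alpha> \<beta> q \<longlongrightarrow> jacobi_F \<alpha> \<beta> q (-1)) (at_right (-1))"
proof -
  let ?G = "\<lambda>x. (1 - x) powr (\<alpha>/2 + 1/4) * (1 + x) powr (\<beta>/2 + 1/4) * \<bar>poly q x\<bar>"
  have evL: "\<forall>\<^sub>F x in at_left (1::real). -1 < x \<and> x < 1"
    using eventually_at_left_real[of "-1" "1::real"] by (auto elim: eventually_mono)
  have evR: "\<forall>\<^sub>F x in at_right (-1::real). -1 < x \<and> x < 1"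
    using eventually_at_right_real[of "-1" "1::real"] by (auto elim: eventually_mono)
  have eqL: "\<forall>\<^sub>F x in at_left 1. ?G x = jacobi_F_open \<alpha> \<beta> q x"
    using evL by eventually_elim (simp add: jacobi_F_open_eq)
  have eqR: "\<forall>\<^sub>F x in at_right (-1). ?G x = jacobi_F_open \<alpha> \<beta> q x"
    using evR by eventually_elim (simp add: jacobi_F_open_eq)
  have pL: "((\<lambda>x. (1 - x) powr (\<alpha>/2 + 1/4)) \<longlongrightarrow> (if \<alpha>/2 + 1/4 = 0 then 1 else 0)) (at_left 1)"
  proof (rule tendsto_powr_nonneg_exponent)
    show "((\<lambda>x. 1 - x) \<longlongrightarrow> (0::real)) (at_left 1)"
      by (auto intro!: tendsto_eq_intros)
    show "\<forall>\<^sub>F x in at_left 1. 0 < 1 - (x::real)"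
      using evL by eventually_elim simp
  qed (use assms in simp)
  have pR: "((\<lambda>x. (1 + x) powr (\<beta>/2 + 1/4)) \<longlongrightarrow> (if \<beta>/2 + 1/4 = 0 then 1 else 0)) (at_right (-1))"
  proof (rule tendsto_powr_nonneg_exponent)
    show "((\<lambda>x. 1 + x) \<longlongrightarrow> (0::real)) (at_right (-1))"
      by (auto intro!: tendsto_eq_intros)
    show "\<forall>\<^sub>F x in at_right (-1). 0 < 1 + (x::real)"
      using evR by eventually_elim simp
  qed (use assms in simp)
  have qL: "((\<lambda>x. (1 + x) powr (\<beta>/2 + 1/4)) \<longlongrightarrow> (1 + 1) powr (\<beta>/2 + 1/4)) (at_left (1::real))"
    by (intro tendsto_intros) auto
  have qR: "((\<lambda>x. (1 - x) powr (\<alpha>/2 + 1/4)) \<longlongrightarrow> (1 - (-1)) powr (\<alpha>/2 + 1/4)) (at_right (-1::real))"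
    by (intro tendsto_intros) auto
  have tL: "((\<lambda>x. \<bar>poly q x\<bar>) \<longlongrightarrow> \<bar>poly q 1\<bar>) (at_left 1)"
    by (intro tendsto_intros)
  have tR: "((\<lambda>x. \<bar>poly q x\<bar>) \<longlongrightarrow> \<bar>poly q (-1)\<bar>) (at_right (-1))"
    by (intro tendsto_intros)
  obtain l where l: "(jacobi_F_open \<alpha> \<beta> q \<longlongrightarrow> l) (at_left 1)"
    using Lim_transform_eventually[OF tendsto_mult[OF tendsto_mult[OF pL qL] tL] eqL] by blast
  obtain r where r: "(jacobi_F_open \<alpha> \<beta> q \<longlongrightarrow> r) (at_right (-1))"
    using Lim_transform_eventually[OF tendsto_mult[OF tendsto_mult[OF qR pR] tR] eqR] by blast
  show "(jacobi_F_open \<alpha> \<beta> q \<longlongrightarrow> jacobi_F \<alpha> \<beta> q 1) (at_left 1)"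
    using l tendsto_Lim[OF _ l] by (simp add: jacobi_F_def)
  show "(jacobi_F_open \<alpha> \<beta> q \<longlongrightarrow> jacobi_F \<alpha> \<beta> q (-1)) (at_right (-1))"
    using r tendsto_Lim[OF _ r] by (simp add: jacobi_F_def)
qed

end

theory Submission
  imports Defs
begin

text \<open>
  In the variable \<open>x = cos \<theta>\<close> the function \<open>F\<close> is a solution of \<open>F'' + q F = 0\<close> with
  \<open>\<integral> F\<^sup>2 d\<theta> = 1\<close> and \<open>q = Q / (1 - x\<^sup>2)\<close> for a concave quadratic polynomial \<open>Q\<close>. For every
  multiplier \<open>g\<close> the quantity \<open>E\<^sub>g = g (F'\<^sup>2 + q F\<^sup>2) - g' F F' + g'' F\<^sup>2 / 2\<close> satisfies
  \<open>E\<^sub>g' = (2 g' q + g q' + g''' / 2) F\<^sup>2\<close>, so a multiplier for which the bracket is bounded below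
  turns the normalisation of \<open>F\<close> into a pointwise bound. Below, \<open>g = h sqrt (1 - x\<^sup>2)\<close>.

  The choice \<open>h = x - xc\<close>, with \<open>xc\<close> the centre of \<open>Qhat = Q - (1 - x\<^sup>2) / 4 - 1 / 4\<close>, yields the second moment of \<open>F\<^sup>2\<close>, and
  \<open>h = 1\<close> then bounds \<open>F\<close> and \<open>F'\<close> at \<open>xc\<close>. By symmetry only \<open>x \<le> xc\<close> remains. If
  \<open>\<beta> \<le> 1/2\<close>, \<open>q\<close> has no turning point near \<open>-1\<close> and the energy at \<open>xc\<close> controls the
  maximum. If \<open>\<beta> \<ge> 1/2\<close>, a crude bound by \<open>sqrt (max q)\<close> suffices for \<open>n \<le> 10\<^sup>6\<close>; for larger
  \<open>n\<close> the multiplier \<open>h = 1 / sqrt (x - y)\<close>, with \<open>y\<close> at Airy distance to the left of the turning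
  point, gives the sharp order of magnitude.
\<close>

section \<open>The energy identity\<close>

text \<open>The factor sqrt (1 - x^2) in the multiplier is the passage to the variable z with dx/dz
  = 1 - x^2, where the coefficient of the equation is the quadratic polynomial \<open>Qhat\<close>;
  so the rate for h = x - xc is a polynomial too. The obstacle is uniformity: the oscillatory
  interval [xc - r, xc + r] shrinks when S is much larger than n, and the turning point may come
  arbitrarily close to -1. Both powers of S in \<open>Phi\<close> arise there. With w0 = 1 - y^2,
  F^4 is bounded by a multiple of u + 2/r, where u^3 is at most 2 A w0 / r^2. For S at most n, r is
  bounded below and A w0 is at most of order S^2, which gives S^(1/3). For S above n, w0 is at most
  of order r^2 A / \<mu>, A of order S^2 and \<mu> at least of order n S, so u^3 is of order S^3 /
  n, which gives S^(1/2) / n^(1/6). The threshold 10^6 makes the lower-order terms of the Airy step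
  negligible; its price is the factor 4 * 10^7 for smaller n, far below the square of the final
  constant. Degree zero needs its own argument, because \<mu> may be negative.\<close>

lemma jacobi_weight_pos: "-1 < x \<Longrightarrow> x < 1 \<Longrightarrow> jacobi_weight \<alpha> \<beta> x > 0"
  by (simp add: jacobi_weight_def)

lemma one_minus_square_pos: "1 - x\<^sup>2 > 0" if "-1 < x" "x < (1::real)"
proof -
  have "(1 - x) * (1 + x) > 0" using that by simp
  then show ?thesis by (simp add: power2_eq_square algebra_simps)
qed

lemma jacobi_weight_has_derivative:
  assumes "-1 < x" "x < 1"
  shows "(jacobi_weight \<alpha> \<beta> has_real_derivative
    jacobi_weight \<alpha> \<beta> x * (\<beta> - \<alpha> - (\<alpha> + \<beta>) * x) / (1 - x\<^sup>2)) (at x)"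
proof -
  have W: "1 - x\<^sup>2 = (1 - x) * (1 + x)" by (simp add: power2_eq_square algebra_simps)
  have "((\<lambda>x. (1 - x) powr \<alpha> * (1 + x) powr \<beta>) has_real_derivative
      (- \<alpha> * (1 - x) powr (\<alpha> - 1)) * (1 + x) powr \<beta> + (1 - x) powr \<alpha> * (\<beta> * (1 + x) powr (\<beta> - 1))) (at x)"
    using assms by (auto intro!: derivative_eq_intros)
  moreover have "(- \<alpha> * (1 - x) powr (\<alpha> - 1)) * (1 + x) powr \<beta> + (1 - x) powr \<alpha> * (\<beta> * (1 + x) powr (\<beta> - 1))
     = jacobi_weight \<alpha> \<beta> x * (\<beta> - \<alpha> - (\<alpha> + \<beta>) * x) / (1 - x\<^sup>2)"
    unfolding W jacobi_weight_def using assms by (simp add: powr_diff field_simps)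
  ultimately show ?thesis by (simp add: jacobi_weight_def[abs_def])
qed

lemma jacobi_weight_times_has_derivative:
  assumes "-1 < x" "x < 1"
  shows "((\<lambda>x. jacobi_weight \<alpha> \<beta> x * (1 - x\<^sup>2)) has_real_derivative
    jacobi_weight \<alpha> \<beta> x * (\<beta> - \<alpha> - (\<alpha> + \<beta> + 2) * x)) (at x)"
proof -
  have "((\<lambda>x. jacobi_weight \<alpha> \<beta> x * (1 - x\<^sup>2)) has_real_derivative
      jacobi_weight \<alpha> \<beta> x * (\<beta> - \<alpha> - (\<alpha> + \<beta>) * x) / (1 - x\<^sup>2) * (1 - x\<^sup>2) + (- 2 * x) * jacobi_weight \<alpha> \<beta> x) (at x)"
    by (rule DERIV_mult[OF jacobi_weight_has_derivative[OF assms]]) (auto intro!: derivative_eq_intros)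
  moreover have "jacobi_weight \<alpha> \<beta> x * (\<beta> - \<alpha> - (\<alpha> + \<beta>) * x) / (1 - x\<^sup>2) * (1 - x\<^sup>2)
      = jacobi_weight \<alpha> \<beta> x * (\<beta> - \<alpha> - (\<alpha> + \<beta>) * x)"
    using one_minus_square_pos[OF assms] by simp
  ultimately show ?thesis by (elim DERIV_cong) (simp add: algebra_simps)
qed

lemma jacobi_weight_times_tendsto:
  assumes "\<alpha> > -1" "\<beta> > -1"
  shows "((\<lambda>x. jacobi_weight \<alpha> \<beta> x * (1 - x\<^sup>2)) \<longlongrightarrow> 0) (at_left 1)"
    and "((\<lambda>x. jacobi_weight \<alpha> \<beta> x * (1 - x\<^sup>2)) \<longlongrightarrow> 0) (at_right (-1))"
proof -
  have eq: "(1 - x) powr (\<alpha> + 1) * (1 + x) powr (\<beta> + 1) = jacobi_weight \<alpha> \<beta> x * (1 - x\<^sup>2)"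
    if "-1 < x" "x < 1" for x
    using that by (simp add: jacobi_weight_def powr_add power2_eq_square algebra_simps)
  have "((\<lambda>x. (1 - x) powr (\<alpha> + 1) * (1 + x) powr (\<beta> + 1)) \<longlongrightarrow> (1 - 1) powr (\<alpha> + 1) * (1 + 1) powr (\<beta> + 1)) (at_left (1::real))"
    using assms by (intro tendsto_intros tendsto_powr') (auto simp: eventually_at_left_field intro!: exI[of _ 0])
  then show "((\<lambda>x. jacobi_weight \<alpha> \<beta> x * (1 - x\<^sup>2)) \<longlongrightarrow> 0) (at_left 1)"
    using assms by (elim Lim_transform_eventually[OF tendsto_eq_rhs])
       (auto simp: eventually_at_left_field eq intro!: exI[of _ 0])
  have "((\<lambda>x. (1 - x) powr (\<alpha> + 1) * (1 + x) powr (\<beta> + 1)) \<longlongrightarrow> (1 - (-1)) powr (\<alpha> + 1) * (1 + (-1)) powr (\<beta> + 1)) (at_right (-1::real))"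
    using assms by (intro tendsto_intros tendsto_powr') (auto simp: eventually_at_right_field intro!: exI[of _ 0])
  then show "((\<lambda>x. jacobi_weight \<alpha> \<beta> x * (1 - x\<^sup>2)) \<longlongrightarrow> 0) (at_right (-1))"
    using assms by (elim Lim_transform_eventually[OF tendsto_eq_rhs])
       (auto simp: eventually_at_right_field eq intro!: exI[of _ 0])
qed

lemma continuous_on_jacobi_weight:
  "continuous_on {-1<..<1} (jacobi_weight \<alpha> \<beta>)"
  unfolding jacobi_weight_def[abs_def] by (intro continuous_intros) auto

text \<open>Pure algebra, with \<open>l\<close>, \<open>s\<close>, \<open>m\<close> for
  \<open>ell\<close>, \<open>\<sigma>\<close>, \<open>\<mu>\<close> and \<open>p\<close>,
  \<open>q\<close>, \<open>z\<close> for the polynomial and its first two derivatives. After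
  multiplication by \<open>W\<close> the second derivative occurs only in the product
  \<open>W * z\<close>, which the differential equation eliminates.\<close>

lemma energy_identity_1:
  fixes W x l s m p q z h h1 h2 h3 :: real
  shows "W * (h1 * (W * q\<^sup>2 + 2 * l * p * q + m * p\<^sup>2)
      + h * (- 2 * x * q\<^sup>2 + 2 * W * q * z - 2 * s * p * q + 2 * l * q\<^sup>2
          + 2 * l * p * z + 2 * m * p * q)
      - h2 * p * (W * q + l * p) - h1 * q * (W * q + l * p)
      - h1 * p * (- 2 * x * q + W * z - s * p + l * q)
      + (W * h3 - 4 * x * h2 - 2 * h1) / 2 * p\<^sup>2
      + (W * h2 - 2 * x * h1) * p * q) = W * h1 * (W * q\<^sup>2 + 2 * l * p * q + m * p\<^sup>2)
      + W * h * (- 2 * x * q\<^sup>2 - 2 * s * p * q + 2 * l * q\<^sup>2 + 2 * m * p * q)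
      + h * (2 * W * q + 2 * l * p) * (W * z)
      - W * h2 * p * (W * q + l * p) - W * h1 * q * (W * q + l * p)
      - W * h1 * p * (- 2 * x * q - s * p + l * q) - W * h1 * p * (W * z)
      + W * (W * h3 - 4 * x * h2 - 2 * h1) / 2 * p\<^sup>2
      + W * (W * h2 - 2 * x * h1) * p * q"
  by (simp add: power2_eq_square field_simps)

text \<open>Once \<open>W * z\<close> is eliminated, every term containing \<open>q\<close> cancels;
  hence the energy rate is a multiple of the squared solution alone.\<close>

lemma energy_identity_2:
  fixes W x l s m p q h h1 h2 h3 :: real
  shows "(2 * l - 2 * x) * (h * (W * q\<^sup>2 + 2 * l * p * q + m * p\<^sup>2) - h1 * p * (W * q + l * p) + (W * h2 - 2 * x * h1) / 2 * p\<^sup>2)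
   + (W * h1 * (W * q\<^sup>2 + 2 * l * p * q + m * p\<^sup>2)
      + W * h * (- 2 * x * q\<^sup>2 - 2 * s * p * q + 2 * l * q\<^sup>2 + 2 * m * p * q)
      + h * (2 * W * q + 2 * l * p) * (- (2 * l - 2 * x) * q - (m - s) * p)
      - W * h2 * p * (W * q + l * p) - W * h1 * q * (W * q + l * p)
      - W * h1 * p * (- 2 * x * q - s * p + l * q) - W * h1 * p * (- (2 * l - 2 * x) * q - (m - s) * p)
      + W * (W * h3 - 4 * x * h2 - 2 * h1) / 2 * p\<^sup>2
      + W * (W * h2 - 2 * x * h1) * p * q)
   = (2 * (m * W - l\<^sup>2) * h1 + (- 2 * m * x + 2 * s * l) * h
      + (W\<^sup>2 * h3 - 6 * x * W * h2 + (4 * x\<^sup>2 - 2 * W) * h1) / 2) * p\<^sup>2"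
  by (simp add: power2_eq_square field_simps)

text \<open>All that the bounds need from orthonormality, apart from the degree when n = 0. Both
  conditions survive reflection, and compact subintervals avoid the singularities of the
  weight.\<close>

locale jacobi_solution =
  fixes \<alpha> \<beta> :: real and n :: nat and p :: "real poly"
  assumes \<alpha>_ge: "\<alpha> \<ge> -1/2" and \<beta>_ge: "\<beta> \<ge> -1/2"
    and ode: "\<And>x. (1 - x\<^sup>2) * poly (pderiv (pderiv p)) x
        + (\<beta> - \<alpha> - (\<alpha> + \<beta> + 2) * x) * poly (pderiv p) x
        + real n * (real n + \<alpha> + \<beta> + 1) * poly p x = 0"
    and mass_le_1: "\<And>a b. -1 < a \<Longrightarrow> a \<le> b \<Longrightarrow> b < 1 \<Longrightarrow>
        integral {a..b} (\<lambda>x. jacobi_weight \<alpha> \<beta> x * (poly p x)\<^sup>2) \<le> 1"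
begin

definition "\<sigma> = (\<alpha> + \<beta>) / 2"
definition "\<delta> = (\<beta> - \<alpha>) / 2"
text \<open>The shifts by \<open>\<sigma>\<close> and \<open>\<sigma>\<^sup>2\<close> complete the
  eigenvalue to (n + (\<alpha> + \<beta> + 1)/2)^2 - 1/4; \<open>- A\<close> is the leading
  coefficient of the quadratic \<open>Qhat\<close>.\<close>

definition "\<mu> = real n * (real n + \<alpha> + \<beta> + 1) + \<sigma>"
definition "A = \<mu> + \<sigma>\<^sup>2"

abbreviation "w \<equiv> jacobi_weight \<alpha> \<beta>"
abbreviation "p0 \<equiv> poly p"
abbreviation "p1 \<equiv> poly (pderiv p)"
abbreviation "p2 \<equiv> poly (pderiv (pderiv p))"

text \<open>In the variable \<open>z\<close> with \<open>dx/dz = 1 - x\<^sup>2\<close> the function \<open>U = sqrt w * p\<close> satisfies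
  \<open>U'' + Qhat U = 0\<close> and \<open>U' = sqrt w * ((1 - x\<^sup>2) p' + ell p)\<close>.\<close>

definition "ell x = \<delta> - \<sigma> * x"
definition "Qhat x = \<mu> * (1 - x\<^sup>2) - (ell x)\<^sup>2"
definition "Qhat' x = - 2 * \<mu> * x + 2 * \<sigma> * ell x"
definition "Q x = Qhat x + (1 - x\<^sup>2) / 4 + 1 / 4"

definition "v x = w x * (p0 x)\<^sup>2"

text \<open>With primes for d/dz this is h (U'^2 + Qhat U^2) - h' U U' + h'' U^2 / 2. The squares of
  \<open>ell\<close> in U'^2 and \<open>Qhat\<close> cancel, so the factor w (1 - x^2) can be pulled
  out; it makes the energy vanish at both endpoints.\<close>

definition energy :: "real \<Rightarrow> real \<Rightarrow> real \<Rightarrow> real \<Rightarrow> real" where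
  "energy h h1 h2 x = w x * (1 - x\<^sup>2) *
     (h * ((1 - x\<^sup>2) * (p1 x)\<^sup>2 + 2 * ell x * p0 x * p1 x + \<mu> * (p0 x)\<^sup>2)
      - h1 * p0 x * ((1 - x\<^sup>2) * p1 x + ell x * p0 x)
      + ((1 - x\<^sup>2) * h2 - 2 * x * h1) / 2 * (p0 x)\<^sup>2)"

lemma p_derivs:
  "(p0 has_real_derivative p1 x) (at x)" "(p1 has_real_derivative p2 x) (at x)"
  by (rule poly_DERIV)+

lemma ell_deriv: "(ell has_real_derivative - \<sigma>) (at x)"
  unfolding ell_def[abs_def] by (auto intro!: derivative_eq_intros)

lemma p2_eq: "(1 - x\<^sup>2) * p2 x = - (2 * ell x - 2 * x) * p1 x - (\<mu> - \<sigma>) * p0 x"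
proof -
  have "2 * ell x - 2 * x = \<beta> - \<alpha> - (\<alpha> + \<beta> + 2) * x" "\<mu> - \<sigma> = real n * (real n + \<alpha> + \<beta> + 1)"
    by (simp_all add: ell_def \<sigma>_def \<delta>_def \<mu>_def field_simps)
  then show ?thesis using ode[of x] by (simp only:)
qed

lemma wW_deriv: "-1 < x \<Longrightarrow> x < 1 \<Longrightarrow> ((\<lambda>x. w x * (1 - x\<^sup>2)) has_real_derivative w x * (2 * ell x - 2 * x)) (at x)"
  by (rule DERIV_cong[OF jacobi_weight_times_has_derivative])
     (auto simp: ell_def \<sigma>_def \<delta>_def field_simps)

text \<open>In the variable z the rate is (2 h' Qhat + h Qhat' + h''' / 2) U^2; the return to x
  cancels one factor 1 - x^2.\<close>

lemma energy_deriv: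
  assumes x: "-1 < x" "x < 1"
    and h: "(h has_real_derivative h1 x) (at x)" "(h1 has_real_derivative h2 x) (at x)"
      "(h2 has_real_derivative h3 x) (at x)"
  shows "((\<lambda>x. energy (h x) (h1 x) (h2 x) x) has_real_derivative
    (2 * Qhat x * h1 x + Qhat' x * h x
      + ((1 - x\<^sup>2)\<^sup>2 * h3 x - 6 * x * (1 - x\<^sup>2) * h2 x + (6 * x\<^sup>2 - 2) * h1 x) / 2) * v x) (at x)"
proof -
  let ?W = "1 - x\<^sup>2"
  let ?K = "h x * (?W * (p1 x)\<^sup>2 + 2 * ell x * p0 x * p1 x + \<mu> * (p0 x)\<^sup>2)
      - h1 x * p0 x * (?W * p1 x + ell x * p0 x)
      + (?W * h2 x - 2 * x * h1 x) / 2 * (p0 x)\<^sup>2"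
  let ?K' = "h1 x * (?W * (p1 x)\<^sup>2 + 2 * ell x * p0 x * p1 x + \<mu> * (p0 x)\<^sup>2)
      + h x * (- 2 * x * (p1 x)\<^sup>2 + 2 * ?W * p1 x * p2 x - 2 * \<sigma> * p0 x * p1 x + 2 * ell x * (p1 x)\<^sup>2
          + 2 * ell x * p0 x * p2 x + 2 * \<mu> * p0 x * p1 x)
      - h2 x * p0 x * (?W * p1 x + ell x * p0 x) - h1 x * p1 x * (?W * p1 x + ell x * p0 x)
      - h1 x * p0 x * (- 2 * x * p1 x + ?W * p2 x - \<sigma> * p0 x + ell x * p1 x)
      + (?W * h3 x - 4 * x * h2 x - 2 * h1 x) / 2 * (p0 x)\<^sup>2
      + (?W * h2 x - 2 * x * h1 x) * p0 x * p1 x"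
  have sq: "((\<lambda>x. (f x)\<^sup>2) has_real_derivative 2 * f x * f') (at x)"
    if "(f has_real_derivative f') (at x)" for f f'
    using that by (auto intro!: derivative_eq_intros)
  have half: "((\<lambda>x. f x / 2) has_real_derivative f' / 2) (at x)"
    if "(f has_real_derivative f') (at x)" for f f'
    using that by (auto intro!: derivative_eq_intros)
  have K: "((\<lambda>x. h x * ((1 - x\<^sup>2) * (p1 x)\<^sup>2 + 2 * ell x * p0 x * p1 x + \<mu> * (p0 x)\<^sup>2)
      - h1 x * p0 x * ((1 - x\<^sup>2) * p1 x + ell x * p0 x)
      + ((1 - x\<^sup>2) * h2 x - 2 * x * h1 x) / 2 * (p0 x)\<^sup>2) has_real_derivative ?K') (at x)"
    by (rule DERIV_cong, (rule DERIV_add DERIV_diff DERIV_mult sq half p_derivs ell_deriv h DERIV_const DERIV_ident)+)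
      (simp add: field_simps power2_eq_square)
  have "((\<lambda>x. energy (h x) (h1 x) (h2 x) x) has_real_derivative
     w x * (2 * ell x - 2 * x) * ?K + ?K' * (w x * ?W)) (at x)"
    unfolding energy_def by (rule DERIV_mult[OF wW_deriv[OF x] K])
  moreover have "w x * (2 * ell x - 2 * x) * ?K + ?K' * (w x * ?W) = w x * ((2 * ell x - 2 * x) * ?K + ?W * ?K')"
  proof -
    have "a * b * c + d * (a * e) = a * (b * c + e * d)" for a b c d e :: real by algebra
    then show ?thesis .
  qed
  moreover have K': "?W * ?K' = 
?W * h1 x * (?W * (p1 x)\<^sup>2 + 2 * ell x * p0 x * p1 x + \<mu> * (p0 x)\<^sup>2)
      + ?W * h x * (- 2 * x * (p1 x)\<^sup>2 - 2 * \<sigma> * p0 x * p1 x + 2 * ell x * (p1 x)\<^sup>2 + 2 * \<mu> * p0 x * p1 x)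
      + h x * (2 * ?W * p1 x + 2 * ell x * p0 x) * (?W * p2 x)
      - ?W * h2 x * p0 x * (?W * p1 x + ell x * p0 x) - ?W * h1 x * p1 x * (?W * p1 x + ell x * p0 x)
      - ?W * h1 x * p0 x * (- 2 * x * p1 x - \<sigma> * p0 x + ell x * p1 x) - ?W * h1 x * p0 x * (?W * p2 x)
      + ?W * (?W * h3 x - 4 * x * h2 x - 2 * h1 x) / 2 * (p0 x)\<^sup>2
      + ?W * (?W * h2 x - 2 * x * h1 x) * p0 x * p1 x"
    by (rule energy_identity_1)
  moreover have "(2 * ell x - 2 * x) * ?K + ?W * ?K' = (2 * Qhat x * h1 x + Qhat' x * h x
      + (?W\<^sup>2 * h3 x - 6 * x * ?W * h2 x + (6 * x\<^sup>2 - 2) * h1 x) / 2) * (p0 x)\<^sup>2"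
  proof -
    have "4 * x\<^sup>2 - 2 * ?W = 6 * x\<^sup>2 - 2" by simp
    then show ?thesis
      unfolding K' unfolding p2_eq Qhat_def Qhat'_def unfolding energy_identity_2 by (simp only:)
  qed
  moreover have "w x * (c * (p0 x)\<^sup>2) = c * v x" for c by (simp add: v_def)
  ultimately show ?thesis by (simp only:)
qed

lemma energy_alt:
  "energy h h1 h2 x = w x * (h * (((1 - x\<^sup>2) * p1 x + ell x * p0 x)\<^sup>2 + Qhat x * (p0 x)\<^sup>2)
      - (1 - x\<^sup>2) * h1 * p0 x * ((1 - x\<^sup>2) * p1 x + ell x * p0 x)
      + ((1 - x\<^sup>2)\<^sup>2 * h2 - 2 * x * (1 - x\<^sup>2) * h1) / 2 * (p0 x)\<^sup>2)"
proof -
  have "(1 - x\<^sup>2) *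
     (h * ((1 - x\<^sup>2) * (p1 x)\<^sup>2 + 2 * ell x * p0 x * p1 x + \<mu> * (p0 x)\<^sup>2)
      - h1 * p0 x * ((1 - x\<^sup>2) * p1 x + ell x * p0 x)
      + ((1 - x\<^sup>2) * h2 - 2 * x * h1) / 2 * (p0 x)\<^sup>2) = (h * (((1 - x\<^sup>2) * p1 x + ell x * p0 x)\<^sup>2 + Qhat x * (p0 x)\<^sup>2)
      - (1 - x\<^sup>2) * h1 * p0 x * ((1 - x\<^sup>2) * p1 x + ell x * p0 x)
      + ((1 - x\<^sup>2)\<^sup>2 * h2 - 2 * x * (1 - x\<^sup>2) * h1) / 2 * (p0 x)\<^sup>2)"
    unfolding Qhat_def by (simp add: field_simps) algebra
  then show ?thesis unfolding energy_def by (simp add: mult.assoc)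
qed

text \<open>Completing the square in the derivative of U leaves a lower bound that involves only the
  solution itself.\<close>

lemma energy_ge:
  assumes x: "-1 < x" "x < 1" and "h > 0"
  shows "(h * Qhat x + ((1 - x\<^sup>2)\<^sup>2 * h2 - 2 * x * (1 - x\<^sup>2) * h1) / 2
      - ((1 - x\<^sup>2) * h1)\<^sup>2 / (4 * h)) * v x \<le> energy h h1 h2 x"
proof -
  define Y where "Y = (1 - x\<^sup>2) * p1 x + ell x * p0 x"
  have *: "W * (h * (Y\<^sup>2 + q * u\<^sup>2) - a * u * Y + c * u\<^sup>2) - (h * q + c - a\<^sup>2 / (4 * h)) * (W * u\<^sup>2)
      = W * (h * (Y - a * u / (2 * h))\<^sup>2)" for W q u c a
    using \<open>h > 0\<close> by (simp add: field_simps power2_eq_square)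
  have nonneg: "w x * (h * (Y - (1 - x\<^sup>2) * h1 * p0 x / (2 * h))\<^sup>2) \<ge> 0"
    using jacobi_weight_pos[OF x, of \<alpha> \<beta>] \<open>h > 0\<close> by simp
  have le: "b \<le> a" if "z \<ge> 0" "a - b = z" for a b z :: real using that by simp
  show ?thesis
    unfolding energy_alt v_def Y_def[symmetric] by (rule le[OF nonneg *])
qed

text \<open>Exponents at least -1/2 make w (1 - x^2) vanish at both ends, so boundary terms
  disappear for every multiplier that has limits there together with two derivatives.\<close>

lemma energy_tendsto:
  assumes "(h \<longlongrightarrow> a) F" "(h1 \<longlongrightarrow> a1) F" "(h2 \<longlongrightarrow> a2) F"
    and "F = at_left 1 \<or> F = at_right (-1)"
  shows "((\<lambda>x. energy (h x) (h1 x) (h2 x) x) \<longlongrightarrow> 0) F"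
proof -
  have *: "((\<lambda>x. w x * (1 - x\<^sup>2)) \<longlongrightarrow> 0) F"
    using assms(4) jacobi_weight_times_tendsto[of \<alpha> \<beta>] \<alpha>_ge \<beta>_ge by auto
  from assms(4) obtain z where z: "((\<lambda>x. x) \<longlongrightarrow> z) F" by (auto simp: tendsto_ident_at)
  have c: "((\<lambda>x. poly q x) \<longlongrightarrow> poly q z) F" for q :: "real poly" by (rule tendsto_poly[OF z])
  have "((\<lambda>x. energy (h x) (h1 x) (h2 x) x) \<longlongrightarrow> 0 *
     (a * ((1 - z\<^sup>2) * (p1 z)\<^sup>2 + 2 * (\<delta> - \<sigma> * z) * p0 z * p1 z + \<mu> * (p0 z)\<^sup>2)
      - a1 * p0 z * ((1 - z\<^sup>2) * p1 z + (\<delta> - \<sigma> * z) * p0 z)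
      + ((1 - z\<^sup>2) * a2 - 2 * z * a1) / 2 * (p0 z)\<^sup>2)) F"
    unfolding energy_def ell_def by (intro tendsto_intros * z c assms(1-3)) simp_all
  then show ?thesis by simp
qed

lemma v_nonneg: "-1 < x \<Longrightarrow> x < 1 \<Longrightarrow> v x \<ge> 0"
  using jacobi_weight_pos[of x \<alpha> \<beta>] by (simp add: v_def)

lemma continuous_on_v: "continuous_on {-1<..<1} v"
  unfolding v_def[abs_def] by (intro continuous_intros continuous_on_jacobi_weight)

lemma integrable_times_v:
  assumes "-1 < a" "b < 1" "continuous_on {a..b} g"
  shows "(\<lambda>x. g x * v x) integrable_on {a..b}"
  using assms by (intro integrable_continuous_interval continuous_intros
      continuous_on_subset[OF continuous_on_v]) auto

lemma integral_v_le_1: "-1 < a \<Longrightarrow> a \<le> b \<Longrightarrow> b < 1 \<Longrightarrow> integral {a..b} v \<le> 1"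
  using mass_le_1[of a b] by (simp add: v_def[abs_def])

lemma energy_diff:
  assumes "-1 < a" "a \<le> b" "b < 1"
    and h: "\<And>x. x \<in> {a..b} \<Longrightarrow> (h has_real_derivative h1 x) (at x)"
      "\<And>x. x \<in> {a..b} \<Longrightarrow> (h1 has_real_derivative h2 x) (at x)"
      "\<And>x. x \<in> {a..b} \<Longrightarrow> (h2 has_real_derivative h3 x) (at x)"
  shows "((\<lambda>x. (2 * Qhat x * h1 x + Qhat' x * h x
      + ((1 - x\<^sup>2)\<^sup>2 * h3 x - 6 * x * (1 - x\<^sup>2) * h2 x + (6 * x\<^sup>2 - 2) * h1 x) / 2) * v x)
     has_integral energy (h b) (h1 b) (h2 b) b - energy (h a) (h1 a) (h2 a) a) {a..b}"
proof (rule fundamental_theorem_of_calculus[OF \<open>a \<le> b\<close>])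
  fix x assume x: "x \<in> {a..b}"
  show "((\<lambda>x. energy (h x) (h1 x) (h2 x) x) has_vector_derivative
      (2 * Qhat x * h1 x + Qhat' x * h x
      + ((1 - x\<^sup>2)\<^sup>2 * h3 x - 6 * x * (1 - x\<^sup>2) * h2 x + (6 * x\<^sup>2 - 2) * h1 x) / 2) * v x) (at x within {a..b})"
    unfolding has_real_derivative_iff_has_vector_derivative[symmetric]
    by (rule has_field_derivative_at_within, rule energy_deriv[of x h h1 h2 h3])
       (use x assms(1-3) h[OF x] in simp_all)
qed

end

section \<open>The differential equation of orthonormal Jacobi polynomials\<close>

text \<open>Bridge from the Lebesgue integral of the orthonormality to the gauge integral of the
  energy argument.\<close>

lemma integral_le_set_integral:
  fixes f :: "real \<Rightarrow> real"
  assumes f: "set_integrable lborel {c..d} f" and pos: "\<And>x. x \<in> {c..d} \<Longrightarrow> f x \<ge> 0" and ab: "{a..b} \<subseteq> {c..d}"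
  shows "integral {a..b} f \<le> (LINT x:{c..d}|lborel. f x)"
proof -
  have f': "set_integrable lborel {a..b} f"
    using ab by (intro set_integrable_subset[OF f]) auto
  have "integral {a..b} f = (LINT x:{a..b}|lborel. f x)"
    using set_borel_integral_eq_integral(2)[OF f'] by simp
  also have "\<dots> \<le> (LINT x:{c..d}|lborel. f x)"
    unfolding set_lebesgue_integral_def
    using f f' pos ab unfolding set_integrable_def
    by (intro integral_mono) (auto simp: indicator_def)
  finally show ?thesis .
qed

lemma jacobi_weight_nonneg: "x \<in> {-1..1} \<Longrightarrow> jacobi_weight \<alpha> \<beta> x \<ge> 0"
  by (simp add: jacobi_weight_def)

definition jacobi_functional :: "real \<Rightarrow> real \<Rightarrow> real poly \<Rightarrow> real" where
  "jacobi_functional \<alpha> \<beta> q = (LINT x:{-1..1}|lborel. poly q x * jacobi_weight \<alpha> \<beta> x)"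

lemma jacobi_inner_eq_functional: "jacobi_inner \<alpha> \<beta> p q = jacobi_functional \<alpha> \<beta> (p * q)"
  by (simp add: jacobi_inner_def jacobi_functional_def)

definition jacobi_op :: "real \<Rightarrow> real \<Rightarrow> real poly \<Rightarrow> real poly" where
  "jacobi_op \<alpha> \<beta> q = pderiv (pderiv q) - monom 1 2 * pderiv (pderiv q)
     + smult (\<beta> - \<alpha>) (pderiv q) - monom (\<alpha> + \<beta> + 2) 1 * pderiv q"

lemma poly_jacobi_op:
  "poly (jacobi_op \<alpha> \<beta> q) x = (1 - x\<^sup>2) * poly (pderiv (pderiv q)) x + (\<beta> - \<alpha> - (\<alpha> + \<beta> + 2) * x) * poly (pderiv q) x"
  by (simp add: jacobi_op_def poly_monom algebra_simps)

text \<open>The operator is triangular on coefficients with diagonal entries -k (k + \<alpha> +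
  \<beta> + 1), so adding the right multiple of a polynomial of degree n removes its top
  coefficient.\<close>

lemma coeff_jacobi_op:
  "coeff (jacobi_op \<alpha> \<beta> q) k = (real k + 2) * (real k + 1) * coeff q (k + 2)
     + (\<beta> - \<alpha>) * (real k + 1) * coeff q (k + 1) - real k * (real k + \<alpha> + \<beta> + 1) * coeff q k"
proof -
  consider "k = 0" | "k = 1" | j where "k = Suc (Suc j)" by (metis One_nat_def not0_implies_Suc)
  then show ?thesis
    by cases ((simp add: jacobi_op_def coeff_pderiv coeff_monom_mult eval_nat_numeral; simp add: algebra_simps)+)
qed

lemma set_integrable_poly_times:
  fixes f :: "real \<Rightarrow> real"
  assumes "set_integrable lborel {-1..1} f"
  shows "set_integrable lborel {-1..1} (\<lambda>x. poly q x * f x)"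
proof -
  have "compact (poly q ` {-1..1})"
    by (intro compact_continuous_image continuous_intros compact_Icc)
  then obtain C where "\<forall>x\<in>{-1..1}. \<bar>poly q x\<bar> \<le> C"
    by (auto dest!: compact_imp_bounded simp: bounded_iff)
  then have C: "\<bar>poly q x\<bar> \<le> C" if "x \<in> {-1..1}" for x
    using that by blast
  have "set_integrable lborel {-1..1} (\<lambda>x. C * f x)"
    using assms by simp
  then show ?thesis
    unfolding set_integrable_def
  proof (rule Bochner_Integration.integrable_bound)
    have "(\<lambda>x. poly q x * (indicat_real {-1..1} x *\<^sub>R f x)) \<in> borel_measurable lborel"
    proof (intro borel_measurable_times)
      show "poly q \<in> borel_measurable lborel"
      proof -
        have "poly q \<in> borel_measurable borel"
          by (intro borel_measurable_continuous_onI continuous_intros)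
        then show ?thesis by simp
      qed
    qed (use assms in \<open>auto simp: set_integrable_def\<close>)
    then show "(\<lambda>x. indicat_real {-1..1} x *\<^sub>R (poly q x * f x)) \<in> borel_measurable lborel"
      by (simp add: mult_ac)
    show "AE x in lborel. norm (indicat_real {-1..1} x *\<^sub>R (poly q x * f x)) \<le> norm (indicat_real {-1..1} x *\<^sub>R (C * f x))"
      using C by (intro AE_I2) (force simp: indicator_def abs_mult intro!: mult_right_mono)
  qed
qed

locale orthonormal_jacobi_seq =
  fixes \<alpha> \<beta> :: real and p :: "nat \<Rightarrow> real poly"
  assumes \<alpha>_ge: "\<alpha> \<ge> -1/2" and \<beta>_ge: "\<beta> \<ge> -1/2" and orthonormal: "orthonormal_jacobi \<alpha> \<beta> p"
begin

abbreviation "I \<equiv> jacobi_functional \<alpha> \<beta>"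
abbreviation "L \<equiv> jacobi_op \<alpha> \<beta>"

lemma degree_p: "degree (p k) = k" and I_p_p: "I (p k * p l) = (if k = l then 1 else 0)"
  using orthonormal by (auto simp: orthonormal_jacobi_def jacobi_inner_eq_functional)

text \<open>The constant polynomial of norm 1 forces this, since a non-integrable function would
  have integral 0.\<close>

lemma weight_integrable: "set_integrable lborel {-1..1} (jacobi_weight \<alpha> \<beta>)"
proof -
  obtain c where c: "p 0 = [:c:]" using degree_p[of 0] by (auto elim: degree_eq_zeroE)
  have 1: "(LINT x:{-1..1}|lborel. c * c * jacobi_weight \<alpha> \<beta> x) = 1"
    using I_p_p[of 0 0] by (simp add: c jacobi_functional_def)
  then have "set_integrable lborel {-1..1} (\<lambda>x. c * c * jacobi_weight \<alpha> \<beta> x)"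
    unfolding set_lebesgue_integral_def set_integrable_def
    by (metis not_integrable_integral_eq zero_neq_one)
  moreover have "c \<noteq> 0" using 1 by auto
  ultimately show ?thesis by simp
qed

lemma poly_weight_integrable: "set_integrable lborel {-1..1} (\<lambda>x. poly q x * jacobi_weight \<alpha> \<beta> x)"
  by (rule set_integrable_poly_times[OF weight_integrable])

lemma I_add: "I (q + r) = I q + I r" and I_diff: "I (q - r) = I q - I r"
  using poly_weight_integrable[of q] poly_weight_integrable[of r]
  by (simp_all add: jacobi_functional_def distrib_right left_diff_distrib)

lemma I_smult: "I (smult c q) = c * I q"
  by (simp add: jacobi_functional_def mult.assoc)

text \<open>Induction on m, cancelling the coefficient of index m by a multiple of
  \<open>p m\<close>. Bounding the degree through coefficients admits m = 0, where q is
  zero.\<close>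

lemma p_orthogonal:
  assumes "\<And>k. k \<ge> m \<Longrightarrow> coeff q k = 0" "m \<le> n"
  shows "I (p n * q) = 0"
  using assms
proof (induction m arbitrary: q)
  case 0
  then have "q = 0" by (simp add: poly_eq_iff)
  then show ?case by (simp add: jacobi_functional_def)
next
  case (Suc m)
  define c where "c = coeff q m / coeff (p m) m"
  have nz: "coeff (p m) m \<noteq> 0"
  proof -
    have "p m \<noteq> 0" using I_p_p[of m m] by (auto simp: jacobi_functional_def)
    then show ?thesis using leading_coeff_neq_0[of "p m"] degree_p[of m] by simp
  qed
  have "I (p n * (q - smult c (p m))) = 0"
  proof (rule Suc.IH)
    fix k assume "k \<ge> m"
    then consider "k = m" | "k \<ge> Suc m" by linarith
    then show "coeff (q - smult c (p m)) k = 0"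
      by cases (use nz Suc.prems(1)[of k] degree_p[of m] in \<open>auto simp: c_def coeff_eq_0\<close>)
  qed (use Suc.prems in simp)
  moreover have "I (p n * smult c (p m)) = 0"
    using Suc.prems(2) by (simp add: I_smult I_p_p)
  ultimately show ?case by (simp add: right_diff_distrib I_diff)
qed

text \<open>Lagrange's identity: w (b L a - a L b) is the derivative of w (1 - x^2) (a' b - a b'),
  which vanishes at both endpoints.\<close>

lemma L_symmetric: "I (L a * b) = I (a * L b)"
proof -
  define F where "F x = jacobi_weight \<alpha> \<beta> x * (1 - x\<^sup>2) * (poly (pderiv a * b - a * pderiv b) x)" for x
  define f where "f x = poly (L a * b - a * L b) x * jacobi_weight \<alpha> \<beta> x" for x
  have int: "set_integrable lborel {-1..1} f"
    unfolding f_def by (rule poly_weight_integrable)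
  have "(LBINT x=ereal (-1)..ereal 1. f x) = 0 - 0"
  proof (rule interval_integral_FTC_integrable)
    fix x :: real assume "ereal (-1) < ereal x" "ereal x < ereal 1"
    then have x: "-1 < x" "x < 1" by auto
    have "(F has_real_derivative jacobi_weight \<alpha> \<beta> x * (\<beta> - \<alpha> - (\<alpha> + \<beta> + 2) * x) * poly (pderiv a * b - a * pderiv b) x
       + poly (pderiv (pderiv a * b - a * pderiv b)) x * (jacobi_weight \<alpha> \<beta> x * (1 - x\<^sup>2))) (at x)"
      unfolding F_def by (intro DERIV_mult jacobi_weight_times_has_derivative x poly_DERIV)
    moreover have "jacobi_weight \<alpha> \<beta> x * (\<beta> - \<alpha> - (\<alpha> + \<beta> + 2) * x) * poly (pderiv a * b - a * pderiv b) x
       + poly (pderiv (pderiv a * b - a * pderiv b)) x * (jacobi_weight \<alpha> \<beta> x * (1 - x\<^sup>2)) = f x"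
      unfolding f_def poly_mult poly_diff poly_jacobi_op pderiv_mult pderiv_diff poly_add by algebra
    ultimately show "(F has_vector_derivative f x) (at x)"
      by (simp add: has_real_derivative_iff_has_vector_derivative)
    show "isCont f x"
      using x continuous_on_jacobi_weight[of \<alpha> \<beta>] unfolding f_def
      by (intro continuous_intros) (auto simp: continuous_on_eq_continuous_at)
  next
    show "set_integrable lborel (einterval (ereal (-1)) (ereal 1)) f"
      by (rule set_integrable_subset[OF int]) (auto simp: einterval_def)
  next
    have z: "((\<lambda>x. poly q x) \<longlongrightarrow> poly q y) (at y within S)" for q :: "real poly" and y S
      by (intro tendsto_poly tendsto_ident_at)
    have "((\<lambda>x. F x) \<longlongrightarrow> 0 * poly (pderiv a * b - a * pderiv b) (-1)) (at_right (-1))"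
      unfolding F_def using \<alpha>_ge \<beta>_ge by (intro tendsto_mult jacobi_weight_times_tendsto z) auto
    then show "((F \<circ> real_of_ereal) \<longlongrightarrow> 0) (at_right (ereal (-1)))"
      by (simp add: ereal_tendsto_simps1)
    have "((\<lambda>x. F x) \<longlongrightarrow> 0 * poly (pderiv a * b - a * pderiv b) 1) (at_left 1)"
      unfolding F_def using \<alpha>_ge \<beta>_ge by (intro tendsto_mult jacobi_weight_times_tendsto z) auto
    then show "((F \<circ> real_of_ereal) \<longlongrightarrow> 0) (at_left (ereal 1))"
      by (simp add: ereal_tendsto_simps1)
  qed auto
  then have "I (L a * b - a * L b) = 0"
    by (simp add: interval_integral_Icc jacobi_functional_def f_def)
  then show ?thesis by (simp add: I_diff)
qed

text \<open>Positivity is tested on [-1/2, 1/2], where the weight is continuous and positive; a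
  polynomial that vanishes there is zero.\<close>

lemma I_square_eq_0:
  assumes "I (r * r) = 0"
  shows "r = 0"
proof (rule ccontr)
  assume "r \<noteq> 0"
  let ?f = "\<lambda>x. poly (r * r) x * jacobi_weight \<alpha> \<beta> x"
  have nonneg: "?f x \<ge> 0" if "x \<in> {-1..1}" for x
    using jacobi_weight_nonneg[OF that, of \<alpha> \<beta>] by simp
  have cont: "continuous_on {-1/2..1/2} ?f"
    by (intro continuous_intros continuous_on_subset[OF continuous_on_jacobi_weight]) auto
  have "integral {-1/2..1/2} ?f \<le> 0"
    using integral_le_set_integral[OF poly_weight_integrable[of "r * r"] nonneg, of "-1/2" "1/2"] assms
    by (simp add: jacobi_functional_def)
  moreover have "integral {-1/2..1/2} ?f \<ge> 0"
    by (intro Henstock_Kurzweil_Integration.integral_nonneg integrable_continuous_interval cont nonneg) auto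
  ultimately have "integral {-1/2..1/2} ?f = 0" by linarith
  then have "\<forall>x\<in>{-1/2..1/2}. ?f x = 0"
    using integral_eq_0_iff[OF cont, of] nonneg by auto
  have "{-1/2..1/2} \<subseteq> {x. poly r x = 0}"
  proof
    fix x :: real assume x: "x \<in> {-1/2..1/2}"
    then have "?f x = 0" using \<open>\<forall>x\<in>{-1/2..1/2}. ?f x = 0\<close> by blast
    moreover have "jacobi_weight \<alpha> \<beta> x > 0" using x by (intro jacobi_weight_pos) auto
    ultimately show "x \<in> {x. poly r x = 0}" by simp
  qed
  moreover have "infinite {-1/2..(1/2::real)}" by (simp add: infinite_Icc)
  ultimately show False
    using poly_roots_finite[OF \<open>r \<noteq> 0\<close>] finite_subset by blast
qed

text \<open>The residual r has degree below n, and so has L r; thus \<open>p n\<close> is orthogonal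
  to both, and symmetry makes the norm of r zero.\<close>

lemma jacobi_ode: "L (p n) + smult (real n * (real n + \<alpha> + \<beta> + 1)) (p n) = 0"
proof -
  define \<Lambda> where "\<Lambda> = real n * (real n + \<alpha> + \<beta> + 1)"
  define r where "r = L (p n) + smult \<Lambda> (p n)"
  have r: "coeff r k = 0" if "k \<ge> n" for k
  proof (cases "k = n")
    case True
    then show ?thesis by (simp add: r_def coeff_jacobi_op \<Lambda>_def coeff_eq_0 degree_p)
  next
    case False
    then show ?thesis using that by (simp add: r_def coeff_jacobi_op coeff_eq_0 degree_p)
  qed
  have "I (L (p n) * r) = I (p n * L r)" by (rule L_symmetric)
  also have "\<dots> = 0"
    by (rule p_orthogonal[of n]) (auto simp: coeff_jacobi_op r)
  finally have "I (L (p n) * r) = 0" .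
  moreover have "I (p n * r) = 0" by (rule p_orthogonal[of n]) (auto simp: r)
  ultimately have "I (r * r) = 0"
    by (subst (1) r_def) (simp add: distrib_right I_add I_smult)
  then show ?thesis using I_square_eq_0 by (simp add: r_def \<Lambda>_def)
qed

lemma jacobi_solution_p: "jacobi_solution \<alpha> \<beta> n (p n)"
proof
  show "(1 - x\<^sup>2) * poly (pderiv (pderiv (p n))) x + (\<beta> - \<alpha> - (\<alpha> + \<beta> + 2) * x) * poly (pderiv (p n)) x
        + real n * (real n + \<alpha> + \<beta> + 1) * poly (p n) x = 0" for x
    using arg_cong[OF jacobi_ode[of n], of "\<lambda>q. poly q x"] by (simp add: poly_jacobi_op)
  fix a b :: real assume ab: "-1 < a" "a \<le> b" "b < 1"
  have "integral {a..b} (\<lambda>x. poly (p n * p n) x * jacobi_weight \<alpha> \<beta> x) \<le> I (p n * p n)"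
    unfolding jacobi_functional_def
    using ab jacobi_weight_nonneg[of _ \<alpha> \<beta>] by (intro integral_le_set_integral poly_weight_integrable) auto
  then show "integral {a..b} (\<lambda>x. jacobi_weight \<alpha> \<beta> x * (poly (p n) x)\<^sup>2) \<le> 1"
    by (simp add: I_p_p power2_eq_square mult_ac)
qed (fact \<alpha>_ge \<beta>_ge)+

end

text \<open>Reflection exchanges the exponents and the ends, so bounds are needed only to the left
  of the centre.\<close>

lemma jacobi_solution_reflect:
  assumes "jacobi_solution \<alpha> \<beta> n p"
  shows "jacobi_solution \<beta> \<alpha> n (pcompose p [:0, -1:])"
proof -
  interpret jacobi_solution \<alpha> \<beta> n p by fact
  let ?q = "pcompose p [:0, -1:]"
  have d1: "pderiv ?q = - pcompose (pderiv p) [:0, -1:]"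
    by (simp add: pderiv_pcompose pderiv_pCons)
  have d2: "pderiv (pderiv ?q) = pcompose (pderiv (pderiv p)) [:0, -1:]"
    by (simp add: d1 pderiv_minus pderiv_pcompose pderiv_pCons)
  show ?thesis
  proof
    show "(1 - x\<^sup>2) * poly (pderiv (pderiv ?q)) x + (\<alpha> - \<beta> - (\<beta> + \<alpha> + 2) * x) * poly (pderiv ?q) x
        + real n * (real n + \<beta> + \<alpha> + 1) * poly ?q x = 0" for x
      using ode[of "-x"] unfolding d2 unfolding d1 by (simp add: poly_pcompose algebra_simps)
    fix a b :: real assume ab: "-1 < a" "a \<le> b" "b < 1"
    have "integral {a..b} (\<lambda>x. jacobi_weight \<beta> \<alpha> x * (poly ?q x)\<^sup>2) =
      integral {a..b} (\<lambda>x. jacobi_weight \<alpha> \<beta> (- x) * (poly p (- x))\<^sup>2)"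
      by (simp add: jacobi_weight_def poly_pcompose mult_ac)
    also have "\<dots> = integral {- b..- a} (\<lambda>x. jacobi_weight \<alpha> \<beta> x * (poly p x)\<^sup>2)"
      using Henstock_Kurzweil_Integration.integral_reflect_real[of "-a" "-b" "\<lambda>x. jacobi_weight \<alpha> \<beta> x * (poly p x)\<^sup>2"] by simp
    also have "\<dots> \<le> 1" using ab by (intro mass_le_1) auto
    finally show "integral {a..b} (\<lambda>x. jacobi_weight \<beta> \<alpha> x * (poly ?q x)\<^sup>2) \<le> 1" .
  qed (fact \<alpha>_ge \<beta>_ge)+
qed

section \<open>First-order system\<close>

lemma DERIV_const_divide_two:
  fixes f :: "real \<Rightarrow> real"
  assumes "(f has_real_derivative f') (at x)" "f x \<noteq> 0"
  shows "((\<lambda>x. c / (2 * f x)) has_real_derivative - f' * (c / (2 * (f x)\<^sup>2))) (at x)"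
  using assms by (auto intro!: derivative_eq_intros simp: field_simps power2_eq_square)

lemma DERIV_square:
  "(f has_real_derivative f') (at x) \<Longrightarrow> ((\<lambda>x. (f x)\<^sup>2) has_real_derivative 2 * f x * f') (at x)"
  by (auto intro!: derivative_eq_intros)

context jacobi_solution begin

definition "S = \<alpha> + \<beta> + 1"
text \<open>For n at least 1 the zeros of \<open>Qhat\<close> are xc - r and xc + r, and its
  maximum, at xc, is A r^2.\<close>

definition "xc = \<sigma> * \<delta> / A"
definition "r = sqrt (\<mu> * (\<mu> + \<alpha> * \<beta>)) / A"
text \<open>In terms of \<open>F\<close> and with \<open>D = sqrt (1 - x\<^sup>2) d/dx = - d/d\<theta>\<close>, the functions below are
  \<open>G = F\<^sup>2\<close>, \<open>P = F DF\<close> and \<open>e = (DF)\<^sup>2 + q F\<^sup>2\<close>.\<close>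

definition "G x = sqrt (1 - x\<^sup>2) * v x"
definition "Y x = (1 - x\<^sup>2) * p1 x + (ell x - x / 2) * p0 x"
definition "P x = w x * p0 x * Y x"
definition "e x = w x / sqrt (1 - x\<^sup>2) * ((Y x)\<^sup>2 + Q x * (p0 x)\<^sup>2)"
definition "q x = A + 1/4 - (\<alpha>\<^sup>2 - 1/4) / (2 * (1 - x)) - (\<beta>\<^sup>2 - 1/4) / (2 * (1 + x))"
definition "q' x = (\<beta>\<^sup>2 - 1/4) / (2 * (1 + x)\<^sup>2) - (\<alpha>\<^sup>2 - 1/4) / (2 * (1 - x)\<^sup>2)"

lemma S_nonneg: "S \<ge> 0" using \<alpha>_ge \<beta>_ge by (simp add: S_def)

lemma Q_over_W: "-1 < x \<Longrightarrow> x < 1 \<Longrightarrow> Q x = q x * (1 - x\<^sup>2)"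
proof -
  assume x: "-1 < x" "x < 1"
  have W: "1 - x\<^sup>2 = (1 - x) * (1 + x)" by (simp add: power2_eq_square algebra_simps)
  have *: "(a - c / (2 * u) - d / (2 * t)) * (u * t) = a * (u * t) - c / 2 * t - d / 2 * u"
    if "u \<noteq> 0" "t \<noteq> 0" for a c d u t :: real
    using that by (simp add: field_simps)
  have "q x * (1 - x\<^sup>2) = (A + 1/4) * (1 - x\<^sup>2) - (\<alpha>\<^sup>2 - 1/4) / 2 * (1 + x) - (\<beta>\<^sup>2 - 1/4) / 2 * (1 - x)"
    using x unfolding q_def W by (intro *) auto
  also have "\<dots> = Q x"
    by (simp add: Q_def Qhat_def A_def ell_def \<sigma>_def \<delta>_def power2_eq_square field_simps)
  finally show ?thesis by simp
qed

lemma q_deriv: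
  assumes "-1 < x" "x < 1" shows "(q has_real_derivative q' x) (at x)"
proof -
  have "((\<lambda>x. 1 - x) has_real_derivative -1) (at x)" "((\<lambda>x. 1 + x) has_real_derivative 1) (at x)"
    by (auto intro!: derivative_eq_intros)
  note d = this
  have e: "0 - - (-1) * X - - 1 * Z = Z - X" for X Z :: real by simp
  have nz: "1 - x \<noteq> 0" "1 + x \<noteq> 0" using assms by auto
  show ?thesis
    unfolding q_def[abs_def] q'_def
    by (rule DERIV_cong[OF DERIV_diff[OF DERIV_diff[OF DERIV_const DERIV_const_divide_two[OF d(1) nz(1)]] DERIV_const_divide_two[OF d(2) nz(2)]]]) (rule e)
qed

lemma p1_eq: "(1 - x\<^sup>2) * p1 x = Y x - (ell x - x / 2) * p0 x"
  by (simp add: Y_def)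

lemma Y_deriv:
  assumes "-1 < x" "x < 1"
  shows "(Y has_real_derivative (- (ell x + x / 2) * Y x - Q x * p0 x) / (1 - x\<^sup>2)) (at x)"
proof -
  have W: "1 - x\<^sup>2 > 0" by (rule one_minus_square_pos[OF assms])
  have "(Y has_real_derivative (1 - x\<^sup>2) * p2 x - 2 * x * p1 x + (- \<sigma> - 1 / 2) * p0 x + (ell x - x / 2) * p1 x) (at x)"
    unfolding Y_def[abs_def] by (auto intro!: derivative_eq_intros p_derivs ell_deriv simp: power2_eq_square algebra_simps)
  moreover have "(1 - x\<^sup>2) * p2 x - 2 * x * p1 x + (- \<sigma> - 1 / 2) * p0 x + (ell x - x / 2) * p1 x
     = (- (ell x + x / 2) * Y x - Q x * p0 x) / (1 - x\<^sup>2)"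
    unfolding p2_eq Y_def Q_def Qhat_def using W by (simp add: field_simps power2_eq_square)
  ultimately show ?thesis by simp
qed

lemma p0_deriv:
  assumes "-1 < x" "x < 1"
  shows "(p0 has_real_derivative (Y x - (ell x - x / 2) * p0 x) / (1 - x\<^sup>2)) (at x)"
proof -
  have W: "1 - x\<^sup>2 > 0" by (rule one_minus_square_pos[OF assms])
  have "p1 x = (Y x - (ell x - x / 2) * p0 x) / (1 - x\<^sup>2)"
    unfolding p1_eq[symmetric] using W by simp
  then show ?thesis using p_derivs(1)[of x] by simp
qed

lemma w_deriv:
  assumes "-1 < x" "x < 1"
  shows "(w has_real_derivative w x * (2 * ell x) / (1 - x\<^sup>2)) (at x)"
  by (rule DERIV_cong[OF jacobi_weight_has_derivative[OF assms]])
     (simp add: ell_def \<sigma>_def \<delta>_def left_diff_distrib diff_divide_distrib)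

lemma sqrtW_deriv:
  assumes "-1 < x" "x < 1"
  shows "((\<lambda>x. sqrt (1 - x\<^sup>2)) has_real_derivative - x / sqrt (1 - x\<^sup>2)) (at x)"
  using one_minus_square_pos[OF assms] by (auto intro!: derivative_eq_intros simp: field_simps)

lemma P_deriv:
  assumes "-1 < x" "x < 1"
  shows "(P has_real_derivative w x / (1 - x\<^sup>2) * ((Y x)\<^sup>2 - Q x * (p0 x)\<^sup>2)) (at x)"
proof -
  have W: "1 - x\<^sup>2 \<noteq> 0" using one_minus_square_pos[OF assms] by simp
  have *: "(c * (2 * l) / W * p + (y - (l - x / 2) * p) / W * c) * y + (- (l + x / 2) * y - t * p) / W * (c * p)
      = c / W * (y\<^sup>2 - t * p\<^sup>2)" if "W \<noteq> 0" for c l W p y t :: real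
    using that by (simp add: field_simps power2_eq_square)
  show ?thesis unfolding P_def[abs_def]
    by (rule DERIV_cong[OF DERIV_mult[OF DERIV_mult[OF w_deriv[OF assms] p0_deriv[OF assms]] Y_deriv[OF assms]]])
       (rule *[OF W])
qed

lemma G_deriv:
  assumes "-1 < x" "x < 1"
  shows "(G has_real_derivative 2 * P x / sqrt (1 - x\<^sup>2)) (at x)"
proof -
  define s where "s = sqrt (1 - x\<^sup>2)"
  have s: "s > 0" "1 - x\<^sup>2 = s * s" using one_minus_square_pos[OF assms] by (auto simp: s_def)
  have *: "(- x / s) * (c * p\<^sup>2) + (c * (2 * l) / (s * s) * p\<^sup>2
      + 2 * p * ((y - (l - x / 2) * p) / (s * s)) * c) * s = 2 * (c * p * y) / s" for c l p y
    using s(1) by (simp add: field_simps power2_eq_square)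
  show ?thesis
    unfolding G_def[abs_def] v_def P_def
    by (rule DERIV_cong[OF DERIV_mult[OF sqrtW_deriv[OF assms]
          DERIV_mult[OF w_deriv[OF assms] DERIV_square[OF p0_deriv[OF assms]]]]])
       (unfold s_def[symmetric], unfold s(2), rule *)
qed

text \<open>The energy of the oscillator F'' + q F = 0 changes only through the explicit dependence
  of \<open>q\<close> on the position.\<close>

lemma e_deriv:
  assumes "-1 < x" "x < 1"
  shows "(e has_real_derivative q' x * G x) (at x)"
proof -
  define s where "s = sqrt (1 - x\<^sup>2)"
  have s: "s > 0" "1 - x\<^sup>2 = s * s" using one_minus_square_pos[OF assms] by (auto simp: s_def)
  have Qd: "(Q has_real_derivative q' x * (1 - x\<^sup>2) + (- 2 * x) * q x) (at x)"
  proof (rule has_field_derivative_transform_within[where d = "min (1 - x) (1 + x)"])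
    have "((\<lambda>x. 1 - x\<^sup>2) has_real_derivative - 2 * x) (at x)"
      by (auto intro!: derivative_eq_intros)
    from DERIV_mult[OF q_deriv[OF assms] this]
    show "((\<lambda>x. q x * (1 - x\<^sup>2)) has_real_derivative q' x * (1 - x\<^sup>2) + (- 2 * x) * q x) (at x)" .
    show "0 < min (1 - x) (1 + x)" using assms by simp
    show "q y * (1 - y\<^sup>2) = Q y" if "dist y x < min (1 - x) (1 + x)" for y :: real
      using that by (subst Q_over_W) (auto simp: dist_real_def)
  qed simp
  have s0: "sqrt (1 - x\<^sup>2) \<noteq> 0" using s(1) by (simp add: s_def)
  have *: "(c * (2 * l) / (s * s) * s - c * (- x / s)) / (s * s) * (y\<^sup>2 + k * (s * s) * p\<^sup>2)
     + (2 * y * ((- (l + x / 2) * y - k * (s * s) * p) / (s * s))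
        + ((k' * (s * s) + (- 2 * x) * k) * p\<^sup>2 + 2 * p * ((y - (l - x / 2) * p) / (s * s)) * (k * (s * s))))
        * (c / s) = k' * (s * (c * p\<^sup>2))" for c l y k k' p
  proof -
    have 1: "(c * (2 * l) / (s * s) * s - c * (- x / s)) / (s * s) = (c / s) * ((2 * l + x) / (s * s))"
      using s(1) by (simp add: field_simps)
    have 2: "2 * y * ((- (l + x / 2) * y - k * (s * s) * p) / (s * s)) = - ((2 * l + x) / (s * s)) * y\<^sup>2 - 2 * y * k * p"
      using s(1) by (simp add: field_simps power2_eq_square)
    have 3: "2 * p * ((y - (l - x / 2) * p) / (s * s)) * (k * (s * s)) = 2 * p * y * k - (2 * l - x) * k * p\<^sup>2"
      using s(1) by (simp add: field_simps power2_eq_square)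
    have 4: "((2 * l + x) / (s * s)) * (k * (s * s) * p\<^sup>2) = (2 * l + x) * k * p\<^sup>2"
      using s(1) by simp
    have 5: "(c / s) * (s * s) = s * c" using s(1) by simp
    have "a * z * (y\<^sup>2 + t) + (b + (u + d)) * a = a * (z * y\<^sup>2 + z * t + b + u + d)" for a b d t u z :: real
      by algebra
    then show ?thesis unfolding 1 2 3 using 4 5 by algebra
  qed
  show ?thesis
    unfolding e_def[abs_def] G_def v_def
    by (rule DERIV_cong[OF DERIV_mult[OF DERIV_divide[OF w_deriv[OF assms] sqrtW_deriv[OF assms] s0]
          DERIV_add[OF DERIV_square[OF Y_deriv[OF assms]] DERIV_mult[OF Qd DERIV_square[OF p0_deriv[OF assms]]]]]])
       (unfold Q_over_W[OF assms], unfold s_def[symmetric], unfold s(2), rule *)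
qed

lemma G_nonneg: "-1 < x \<Longrightarrow> x < 1 \<Longrightarrow> G x \<ge> 0"
  using v_nonneg one_minus_square_pos[of x] by (simp add: G_def)

lemma e_ge: assumes x: "-1 < x" "x < 1" shows "q x * G x \<le> e x"
proof -
  define s where "s = sqrt (1 - x\<^sup>2)"
  have s: "s > 0" "1 - x\<^sup>2 = s * s" using one_minus_square_pos[OF x] by (auto simp: s_def)
  have "e x - q x * G x = w x / s * (Y x)\<^sup>2"
    using s(1) unfolding e_def G_def v_def Q_over_W[OF x] unfolding s_def[symmetric] unfolding s(2)
    by (simp add: field_simps)
  moreover have "\<dots> \<ge> 0" using s jacobi_weight_pos[OF x, of \<alpha> \<beta>] by simp
  ultimately show ?thesis by simp
qed

end

section \<open>Parameters and the second moment\<close>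

context jacobi_solution begin

text \<open>Measures the excess of S over the degree; A / \<mu> and 1 / r turn out to be bounded by
  multiples of it.\<close>

definition "\<Psi> = max 1 (S / (real n + 1))"

lemma \<sigma>_eq: "\<sigma> = (S - 1) / 2"
  by (simp add: \<sigma>_def S_def)

lemma \<mu>_eq: "\<mu> = (real n)\<^sup>2 - 1/2 + (real n + 1/2) * S"
  by (simp add: \<mu>_def \<sigma>_def S_def power2_eq_square field_simps)

lemma A_eq: "A = (real n + S / 2)\<^sup>2 - 1/4"
  by (simp add: A_def \<mu>_eq \<sigma>_eq power2_eq_square field_simps)

lemma \<alpha>\<beta>_eq: "\<alpha> * \<beta> = \<sigma>\<^sup>2 - \<delta>\<^sup>2"
  by (simp add: \<sigma>_def \<delta>_def power2_eq_square field_simps)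

lemma \<alpha>\<beta>_ge: "\<alpha> * \<beta> \<ge> 1/4 - S / 2"
proof -
  have "(\<alpha> + 1/2) * (\<beta> + 1/2) \<ge> 0" using \<alpha>_ge \<beta>_ge by simp
  then show ?thesis by (simp add: S_def field_simps)
qed

end

text \<open>For n = 0 one has \<open>\<mu> = (S - 1) / 2\<close>, possibly negative, and
  \<open>Qhat\<close> need not be positive anywhere.\<close>

locale jacobi_solution_pos = jacobi_solution +
  assumes n: "n \<ge> 1"
begin

lemma \<mu>_ge: "\<mu> \<ge> 1/2 + 3/2 * S" and \<mu>_ge_n: "\<mu> \<ge> (real n)\<^sup>2 / 2 + 3/4 * (real n + 1) * S"
proof -
  have 1: "real n \<ge> 1" using n by simp
  have 2: "(real n)\<^sup>2 \<ge> 1" using 1 by simp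
  have "real n + 1/2 \<ge> 3/2" "real n + 1/2 \<ge> 3/4 * (real n + 1)" using 1 by (auto simp: field_simps)
  from this[THEN mult_right_mono, OF S_nonneg]
  show "\<mu> \<ge> 1/2 + 3/2 * S" "\<mu> \<ge> (real n)\<^sup>2 / 2 + 3/4 * (real n + 1) * S"
    unfolding \<mu>_eq using 2 by linarith+
qed

lemma \<mu>_pos: "\<mu> > 0"
  using \<mu>_ge S_nonneg by linarith

lemma T_ge: "\<mu> + \<alpha> * \<beta> \<ge> (real n)\<^sup>2 - 1/4 + real n * S"
  using \<alpha>\<beta>_ge unfolding \<mu>_eq by (simp add: algebra_simps)

lemma T_ge_half_\<mu>: "\<mu> + \<alpha> * \<beta> \<ge> \<mu> / 2"
  using \<alpha>\<beta>_ge \<mu>_ge S_nonneg by linarith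

lemma T_pos: "\<mu> + \<alpha> * \<beta> > 0"
  using T_ge_half_\<mu> \<mu>_pos by linarith

lemma A_ge: "A \<ge> 3/4"
proof -
  have "real n + S / 2 \<ge> 1" using n S_nonneg by simp
  then have "(real n + S / 2)\<^sup>2 \<ge> 1" by simp
  then show ?thesis by (simp add: A_eq)
qed

lemma r_square: "r\<^sup>2 = \<mu> * (\<mu> + \<alpha> * \<beta>) / A\<^sup>2"
  using \<mu>_pos T_pos by (simp add: r_def power_divide)

lemma A_r_square: "A * r\<^sup>2 = \<mu> * (\<mu> + \<alpha> * \<beta>) / A"
  using A_ge unfolding r_square by (simp add: power2_eq_square)

lemma r_pos: "r > 0"
  using \<mu>_pos T_pos A_ge by (simp add: r_def)

text \<open>Absorbs the additive 2 in the second-moment estimate: 2 A r^2 + 2 is at most 6 A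
  r^2.\<close>

lemma A_r_square_ge: "A * r\<^sup>2 \<ge> 1/2"
proof -
  have 1: "2 * (\<mu> + \<alpha> * \<beta>) - 1 \<ge> 1/2 + S"
  proof -
    define a where "a = real n * S"
    define b where "b = (real n)\<^sup>2"
    have "a \<ge> 1 * S" unfolding a_def using n S_nonneg by (intro mult_right_mono) auto
    moreover have "b \<ge> 1" using n by (simp add: b_def)
    moreover define T where "T = \<mu> + \<alpha> * \<beta>"
    ultimately show ?thesis
      using T_ge S_nonneg unfolding a_def[symmetric] b_def[symmetric] T_def[symmetric] by linarith
  qed
  have "(1/2 + 3/2 * S) * (1/2 + S) \<le> \<mu> * (2 * (\<mu> + \<alpha> * \<beta>) - 1)"
    using 1 \<mu>_ge S_nonneg by (intro mult_mono) auto
  moreover have "\<sigma>\<^sup>2 \<le> (1/2 + 3/2 * S) * (1/2 + S)"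
    using S_nonneg by (simp add: \<sigma>_eq power2_eq_square field_simps)
  ultimately have "A \<le> 2 * (\<mu> * (\<mu> + \<alpha> * \<beta>))"
    by (simp add: A_def algebra_simps)
  then show ?thesis using A_ge by (simp add: A_r_square field_simps)
qed

text \<open>The difference of A and \<mu> is about S^2 / 4; S^2 is at most (n + 1) S \<Psi>, and (n
  + 1) S at most 4/3 \<mu>.\<close>

lemma A_le: "A \<le> 2 * \<mu> * \<Psi>"
proof -
  have n1: "real n + 1 > 0" by simp
  have a: "\<sigma>\<^sup>2 \<le> S * S / 4 + 1/4"
    using S_nonneg by (simp add: \<sigma>_eq power2_eq_square field_simps)
  have "S / (real n + 1) \<le> \<Psi>" by (simp add: \<Psi>_def)
  then have "S \<le> (real n + 1) * \<Psi>"
    using n1 by (simp add: pos_divide_le_eq mult.commute)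
  then have "S * S \<le> S * ((real n + 1) * \<Psi>)"
    using S_nonneg by (intro mult_left_mono) auto
  also have "\<dots> \<le> 4/3 * \<mu> * \<Psi>"
  proof -
    have "(real n + 1) * S \<le> 4/3 * \<mu>" using \<mu>_ge_n zero_le_power2[of "real n"] by linarith
    moreover have "\<Psi> \<ge> 0" by (simp add: \<Psi>_def)
    ultimately have "(real n + 1) * S * \<Psi> \<le> 4/3 * \<mu> * \<Psi>" by (rule mult_right_mono)
    then show ?thesis by (simp add: mult_ac)
  qed
  finally have "\<sigma>\<^sup>2 \<le> \<mu> * \<Psi> / 3 + 1/4" using a by linarith
  moreover have "\<mu> \<le> \<mu> * \<Psi>" using \<mu>_pos by (simp add: \<Psi>_def)
  moreover have "1/2 \<le> \<mu>" using \<mu>_ge S_nonneg by linarith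
  ultimately show ?thesis unfolding A_def by linarith
qed

lemma one_plus_xc: "1 + xc = (\<mu> + \<sigma> * \<beta>) / A" and one_minus_xc: "1 - xc = (\<mu> + \<sigma> * \<alpha>) / A"
proof -
  have "A + \<sigma> * \<delta> = \<mu> + \<sigma> * \<beta>" "A - \<sigma> * \<delta> = \<mu> + \<sigma> * \<alpha>"
    by (simp_all add: A_def \<sigma>_def \<delta>_def power2_eq_square field_simps)
  then show "1 + xc = (\<mu> + \<sigma> * \<beta>) / A" "1 - xc = (\<mu> + \<sigma> * \<alpha>) / A"
    using A_ge unfolding xc_def by (simp_all add: field_simps)
qed

lemma \<sigma>_mult_ge: "a \<ge> -1/2 \<Longrightarrow> a \<le> S - 1/2 \<Longrightarrow> \<mu> + \<sigma> * a \<ge> \<mu> / 2"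
proof -
  assume a: "a \<ge> -1/2" "a \<le> S - 1/2"
  have "S * (a + 1/2) \<ge> 0" using S_nonneg a by simp
  then have "\<sigma> * a \<ge> - 3/4 * S + 1/4"
    using a by (simp add: \<sigma>_eq field_simps)
  then show ?thesis using \<mu>_ge by linarith
qed

lemma \<mu>\<sigma>_ge: "\<mu> + \<sigma> * \<alpha> \<ge> \<mu> / 2" "\<mu> + \<sigma> * \<beta> \<ge> \<mu> / 2"
  using \<alpha>_ge \<beta>_ge by (intro \<sigma>_mult_ge; simp add: S_def)+

lemma xc_bounds: "-1 < xc" "xc < 1"
proof -
  have "1 + xc > 0" "1 - xc > 0"
    unfolding one_plus_xc one_minus_xc using \<mu>\<sigma>_ge \<mu>_pos A_ge by (auto intro!: divide_pos_pos)
  then show "-1 < xc" "xc < 1" by auto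
qed

text \<open>Compares 1 - x^2 at the centre with the squared half-width of the oscillatory interval,
  at the cost of the ratio A / \<mu>.\<close>

lemma W_xc_le: "1 - xc\<^sup>2 \<le> 6 * r\<^sup>2 * A / \<mu>"
proof -
  have "1 - xc\<^sup>2 = (1 + xc) * (1 - xc)" by (simp add: power2_eq_square algebra_simps)
  also have "\<dots> = (\<mu> + \<sigma> * \<beta>) * (\<mu> + \<sigma> * \<alpha>) / A\<^sup>2"
    unfolding one_plus_xc one_minus_xc by (simp add: power2_eq_square)
  also have "\<dots> \<le> 6 * A * (\<mu> + \<alpha> * \<beta>) / A\<^sup>2"
  proof (rule divide_right_mono)
    have ab: "\<alpha> * \<beta> \<ge> - \<mu> / 3" using \<alpha>\<beta>_ge \<mu>_ge S_nonneg by linarith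
    have "6 * A * (\<mu> + \<alpha> * \<beta>) - (\<mu> + \<sigma> * \<beta>) * (\<mu> + \<sigma> * \<alpha>)
        = \<mu> * (5 * \<mu> + 6 * (\<alpha> * \<beta>)) + \<sigma>\<^sup>2 * (4 * \<mu> + 5 * (\<alpha> * \<beta>))"
    proof -
      have "\<alpha> + \<beta> = 2 * \<sigma>" by (simp add: \<sigma>_def)
      then show ?thesis unfolding A_def by algebra
    qed
    moreover have "\<mu> * (5 * \<mu> + 6 * (\<alpha> * \<beta>)) \<ge> 0" "\<sigma>\<^sup>2 * (4 * \<mu> + 5 * (\<alpha> * \<beta>)) \<ge> 0"
      using ab \<mu>_pos by auto
    ultimately show "(\<mu> + \<sigma> * \<beta>) * (\<mu> + \<sigma> * \<alpha>) \<le> 6 * A * (\<mu> + \<alpha> * \<beta>)" by linarith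
  qed simp
  also have "\<dots> = 6 * r\<^sup>2 * A / \<mu>"
    using A_ge \<mu>_pos unfolding r_square by (simp add: field_simps power2_eq_square)
  finally show ?thesis .
qed

lemma Qhat_eq: "Qhat x = A * (r\<^sup>2 - (x - xc)\<^sup>2)"
proof -
  have A0: "A \<noteq> 0" using A_ge by simp
  have x: "A * xc = \<sigma> * \<delta>" using A0 by (simp add: xc_def)
  have "A * (A * r\<^sup>2) = \<mu> * (\<mu> + (\<sigma>\<^sup>2 - \<delta>\<^sup>2))" using A0 by (simp add: A_r_square \<alpha>\<beta>_eq)
  then have "A * (A * (r\<^sup>2 - (x - xc)\<^sup>2)) = A * Qhat x"
    using x A_def unfolding Qhat_def ell_def by algebra
  then show ?thesis using A0 by simp
qed

lemma Qhat'_eq: "Qhat' x = - 2 * A * (x - xc)"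
proof -
  have x: "A * xc = \<sigma> * \<delta>" using A_ge by (simp add: xc_def)
  show ?thesis unfolding Qhat'_def ell_def using x A_def by algebra
qed

text \<open>At 1 and -1 the quadratic \<open>Qhat\<close> is minus a square, so both lie outside the
  open oscillatory interval.\<close>

lemma r_le: "r \<le> 1 - xc" "r \<le> 1 + xc"
proof -
  have "Qhat 1 \<le> 0" "Qhat (-1) \<le> 0" by (simp_all add: Qhat_def)
  moreover have "(-1 - xc)\<^sup>2 = (1 + xc)\<^sup>2" by (simp add: power2_eq_square algebra_simps)
  ultimately have "r\<^sup>2 \<le> (1 - xc)\<^sup>2" "r\<^sup>2 \<le> (1 + xc)\<^sup>2"
    unfolding Qhat_eq using A_ge by (auto simp: mult_le_0_iff)
  then show "r \<le> 1 - xc" "r \<le> 1 + xc"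
    using xc_bounds by (auto elim!: power2_le_imp_le)
qed

text \<open>Boundary energies are removed by letting the free endpoint run to -1 here, to 1 in the
  next lemma; there the factor \<open>s\<close> admits either sign.\<close>

lemma le_of_energy_left:
  assumes "\<And>a. -1 < a \<Longrightarrow> a < a0 \<Longrightarrow> c \<le> K + energy (h a) (h1 a) (h2 a) a" "-1 < a0"
    and "(h \<longlongrightarrow> k) (at_right (-1))" "(h1 \<longlongrightarrow> k1) (at_right (-1))" "(h2 \<longlongrightarrow> k2) (at_right (-1))"
  shows "c \<le> K"
proof -
  have "((\<lambda>a. K + energy (h a) (h1 a) (h2 a) a) \<longlongrightarrow> K + 0) (at_right (-1))"
    by (intro tendsto_intros energy_tendsto[OF assms(3-5)]) simp
  moreover have "\<forall>\<^sub>F a in at_right (-1). c \<le> K + energy (h a) (h1 a) (h2 a) a"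
    using assms(1,2) by (auto simp: eventually_at_right_field)
  ultimately show ?thesis
    by (intro tendsto_lowerbound[of _ K "at_right (-1)"]) auto
qed

lemma le_of_energy_right:
  assumes "\<And>b. b0 < b \<Longrightarrow> b < 1 \<Longrightarrow> c \<le> K + s * energy (h b) (h1 b) (h2 b) b" "b0 < 1"
    and "(h \<longlongrightarrow> k) (at_left 1)" "(h1 \<longlongrightarrow> k1) (at_left 1)" "(h2 \<longlongrightarrow> k2) (at_left 1)"
  shows "c \<le> K"
proof -
  have "((\<lambda>b. K + s * energy (h b) (h1 b) (h2 b) b) \<longlongrightarrow> K + s * 0) (at_left 1)"
    by (intro tendsto_intros energy_tendsto[OF assms(3-5)]) simp
  moreover have "\<forall>\<^sub>F b in at_left 1. c \<le> K + s * energy (h b) (h1 b) (h2 b) b"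
    using assms(1,2) by (auto simp: eventually_at_left_field)
  ultimately show ?thesis
    by (intro tendsto_lowerbound[of _ K "at_left 1"]) auto
qed

text \<open>A virial identity: for h = x - xc the rate is (2 A r^2 + 3 x^2 - 1 - 4 A (x - xc)^2) v.
  As the mass is at most 1 and 3 x^2 - 1 at most 2, vanishing boundary terms leave 4 A times the
  moment at most 2 A r^2 + 2.\<close>

lemma second_moment:
  assumes ab: "-1 < a" "a \<le> b" "b < 1"
  shows "integral {a..b} (\<lambda>x. (x - xc)\<^sup>2 * v x) \<le> 3/2 * r\<^sup>2"
proof -
  let ?J = "\<lambda>a b. integral {a..b} (\<lambda>x. (x - xc)\<^sup>2 * v x)"
  \<comment> \<open>The interval is widened because the energies vanish only in the limit at -1 and
    1; the moment does not decrease under this.\<close>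
  have step: "4 * A * ?J a b \<le> 2 * A * r\<^sup>2 + 2 + energy (a' - xc) 1 0 a' + (-1) * energy (b' - xc) 1 0 b'"
    if a': "-1 < a'" "a' \<le> a" and b': "b \<le> b'" "b' < 1" for a' b'
  proof -
    have le: "a' \<le> b'" using a' b' ab by simp
    have "((\<lambda>x. (2 * Qhat x * 1 + Qhat' x * (x - xc)
        + ((1 - x\<^sup>2)\<^sup>2 * 0 - 6 * x * (1 - x\<^sup>2) * 0 + (6 * x\<^sup>2 - 2) * 1) / 2) * v x)
        has_integral energy (b' - xc) 1 0 b' - energy (a' - xc) 1 0 a') {a'..b'}"
      using a' b' le by (intro energy_diff) (auto intro!: derivative_eq_intros)
    moreover have "2 * Qhat x * 1 + Qhat' x * (x - xc)
        + ((1 - x\<^sup>2)\<^sup>2 * 0 - 6 * x * (1 - x\<^sup>2) * 0 + (6 * x\<^sup>2 - 2) * 1) / 2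
        = (2 * A * r\<^sup>2 + (3 * x\<^sup>2 - 1)) - 4 * A * (x - xc)\<^sup>2" for x
      unfolding Qhat_eq Qhat'_eq by (simp add: power2_eq_square field_simps)
    ultimately have 1: "((\<lambda>x. ((2 * A * r\<^sup>2 + (3 * x\<^sup>2 - 1)) - 4 * A * (x - xc)\<^sup>2) * v x)
        has_integral energy (b' - xc) 1 0 b' - energy (a' - xc) 1 0 a') {a'..b'}"
      by (simp only:)
    have "4 * A * ?J a b \<le> 4 * A * ?J a' b'"
      using A_ge a' b' ab
      by (intro mult_left_mono integral_subset_le integrable_times_v continuous_intros) (auto intro!: v_nonneg mult_nonneg_nonneg)
    also have "\<dots> = integral {a'..b'} (\<lambda>x. 4 * A * ((x - xc)\<^sup>2 * v x))" by simp
    also have "\<dots> \<le> integral {a'..b'} (\<lambda>x. (2 * A * r\<^sup>2 + 2) * v x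
        - ((2 * A * r\<^sup>2 + (3 * x\<^sup>2 - 1)) - 4 * A * (x - xc)\<^sup>2) * v x)"
    proof (rule integral_le)
      show "(\<lambda>x. 4 * A * ((x - xc)\<^sup>2 * v x)) integrable_on {a'..b'}"
        using a' b' integrable_times_v[of a' b' "\<lambda>x. 4 * A * (x - xc)\<^sup>2"] by (simp add: mult.assoc continuous_intros)
      show "(\<lambda>x. (2 * A * r\<^sup>2 + 2) * v x - ((2 * A * r\<^sup>2 + (3 * x\<^sup>2 - 1)) - 4 * A * (x - xc)\<^sup>2) * v x) integrable_on {a'..b'}"
        using a' b' by (intro integrable_diff integrable_times_v continuous_intros)
      fix x assume x: "x \<in> {a'..b'}"
      then have "x\<^sup>2 \<le> 1" using one_minus_square_pos[of x] a' b' by simp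
      then have "(4 * A * (x - xc)\<^sup>2) * v x \<le> ((2 * A * r\<^sup>2 + 2) - ((2 * A * r\<^sup>2 + (3 * x\<^sup>2 - 1)) - 4 * A * (x - xc)\<^sup>2)) * v x"
        using x a' b' by (intro mult_right_mono v_nonneg) auto
      then show "4 * A * ((x - xc)\<^sup>2 * v x) \<le> (2 * A * r\<^sup>2 + 2) * v x
        - ((2 * A * r\<^sup>2 + (3 * x\<^sup>2 - 1)) - 4 * A * (x - xc)\<^sup>2) * v x"
        by (simp only: left_diff_distrib mult.assoc)
    qed
    also have "\<dots> = (2 * A * r\<^sup>2 + 2) * integral {a'..b'} v - (energy (b' - xc) 1 0 b' - energy (a' - xc) 1 0 a')"
      using a' b' 1 integrable_times_v[of a' b' "\<lambda>_. 2 * A * r\<^sup>2 + 2"]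
      by (subst integral_diff) (auto simp: integral_unique has_integral_integrable continuous_intros)
    also have "\<dots> \<le> (2 * A * r\<^sup>2 + 2) * 1 - (energy (b' - xc) 1 0 b' - energy (a' - xc) 1 0 a')"
      using A_ge a' b' le by (intro diff_right_mono mult_left_mono integral_v_le_1) auto
    finally show ?thesis by simp
  qed
  have "4 * A * ?J a b \<le> 2 * A * r\<^sup>2 + 2 + energy (a' - xc) 1 0 a'" if "-1 < a'" "a' < a" for a'
    by (rule le_of_energy_right[where ?b0.0 = b and h = "\<lambda>b. b - xc" and ?h1.0 = "\<lambda>_. 1" and ?h2.0 = "\<lambda>_. 0" and s = "-1"])
       (use that ab step[of a'] in \<open>auto intro!: tendsto_eq_intros\<close>)
  then have "4 * A * ?J a b \<le> 2 * A * r\<^sup>2 + 2"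
    by (rule le_of_energy_left[where ?a0.0 = a and h = "\<lambda>b. b - xc" and ?h1.0 = "\<lambda>_. 1" and ?h2.0 = "\<lambda>_. 0"])
       (use ab in \<open>auto intro!: tendsto_eq_intros\<close>)
  also have "\<dots> \<le> 4 * A * (3/2 * r\<^sup>2)" using A_r_square_ge by simp
  finally show ?thesis using A_ge by simp
qed

end

section \<open>Bounds away from the turning point\<close>

lemma square_le_quarter: "\<bar>t\<bar> \<le> 1/2 \<Longrightarrow> t\<^sup>2 \<le> 1/4" for t :: real
  using abs_le_square_iff[of t "1/2"] by (simp add: power2_eq_square)

context jacobi_solution_pos begin

text \<open>A multiplier is useful as soon as its rate is bounded below: integration from x0 to b,
  followed by b -> 1, removes the energy on the right.\<close>

lemma energy_le:
  assumes x0: "-1 < x0" "x0 < 1"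
    and h: "\<And>x. x0 \<le> x \<Longrightarrow> x < 1 \<Longrightarrow> (h has_real_derivative h1 x) (at x)"
      "\<And>x. x0 \<le> x \<Longrightarrow> x < 1 \<Longrightarrow> (h1 has_real_derivative h2 x) (at x)"
      "\<And>x. x0 \<le> x \<Longrightarrow> x < 1 \<Longrightarrow> (h2 has_real_derivative h3 x) (at x)"
    and lim: "(h \<longlongrightarrow> k) (at_left 1)" "(h1 \<longlongrightarrow> k1) (at_left 1)" "(h2 \<longlongrightarrow> k2) (at_left 1)"
    and rate: "\<And>x. x0 \<le> x \<Longrightarrow> x < 1 \<Longrightarrow> - g x \<le> 2 * Qhat x * h1 x + Qhat' x * h x
      + ((1 - x\<^sup>2)\<^sup>2 * h3 x - 6 * x * (1 - x\<^sup>2) * h2 x + (6 * x\<^sup>2 - 2) * h1 x) / 2"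
    and g: "continuous_on {x0..<1} g"
    and K: "\<And>b. x0 < b \<Longrightarrow> b < 1 \<Longrightarrow> integral {x0..b} (\<lambda>x. g x * v x) \<le> K"
  shows "energy (h x0) (h1 x0) (h2 x0) x0 \<le> K"
proof (rule le_of_energy_right[where s = 1 and ?b0.0 = x0, OF _ x0(2) lim])
  fix b assume b: "x0 < b" "b < 1"
  define D where "D x = 2 * Qhat x * h1 x + Qhat' x * h x
      + ((1 - x\<^sup>2)\<^sup>2 * h3 x - 6 * x * (1 - x\<^sup>2) * h2 x + (6 * x\<^sup>2 - 2) * h1 x) / 2" for x
  have D: "((\<lambda>x. D x * v x) has_integral energy (h b) (h1 b) (h2 b) b - energy (h x0) (h1 x0) (h2 x0) x0) {x0..b}"
    unfolding D_def using x0 b by (intro energy_diff h) auto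
  have g': "(\<lambda>x. g x * v x) integrable_on {x0..b}"
    using x0 b by (intro integrable_times_v continuous_on_subset[OF g]) auto
  have "integral {x0..b} (\<lambda>x. - (g x * v x)) \<le> integral {x0..b} (\<lambda>x. D x * v x)"
  proof (rule integral_le)
    show "(\<lambda>x. - (g x * v x)) integrable_on {x0..b}" using g' by (rule integrable_neg)
    show "(\<lambda>x. D x * v x) integrable_on {x0..b}" using D by blast
    fix x assume x: "x \<in> {x0..b}"
    have "- g x * v x \<le> D x * v x"
      using x x0 b rate[of x] by (intro mult_right_mono v_nonneg) (auto simp: D_def)
    then show "- (g x * v x) \<le> D x * v x" by simp
  qed
  then have "- integral {x0..b} (\<lambda>x. g x * v x) \<le> energy (h b) (h1 b) (h2 b) b - energy (h x0) (h1 x0) (h2 x0) x0"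
    using integral_unique[OF D] by simp
  then show "energy (h x0) (h1 x0) (h2 x0) x0 \<le> K + 1 * energy (h b) (h1 b) (h2 b) b"
    using K[OF b] by simp
qed

text \<open>Mass and second moment together integrate every quadratic majorant centred at
  xc.\<close>

lemma integral_v_quadratic_le:
  assumes ab: "-1 < a" "a \<le> b" "b < 1" and "c \<ge> 0" "d \<ge> 0"
    and le: "\<And>x. x \<in> {a..b} \<Longrightarrow> g x \<le> c + d * (x - xc)\<^sup>2" and g: "continuous_on {a..b} g"
  shows "integral {a..b} (\<lambda>x. g x * v x) \<le> c + d * (3/2 * r\<^sup>2)"
proof -
  have i1: "(\<lambda>x. c * v x) integrable_on {a..b}" and i2: "(\<lambda>x. d * ((x - xc)\<^sup>2 * v x)) integrable_on {a..b}"
    using ab integrable_times_v[of a b "\<lambda>_. c"] integrable_times_v[of a b "\<lambda>x. d * (x - xc)\<^sup>2"]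
    by (simp_all add: mult.assoc continuous_intros)
  have "integral {a..b} (\<lambda>x. g x * v x) \<le> integral {a..b} (\<lambda>x. c * v x + d * ((x - xc)\<^sup>2 * v x))"
  proof (rule integral_le)
    show "(\<lambda>x. g x * v x) integrable_on {a..b}" using ab g by (intro integrable_times_v)
    show "(\<lambda>x. c * v x + d * ((x - xc)\<^sup>2 * v x)) integrable_on {a..b}"
      using i1 i2 by (rule integrable_add)
    fix x assume x: "x \<in> {a..b}"
    have "g x * v x \<le> (c + d * (x - xc)\<^sup>2) * v x"
      using x ab le by (intro mult_right_mono v_nonneg) auto
    then show "g x * v x \<le> c * v x + d * ((x - xc)\<^sup>2 * v x)" by (simp add: algebra_simps)
  qed
  also have "\<dots> = c * integral {a..b} v + d * integral {a..b} (\<lambda>x. (x - xc)\<^sup>2 * v x)"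
    using i1 i2 by (subst integral_add) simp_all
  also have "\<dots> \<le> c * 1 + d * (3/2 * r\<^sup>2)"
    using assms by (intro add_mono mult_left_mono integral_v_le_1 second_moment)
  finally show ?thesis by simp
qed

text \<open>For h = 1 the rate is -2 A (x - xc) v, and 2 (x - xc) is at most r + (x - xc)^2 / r;
  mass and second moment contribute A r and 3/2 A r.\<close>

lemma energy_at_center:
  "w xc * (((1 - xc\<^sup>2) * p1 xc + ell xc * p0 xc)\<^sup>2 + A * r\<^sup>2 * (p0 xc)\<^sup>2) \<le> 5/2 * A * r"
proof -
  have "energy 1 0 0 xc \<le> 5/2 * A * r"
  proof (rule energy_le[where h = "\<lambda>_. 1" and ?h1.0 = "\<lambda>_. 0" and ?h2.0 = "\<lambda>_. 0" and ?h3.0 = "\<lambda>_. 0"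
        and g = "\<lambda>x. 2 * A * (x - xc)"])
    fix b assume b: "xc < b" "b < 1"
    have "integral {xc..b} (\<lambda>x. 2 * A * (x - xc) * v x) \<le> A * r + A / r * (3/2 * r\<^sup>2)"
    proof (rule integral_v_quadratic_le)
      fix x assume "x \<in> {xc..b}"
      have "0 \<le> (x - xc - r)\<^sup>2" by simp
      then have "2 * (x - xc) * r \<le> r\<^sup>2 + (x - xc)\<^sup>2" by (simp add: power2_eq_square algebra_simps)
      then have "A / r * (2 * (x - xc) * r) \<le> A / r * (r\<^sup>2 + (x - xc)\<^sup>2)"
        using A_ge r_pos by (intro mult_left_mono) auto
      moreover have "A / r * (2 * t * r) = 2 * A * t" "A / r * (r\<^sup>2 + t\<^sup>2) = A * r + A / r * t\<^sup>2" for t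
        using r_pos by (simp_all add: field_simps power2_eq_square)
      ultimately show "2 * A * (x - xc) \<le> A * r + A / r * (x - xc)\<^sup>2" by (simp only:)
    qed (use b xc_bounds A_ge r_pos in \<open>auto intro!: continuous_intros\<close>)
    also have "\<dots> = 5/2 * A * r" using r_pos by (simp add: power2_eq_square field_simps)
    finally show "integral {xc..b} (\<lambda>x. 2 * A * (x - xc) * v x) \<le> 5/2 * A * r" .
  qed (use xc_bounds in \<open>auto simp: Qhat'_eq intro!: continuous_intros\<close>)
  then show ?thesis by (simp add: energy_alt Qhat_eq)
qed

text \<open>The constant 18/5 is a rational bound for sqrt 12, with 12 = 6 * 2 from
  \<open>W_xc_le\<close> and \<open>A_le\<close>.\<close>

lemma sqrt_W_xc_le: "sqrt (1 - xc\<^sup>2) \<le> 18/5 * sqrt \<Psi> * r"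
proof (rule real_le_lsqrt)
  have "A / \<mu> \<le> 2 * \<Psi>" using A_le \<mu>_pos by (simp add: field_simps)
  then have "6 * r\<^sup>2 * (A / \<mu>) \<le> 6 * r\<^sup>2 * (2 * \<Psi>)" by (intro mult_left_mono) auto
  moreover have "\<Psi> * r\<^sup>2 \<ge> 0" by (simp add: \<Psi>_def)
  moreover have "6 * r\<^sup>2 * (2 * \<Psi>) = 12 * (\<Psi> * r\<^sup>2)" "324/25 * \<Psi> * r\<^sup>2 = 324/25 * (\<Psi> * r\<^sup>2)"
    "6 * r\<^sup>2 * (A / \<mu>) = 6 * r\<^sup>2 * A / \<mu>" by simp_all
  ultimately have "1 - xc\<^sup>2 \<le> 324/25 * \<Psi> * r\<^sup>2" using W_xc_le by linarith
  also have "\<dots> = (18/5 * sqrt \<Psi> * r)\<^sup>2"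
    by (simp add: power_mult_distrib \<Psi>_def power_divide)
  finally show "1 - xc\<^sup>2 \<le> (18/5 * sqrt \<Psi> * r)\<^sup>2" .
qed (use r_pos in \<open>simp add: \<Psi>_def\<close>)

lemma G_xc_le: "G xc \<le> 9 * sqrt \<Psi>"
proof -
  have "A * r\<^sup>2 * v xc \<le> w xc * (((1 - xc\<^sup>2) * p1 xc + ell xc * p0 xc)\<^sup>2 + A * r\<^sup>2 * (p0 xc)\<^sup>2)"
    using jacobi_weight_pos[OF xc_bounds, of \<alpha> \<beta>] by (simp add: v_def algebra_simps)
  also have "\<dots> \<le> 5/2 * A * r" by (rule energy_at_center)
  finally have "r * v xc \<le> 5/2" using A_ge r_pos by (simp add: power2_eq_square)
  have "G xc \<le> 18/5 * sqrt \<Psi> * r * v xc"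
    unfolding G_def using sqrt_W_xc_le v_nonneg[OF xc_bounds] by (rule mult_right_mono)
  also have "\<dots> = 18/5 * sqrt \<Psi> * (r * v xc)" by simp
  also have "\<dots> \<le> 18/5 * sqrt \<Psi> * (5/2)"
    using \<open>r * v xc \<le> 5/2\<close> by (intro mult_left_mono) (auto simp: \<Psi>_def)
  finally show ?thesis by simp
qed

lemma Q_xc_ge: "Q xc \<ge> A * r\<^sup>2"
  using one_minus_square_pos[OF xc_bounds] by (simp add: Q_def Qhat_eq)

lemma q_xc_pos: "q xc > 0"
proof -
  have "q xc * (1 - xc\<^sup>2) > 0"
    using Q_over_W[OF xc_bounds] Q_xc_ge A_r_square_ge by simp
  then show ?thesis using one_minus_square_pos[OF xc_bounds] by (simp add: zero_less_mult_iff)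
qed

text \<open>The central energy controls \<open>Z\<close>, whereas \<open>e\<close> contains
  \<open>Y\<close>, which differs from it by \<open>xc / 2 * p0 xc\<close>; A r^2 at least 1/2
  absorbs the difference.\<close>

lemma e_xc_le: "e xc \<le> q xc * (18 * sqrt \<Psi>)"
proof -
  define s where "s = sqrt (1 - xc\<^sup>2)"
  define Z where "Z = (1 - xc\<^sup>2) * p1 xc + ell xc * p0 xc"
  define c where "c = A * r\<^sup>2"
  have c: "c \<ge> 1/2" "Q xc \<ge> c" using A_r_square_ge Q_xc_ge by (auto simp: c_def)
  have W: "1 - xc\<^sup>2 > 0" by (rule one_minus_square_pos[OF xc_bounds])
  then have s: "s > 0" "s * s = 1 - xc\<^sup>2" by (auto simp: s_def)
  have w0: "w xc > 0" by (rule jacobi_weight_pos[OF xc_bounds])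
  have x1: "xc\<^sup>2 \<le> 1" using W by simp
  have Y: "Y xc = Z - xc / 2 * p0 xc" by (simp add: Y_def Z_def algebra_simps)
  have "(Y xc)\<^sup>2 \<le> 2 * Z\<^sup>2 + 1/2 * (p0 xc)\<^sup>2"
  proof -
    have "0 \<le> (Z + xc / 2 * p0 xc)\<^sup>2" by simp
    moreover have "xc\<^sup>2 * (p0 xc)\<^sup>2 \<le> 1 * (p0 xc)\<^sup>2" using x1 by (intro mult_right_mono) auto
    moreover have "2 * Z\<^sup>2 + 1/2 * (xc\<^sup>2 * (p0 xc)\<^sup>2) - (Y xc)\<^sup>2 = (Z + xc / 2 * p0 xc)\<^sup>2"
      unfolding Y by (simp add: power2_eq_square field_simps)
    ultimately show ?thesis by linarith
  qed
  then have "(Y xc)\<^sup>2 + Q xc * (p0 xc)\<^sup>2 \<le> 2 * Z\<^sup>2 + (1/2 + Q xc) * (p0 xc)\<^sup>2"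
    by (simp add: algebra_simps)
  also have "\<dots> \<le> Q xc / c * (2 * Z\<^sup>2 + 2 * c * (p0 xc)\<^sup>2)"
  proof -
    have "1 * Z\<^sup>2 \<le> Q xc / c * Z\<^sup>2" using c by (intro mult_right_mono) (auto simp: field_simps)
    moreover have "(1/2 + Q xc) * (p0 xc)\<^sup>2 \<le> (2 * Q xc) * (p0 xc)\<^sup>2" using c by (intro mult_right_mono) auto
    moreover have "Q xc / c * (2 * Z\<^sup>2 + 2 * c * (p0 xc)\<^sup>2) = 2 * (Q xc / c * Z\<^sup>2) + (2 * Q xc) * (p0 xc)\<^sup>2"
      using c by (simp add: field_simps)
    ultimately show ?thesis by linarith
  qed
  finally have "w xc * ((Y xc)\<^sup>2 + Q xc * (p0 xc)\<^sup>2) \<le> w xc * (Q xc / c * (2 * Z\<^sup>2 + 2 * c * (p0 xc)\<^sup>2))"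
    using w0 by (intro mult_left_mono) auto
  also have "\<dots> = 2 * Q xc / c * (w xc * (Z\<^sup>2 + c * (p0 xc)\<^sup>2))"
    by (simp add: algebra_simps)
  also have "\<dots> \<le> 2 * Q xc / c * (5/2 * A * r)"
    using c energy_at_center by (intro mult_left_mono) (auto simp: Z_def c_def)
  also have "\<dots> = 5 * Q xc / r"
    using r_pos A_ge by (simp add: c_def power2_eq_square)
  also have "\<dots> = q xc * (5 * s / r) * s"
    using Q_over_W[OF xc_bounds] s by (simp add: mult_ac)
  also have "\<dots> \<le> q xc * (18 * sqrt \<Psi>) * s"
  proof -
    have "5 * s / r \<le> 18 * sqrt \<Psi>"
      using sqrt_W_xc_le r_pos by (simp add: s_def field_simps)
    then show ?thesis using s q_xc_pos by (intro mult_right_mono mult_left_mono) auto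
  qed
  finally have "w xc * ((Y xc)\<^sup>2 + Q xc * (p0 xc)\<^sup>2) / s \<le> q xc * (18 * sqrt \<Psi>)"
    using s by (simp add: pos_divide_le_eq)
  then show ?thesis by (simp add: e_def s_def)
qed

lemma continuous_on_G: "-1 < a \<Longrightarrow> b < 1 \<Longrightarrow> continuous_on {a..b} G"
  by (intro continuous_at_imp_continuous_on ballI DERIV_isCont[OF G_deriv]) auto

lemma G_max:
  assumes "-1 < a" "a \<le> b" "b < 1"
  obtains z where "z \<in> {a..b}" "\<And>x. x \<in> {a..b} \<Longrightarrow> G x \<le> G z"
  using continuous_attains_sup[OF compact_Icc _ continuous_on_G[of a b]] assms by auto

text \<open>A Sonin argument: at a maximum point z of G on [x0, xc] the function e - G z * q is
  nonnegative, and it grows up to xc as long as q does not increase. Hence G z * q xc is at most e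
  xc.\<close>

lemma G_le_small_\<beta>:
  assumes \<beta>: "\<beta> \<le> 1/2" and x0: "-1 < x0" "x0 \<le> xc"
  shows "G x0 \<le> 36 * sqrt \<Psi>"
proof -
  obtain z where z: "z \<in> {x0..xc}" and zmax: "\<And>x. x \<in> {x0..xc} \<Longrightarrow> G x \<le> G z"
    using G_max[of x0 xc] x0 xc_bounds by blast
  have z': "-1 < z" "z \<le> xc" "z < 1" using z x0 xc_bounds by auto
  have \<beta>2: "\<beta>\<^sup>2 \<le> 1/4"
    using \<beta> \<beta>_ge by (intro square_le_quarter) (simp add: abs_le_iff)
  have \<Psi>0: "sqrt \<Psi> \<ge> 0" by (simp add: \<Psi>_def)
  have Gz: "G z \<ge> 0" using z' by (intro G_nonneg) auto
  have "G z \<le> 36 * sqrt \<Psi>"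
  proof (cases "\<alpha> \<ge> 1/2")
    case True
    then have \<alpha>2: "\<alpha>\<^sup>2 \<ge> 1/4"
      using abs_le_square_iff[of "1/2" \<alpha>] by (simp add: power2_eq_square)
    have "e z - G z * q z \<le> e xc - G z * q xc"
    proof (rule DERIV_nonneg_imp_nondecreasing[OF z'(2)])
      fix x assume x: "z \<le> x" "x \<le> xc"
      then have x': "-1 < x" "x < 1" using z' xc_bounds by auto
      have "((\<lambda>x. e x - G z * q x) has_real_derivative q' x * G x - G z * q' x) (at x)"
        by (intro DERIV_diff DERIV_cmult e_deriv q_deriv x')
      moreover have "q' x * G x - G z * q' x = (- q' x) * (G z - G x)" by (simp add: algebra_simps)
      moreover have "q' x \<le> 0"
      proof -
        have "(\<beta>\<^sup>2 - 1/4) / (2 * (1 + x)\<^sup>2) \<le> 0" using \<beta>2 by (intro divide_nonpos_nonneg) auto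
        moreover have "(\<alpha>\<^sup>2 - 1/4) / (2 * (1 - x)\<^sup>2) \<ge> 0" using \<alpha>2 by (intro divide_nonneg_nonneg) auto
        ultimately show ?thesis unfolding q'_def by linarith
      qed
      moreover have "G x \<le> G z" using x z by (intro zmax) auto
      ultimately show "\<exists>y. ((\<lambda>x. e x - G z * q x) has_real_derivative y) (at x) \<and> 0 \<le> y"
        by (metis diff_ge_0_iff_ge mult_nonneg_nonneg neg_0_le_iff_le)
    qed
    moreover have "e z - G z * q z \<ge> 0" using e_ge[OF z'(1,3)] by (simp add: mult.commute)
    ultimately have "q xc * G z \<le> q xc * (18 * sqrt \<Psi>)" using e_xc_le by (simp add: mult.commute)
    then have "G z \<le> 18 * sqrt \<Psi>" using q_xc_pos by simp
    then show ?thesis using \<Psi>0 by linarith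
  next
    case False
    then have \<alpha>2: "\<alpha>\<^sup>2 \<le> 1/4"
      using \<alpha>_ge by (intro square_le_quarter) (simp add: abs_le_iff)
    \<comment> \<open>Now the pole of q at 1 may make q increase. \<open>k\<close> is the
      nonincreasing part of q; the omitted part has a favourable sign in the derivative and at
      z.\<close>
    define k where "k x = A + 1/4 - (\<beta>\<^sup>2 - 1/4) / (2 * (1 + x))" for x
    have qk: "q x = k x + (1/4 - \<alpha>\<^sup>2) / (2 * (1 - x))" for x
      by (simp add: q_def k_def diff_divide_distrib)
    have kd: "(k has_real_derivative (\<beta>\<^sup>2 - 1/4) / (2 * (1 + x)\<^sup>2)) (at x)" if "-1 < x" for x
    proof -
      have d: "((\<lambda>x. 1 + x) has_real_derivative 1) (at x)" by (auto intro!: derivative_eq_intros)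
      have nz: "1 + x \<noteq> 0" using that by auto
      have e: "0 - - 1 * X = X" for X :: real by simp
      show ?thesis
        unfolding k_def[abs_def] by (rule DERIV_cong[OF DERIV_diff[OF DERIV_const DERIV_const_divide_two[OF d nz]]]) (rule e)
    qed
    have "e z - G z * k z \<le> e xc - G z * k xc"
    proof (rule DERIV_nonneg_imp_nondecreasing[OF z'(2)])
      fix x assume x: "z \<le> x" "x \<le> xc"
      then have x': "-1 < x" "x < 1" using z' xc_bounds by auto
      let ?b = "(\<beta>\<^sup>2 - 1/4) / (2 * (1 + x)\<^sup>2)"
      have deriv: "((\<lambda>x. e x - G z * k x) has_real_derivative q' x * G x - G z * ?b) (at x)"
        by (intro DERIV_diff DERIV_cmult e_deriv kd x')
      have "q' x * G x - G z * ?b = (- ?b) * (G z - G x) + (1/4 - \<alpha>\<^sup>2) / (2 * (1 - x)\<^sup>2) * G x"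
        unfolding q'_def by (simp add: algebra_simps diff_divide_distrib)
      moreover have "?b \<le> 0" using \<beta>2 by (intro divide_nonpos_nonneg) auto
      moreover have "(1/4 - \<alpha>\<^sup>2) / (2 * (1 - x)\<^sup>2) \<ge> 0" using \<alpha>2 by (intro divide_nonneg_nonneg) auto
      moreover have "G x \<le> G z" using x z by (intro zmax) auto
      moreover have "G x \<ge> 0" using x' by (rule G_nonneg)
      ultimately have "q' x * G x - G z * ?b \<ge> 0"
        by (simp only:) (intro add_nonneg_nonneg mult_nonneg_nonneg; simp)
      with deriv show "\<exists>y. ((\<lambda>x. e x - G z * k x) has_real_derivative y) (at x) \<and> 0 \<le> y"
        by blast
    qed
    moreover have "e z - G z * k z \<ge> 0"
    proof -
      have "(1/4 - \<alpha>\<^sup>2) / (2 * (1 - z)) \<ge> 0" using \<alpha>2 z' by (intro divide_nonneg_nonneg) auto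
      then have "k z * G z \<le> q z * G z" unfolding qk using Gz by (intro mult_right_mono) auto
      then show ?thesis using e_ge[OF z'(1,3)] by (simp add: mult.commute)
    qed
    moreover have k1: "k xc \<ge> 1"
    proof -
      have "(\<beta>\<^sup>2 - 1/4) / (2 * (1 + xc)) \<le> 0" using \<beta>2 xc_bounds by (intro divide_nonpos_nonneg) auto
      then show ?thesis using A_ge by (simp add: k_def)
    qed
    \<comment> \<open>Both exponents are at most 1/2 in absolute value, which keeps the centre away
      from 1.\<close>
    moreover have "q xc \<le> 2 * k xc"
    proof -
      have "\<bar>\<sigma>\<bar> \<le> 1/2" "\<bar>\<delta>\<bar> \<le> 1/2" using False \<beta> \<alpha>_ge \<beta>_ge by (auto simp: \<sigma>_def \<delta>_def abs_le_iff field_simps)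
      then have "\<bar>\<sigma>\<bar> * \<bar>\<delta>\<bar> \<le> 1/2 * (1/2)" by (intro mult_mono) auto
      then have "\<bar>xc\<bar> \<le> 1/3" using A_ge by (simp add: xc_def abs_mult field_simps)
      then have "1 - xc \<ge> 2/3" by linarith
      moreover have "1/4 - \<alpha>\<^sup>2 \<le> 1/4" by simp
      ultimately have "(1/4 - \<alpha>\<^sup>2) / (2 * (1 - xc)) \<le> (1/4) / (2 * (2/3))"
        by (intro frac_le) auto
      then have "(1/4 - \<alpha>\<^sup>2) / (2 * (1 - xc)) \<le> 1" by (rule order_trans) simp
      then show ?thesis unfolding qk using k1 by linarith
    qed
    ultimately have "k xc * G z \<le> q xc * (18 * sqrt \<Psi>)" using e_xc_le by (simp add: mult.commute)
    also have "\<dots> \<le> 2 * k xc * (18 * sqrt \<Psi>)"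
      using \<open>q xc \<le> 2 * k xc\<close> \<Psi>0 by (intro mult_right_mono) auto
    finally have "k xc * G z \<le> k xc * (36 * sqrt \<Psi>)" by simp
    then show ?thesis using k1 by simp
  qed
  then show ?thesis using zmax[of x0] x0 by auto
qed

text \<open>A generous majorant: its square, of order n (n + S) for n at least 1, bounds q on (-1,
  xc].\<close>

definition "\<kappa> = sqrt (2 * (real n + 1) * (real n + S + 1))"

section \<open>The case \<beta> \<ge> 1/2: a bound that grows with the degree\<close>

context
  assumes \<beta>: "\<beta> \<ge> 1/2"
begin

text \<open>For \<beta> at least 1/2 the weight itself vanishes at -1, so F and F DF start from zero
  at the left end.\<close>

lemma P_tendsto: "(P \<longlongrightarrow> 0) (at_right (-1))" and G_tendsto: "(G \<longlongrightarrow> 0) (at_right (-1))"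
proof -
  have "((\<lambda>x. (1 - x) powr \<alpha> * (1 + x) powr \<beta>) \<longlongrightarrow> (1 - (-1)) powr \<alpha> * (1 + (-1)) powr \<beta>) (at_right (-1::real))"
    using \<beta> by (intro tendsto_intros tendsto_powr') (auto simp: eventually_at_right_field intro!: exI[of _ 0])
  then have w: "(w \<longlongrightarrow> 0) (at_right (-1))" using \<beta> by (simp add: jacobi_weight_def[abs_def])
  have c: "((\<lambda>x. poly q x) \<longlongrightarrow> poly q (-1)) (at_right (-1))" for q :: "real poly"
    by (intro tendsto_poly tendsto_ident_at)
  have "((\<lambda>x. w x * p0 x * ((1 - x\<^sup>2) * p1 x + (\<delta> - \<sigma> * x - x / 2) * p0 x)) \<longlongrightarrow>
      0 * p0 (-1) * ((1 - (-1)\<^sup>2) * p1 (-1) + (\<delta> - \<sigma> * (-1) - (-1) / 2) * p0 (-1))) (at_right (-1))"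
    by (intro tendsto_intros w c) auto
  then show "(P \<longlongrightarrow> 0) (at_right (-1))" by (simp add: P_def[abs_def] Y_def ell_def)
  have "((\<lambda>x. sqrt (1 - x\<^sup>2) * (w x * (p0 x)\<^sup>2)) \<longlongrightarrow> sqrt (1 - (-1)\<^sup>2) * (0 * (p0 (-1))\<^sup>2)) (at_right (-1))"
    by (intro tendsto_intros w c)
  then show "(G \<longlongrightarrow> 0) (at_right (-1))" by (simp add: G_def[abs_def] v_def)
qed

text \<open>Where q is nonpositive, D (F DF) = (DF)^2 - q F^2 is nonnegative, so F DF grows from
  zero and stays nonnegative.\<close>

lemma G_mono_of_Q_nonpos:
  assumes Q: "\<And>x. -1 < x \<Longrightarrow> x \<le> b \<Longrightarrow> Q x \<le> 0" and x: "-1 < x" "x \<le> b" "b < 1"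
  shows "G x \<le> G b"
proof -
  have P: "P x \<ge> 0" if x: "-1 < x" "x \<le> b" for x
  proof -
    have "P a \<le> P x" if a: "-1 < a" "a < x" for a
    proof (rule DERIV_nonneg_imp_nondecreasing[where f = P])
      fix y assume y: "a \<le> y" "y \<le> x"
      then have y': "-1 < y" "y < 1" "y \<le> b" using a x assms by auto
      have "w y / (1 - y\<^sup>2) * ((Y y)\<^sup>2 - Q y * (p0 y)\<^sup>2) \<ge> 0"
        using Q[OF y'(1,3)] jacobi_weight_pos[OF y'(1,2), of \<alpha> \<beta>] one_minus_square_pos[OF y'(1,2)]
        by (intro mult_nonneg_nonneg) (auto intro: add_nonneg_nonneg simp: mult_nonpos_nonneg order_trans[of _ 0])
      then show "\<exists>d. (P has_real_derivative d) (at y) \<and> 0 \<le> d" using P_deriv[OF y'(1,2)] by blast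
    qed (use a in simp)
    then have "\<forall>\<^sub>F a in at_right (-1). P a \<le> P x"
      using x by (auto simp: eventually_at_right_field)
    then show ?thesis by (intro tendsto_upperbound[OF P_tendsto]) auto
  qed
  show ?thesis
  proof (rule DERIV_nonneg_imp_nondecreasing[where f = G, OF x(2)])
    fix y assume y: "x \<le> y" "y \<le> b"
    then have y': "-1 < y" "y < 1" using x by auto
    have "2 * P y / sqrt (1 - y\<^sup>2) \<ge> 0" using P[of y] y y' one_minus_square_pos[OF y'] by simp
    then show "\<exists>d. (G has_real_derivative d) (at y) \<and> 0 \<le> d" using G_deriv[OF y'] by blast
  qed
qed

text \<open>A alone contains S^2 / 4, which would be too large; the pole terms of q must cancel it.
  Both do so for \<alpha> at least 1/2; otherwise the one at -1 suffices, since then S - \<beta> is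
  at most 3/2.\<close>

lemma q_le:
  assumes x: "-1 < x" "x \<le> xc"
  shows "q x \<le> \<kappa>\<^sup>2"
proof -
  define \<nu> where "\<nu> = real n"
  have \<nu>: "\<nu> \<ge> 1" using n by (simp add: \<nu>_def)
  have S0: "S \<ge> 0" by (rule S_nonneg)
  have \<nu>S: "\<nu> * S \<ge> 0" using \<nu> S0 by simp
  have \<kappa>: "\<kappa>\<^sup>2 = 2 * (\<nu> * \<nu>) + 2 * (\<nu> * S) + 4 * \<nu> + 2 * S + 2"
    using \<nu> S0 by (simp add: \<kappa>_def \<nu>_def[symmetric] power2_eq_square field_simps)
  have A: "A + 1/4 = \<nu> * \<nu> + \<nu> * S + S * S / 4"
    by (simp add: A_eq \<nu>_def power2_eq_square field_simps)
  have \<beta>2: "\<beta>\<^sup>2 - 1/4 \<ge> 0"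
    using \<beta> abs_le_square_iff[of "1/2" \<beta>] by (simp add: power2_eq_square)
  have x1: "x < 1" using x xc_bounds by simp
  show ?thesis
  proof (cases "\<alpha> \<ge> 1/2")
    case True
    define a where "a = \<alpha> - 1/2"
    define b where "b = \<beta> - 1/2"
    have ab: "a \<ge> 0" "b \<ge> 0" "S = a + b + 2" using True \<beta> by (auto simp: a_def b_def S_def)
    have 1: "(\<alpha>\<^sup>2 - 1/4) / (2 * (1 - x)) \<ge> a\<^sup>2 / (2 * (1 - x))"
      using ab x1 by (intro divide_right_mono) (auto simp: a_def power2_eq_square algebra_simps)
    have 2: "(\<beta>\<^sup>2 - 1/4) / (2 * (1 + x)) \<ge> b\<^sup>2 / (2 * (1 + x))"
      using ab x by (intro divide_right_mono) (auto simp: b_def power2_eq_square algebra_simps)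
    \<comment> \<open>Cauchy-Schwarz with the weights t and 2 - t, whose sum is 2.\<close>
    have 3: "a\<^sup>2 / (2 * t) + b\<^sup>2 / (2 * (2 - t)) \<ge> (a + b)\<^sup>2 / 4" if "0 < t" "t < 2" for t
    proof -
      have "a\<^sup>2 / (2 * t) + b\<^sup>2 / (2 * (2 - t)) - (a + b)\<^sup>2 / 4 = (a * (2 - t) - b * t)\<^sup>2 / (4 * t * (2 - t))"
        using that by (simp add: field_simps power2_eq_square)
      moreover have "\<dots> \<ge> 0" using that by simp
      ultimately show ?thesis by linarith
    qed
    have "q x \<le> A + 1/4 - (a + b)\<^sup>2 / 4"
    proof -
      have "2 - (1 - x) = 1 + x" by simp
      then have "a\<^sup>2 / (2 * (1 - x)) + b\<^sup>2 / (2 * (1 + x)) \<ge> (a + b)\<^sup>2 / 4"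
        using 3[of "1 - x"] x x1 by (simp only:)
      then show ?thesis using 1 2 unfolding q_def by linarith
    qed
    also have "\<dots> = A + 1/4 - (S - 2)\<^sup>2 / 4" by (simp add: ab)
    also have "\<dots> = \<nu> * \<nu> + \<nu> * S + S - 1" unfolding A by (simp add: power2_eq_square field_simps)
    also have "\<dots> \<le> \<kappa>\<^sup>2" unfolding \<kappa> using \<nu> S0 \<nu>S zero_le_square[of \<nu>] by linarith
    finally show ?thesis .
  next
    case False
    have \<alpha>2: "\<alpha>\<^sup>2 \<le> 1/4" using False \<alpha>_ge by (intro square_le_quarter) (simp add: abs_le_iff)
    have 1: "(\<beta>\<^sup>2 - 1/4) / (2 * (1 + x)) \<ge> (\<beta>\<^sup>2 - 1/4) / 4"
      using \<beta>2 x x1 by (intro divide_left_mono) auto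
    \<comment> \<open>The pole at 1 has the wrong sign here, but x stays at or left of xc, and 1 -
      xc is at least 1 / (4 \<Psi>).\<close>
    have "(1/4 - \<alpha>\<^sup>2) / (2 * (1 - x)) \<le> (1/4) / (2 * (1 - xc))"
      using x xc_bounds by (intro frac_le) auto
    also have "\<dots> \<le> \<Psi> / 2"
    proof -
      have "(\<mu> / 2) / A \<le> 1 - xc" unfolding one_minus_xc using \<mu>\<sigma>_ge A_ge by (intro divide_right_mono) auto
      then have "(\<mu> / 2) / A * \<Psi> \<le> (1 - xc) * \<Psi>" by (rule mult_right_mono) (simp add: \<Psi>_def)
      moreover have "1/4 \<le> (\<mu> / 2) / A * \<Psi>" using A_le A_ge by (simp add: field_simps)
      ultimately have 4: "1/4 \<le> (1 - xc) * \<Psi>" by linarith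
      have "(1/4) / (2 * u) \<le> c / 2" if "1/4 \<le> u * c" "u > 0" for u c :: real
        using that by (simp add: field_simps)
      from this[OF 4] xc_bounds show ?thesis by (simp only: diff_gt_0_iff_gt)
    qed
    also have "\<dots> \<le> (1 + S) / 2"
    proof -
      have "S / (real n + 1) \<le> S / 1" using S0 by (intro divide_left_mono) auto
      then show ?thesis using S0 by (simp add: \<Psi>_def)
    qed
    finally have 2: "- ((\<alpha>\<^sup>2 - 1/4) / (2 * (1 - x))) \<le> (1 + S) / 2"
      by (simp add: minus_divide_left)
    have "S * S - \<beta>\<^sup>2 \<le> 3 * S"
    proof -
      have s1: "S - \<beta> \<le> 3/2" "S - \<beta> \<ge> 0" "S + \<beta> \<le> 2 * S" "\<beta> \<le> S + 1/2"
        using False \<alpha>_ge \<beta> by (auto simp: S_def)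
      have "(S - \<beta>) * (S + \<beta>) \<le> 3/2 * (2 * S)" using s1 S0 \<beta> by (intro mult_mono) auto
      then show ?thesis by (simp add: power2_eq_square algebra_simps)
    qed
    then have "q x \<le> \<nu> * \<nu> + \<nu> * S + 3/4 * S + 1/16 + (1 + S) / 2"
    proof -
      have "a - t - u \<le> N + 3/4 * S + 1/16 + (1 + S) / 2"
        if "SS - b \<le> 3 * S" "(b - 1/4) / 4 \<le> u" "- t \<le> (1 + S) / 2" "a = N + SS / 4" for a t u N SS b
        using that by (simp add: field_simps)
      from this[OF \<open>S * S - \<beta>\<^sup>2 \<le> 3 * S\<close> 1 2 A] show ?thesis unfolding q_def .
    qed
    also have "\<dots> \<le> \<kappa>\<^sup>2"
    proof -
      have "N + M + 3/4 * S + 1/16 + (1 + S) / 2 \<le> 2 * N + 2 * M + 4 * \<nu> + 2 * S + 2"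
        if "N \<ge> 0" "M \<ge> 0" for N M
        using that \<nu> S0 by (simp add: field_simps)
      from this[OF zero_le_square \<nu>S] show ?thesis unfolding \<kappa> .
    qed
    finally show ?thesis .
  qed
qed

lemma \<kappa>_pos: "\<kappa> > 0" using S_nonneg by (simp add: \<kappa>_def add_nonneg_pos)

text \<open>Young's inequality bounds 2 F DF by \<kappa> F^2 + (DF)^2 / \<kappa>; subtracting P /
  \<kappa> from G cancels the second term and leaves q F^2 / \<kappa>, at most \<kappa> F^2. So G -
  P / \<kappa> has derivative at most 2 \<kappa> v, and it starts from 0.\<close>

lemma G_le_\<kappa>:
  assumes x0: "-1 < x0" "x0 \<le> xc" and P0: "P x0 \<le> 0"
  shows "G x0 \<le> 2 * \<kappa>"
proof -
  have x1: "x0 < 1" using x0 xc_bounds by simp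
  have "G x0 \<le> 2 * \<kappa> + (G a - P a / \<kappa>)" if a: "-1 < a" "a < x0" for a
  proof -
    let ?D = "\<lambda>x. 2 * P x / sqrt (1 - x\<^sup>2) - w x / (1 - x\<^sup>2) * ((Y x)\<^sup>2 - Q x * (p0 x)\<^sup>2) / \<kappa>"
    have "(?D has_integral (G x0 - P x0 / \<kappa>) - (G a - P a / \<kappa>)) {a..x0}"
    proof (rule fundamental_theorem_of_calculus)
      fix x assume "x \<in> {a..x0}"
      then have x: "-1 < x" "x < 1" using a x1 by auto
      have "((\<lambda>x. G x - P x / \<kappa>) has_real_derivative ?D x) (at x)"
        by (intro DERIV_diff DERIV_cdivide G_deriv P_deriv x)
      then show "((\<lambda>x. G x - P x / \<kappa>) has_vector_derivative ?D x) (at x within {a..x0})"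
        by (simp add: has_real_derivative_iff_has_vector_derivative has_vector_derivative_at_within)
    qed (use a in simp)
    moreover have "((\<lambda>x. 2 * \<kappa> * v x) has_integral 2 * \<kappa> * integral {a..x0} v) {a..x0}"
      using integrable_times_v[of a x0 "\<lambda>_. 1"] a x1 by (intro has_integral_mult_right integrable_integral) simp
    ultimately have "(G x0 - P x0 / \<kappa>) - (G a - P a / \<kappa>) \<le> 2 * \<kappa> * integral {a..x0} v"
    proof (rule has_integral_le)
      fix x assume "x \<in> {a..x0}"
      then have x: "-1 < x" "x < 1" "x \<le> xc" using a x0 x1 by auto
      define s where "s = sqrt (1 - x\<^sup>2)"
      have s: "s > 0" "1 - x\<^sup>2 = s * s" using one_minus_square_pos[OF x(1,2)] by (auto simp: s_def)
      have w0: "w x > 0" by (rule jacobi_weight_pos[OF x(1,2)])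
      have amgm: "2 * t * y / s - y\<^sup>2 / (s * s) / \<kappa> \<le> \<kappa> * t\<^sup>2" for t y
      proof -
        have "\<kappa> * t\<^sup>2 - (2 * t * y / s - y\<^sup>2 / (s * s) / \<kappa>) = \<kappa> * (t - y / (s * \<kappa>))\<^sup>2"
          using s(1) \<kappa>_pos by (simp add: field_simps power2_eq_square)
        moreover have "\<dots> \<ge> 0" using \<kappa>_pos by simp
        ultimately show ?thesis by linarith
      qed
      have "q x * (p0 x)\<^sup>2 / \<kappa> \<le> \<kappa>\<^sup>2 * (p0 x)\<^sup>2 / \<kappa>"
        using q_le[OF x(1,3)] \<kappa>_pos by (intro divide_right_mono mult_right_mono) auto
      also have "\<dots> = \<kappa> * (p0 x)\<^sup>2" using \<kappa>_pos by (simp add: power2_eq_square)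
      finally have "2 * p0 x * Y x / s - (Y x)\<^sup>2 / (s * s) / \<kappa> + q x * (p0 x)\<^sup>2 / \<kappa> \<le> 2 * \<kappa> * (p0 x)\<^sup>2"
        using amgm[of "p0 x" "Y x"] by linarith
      then have "w x * (2 * p0 x * Y x / s - (Y x)\<^sup>2 / (s * s) / \<kappa> + q x * (p0 x)\<^sup>2 / \<kappa>) \<le> w x * (2 * \<kappa> * (p0 x)\<^sup>2)"
        using w0 by (intro mult_left_mono) auto
      moreover have "w x * (2 * t * y / s - y\<^sup>2 / (s * s) / \<kappa> + k * t\<^sup>2 / \<kappa>)
          = 2 * (w x * t * y) / s - w x / (s * s) * (y\<^sup>2 - k * (s * s) * t\<^sup>2) / \<kappa>" for t y k
        using s(1) \<kappa>_pos by (simp add: field_simps)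
      ultimately have "2 * (w x * p0 x * Y x) / s - w x / (s * s) * ((Y x)\<^sup>2 - q x * (s * s) * (p0 x)\<^sup>2) / \<kappa> \<le> w x * (2 * \<kappa> * (p0 x)\<^sup>2)"
        by (simp only:)
      then show "?D x \<le> 2 * \<kappa> * v x"
        unfolding P_def v_def Q_over_W[OF x(1,2)] unfolding s_def[symmetric] unfolding s(2)
        by (simp only: mult_ac)
    qed
    also have "\<dots> \<le> 2 * \<kappa> * 1"
      using a x1 \<kappa>_pos by (intro mult_left_mono integral_v_le_1) auto
    also have "P x0 / \<kappa> \<le> 0" using P0 \<kappa>_pos by (simp add: divide_nonpos_pos)
    ultimately show ?thesis by simp
  qed
  then have "\<forall>\<^sub>F a in at_right (-1). G x0 \<le> 2 * \<kappa> + (G a - P a / \<kappa>)"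
    using x0 by (auto simp: eventually_at_right_field)
  moreover have "((\<lambda>a. 2 * \<kappa> + (G a - P a / \<kappa>)) \<longlongrightarrow> 2 * \<kappa> + (0 - 0 / \<kappa>)) (at_right (-1))"
    using \<kappa>_pos by (intro tendsto_intros G_tendsto P_tendsto) auto
  ultimately show ?thesis
    by (intro tendsto_lowerbound[of _ "2 * \<kappa>" "at_right (-1)"]) auto
qed

text \<open>At a maximum of G before xc the function P cannot be positive, as G would still increase
  to the right.\<close>

lemma G_le_max:
  assumes x0: "-1 < x0" "x0 \<le> xc"
  shows "G x0 \<le> max (2 * \<kappa>) (9 * sqrt \<Psi>)"
proof -
  obtain z where z: "z \<in> {x0..xc}" and zmax: "\<And>x. x \<in> {x0..xc} \<Longrightarrow> G x \<le> G z"
    using G_max[of x0 xc] x0 xc_bounds by blast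
  have "G z \<le> max (2 * \<kappa>) (9 * sqrt \<Psi>)"
  proof (cases "z = xc")
    case True
    then show ?thesis using G_xc_le by simp
  next
    case False
    then have z': "-1 < z" "z < xc" "z < 1" using z x0 xc_bounds by auto
    have "\<not> P z > 0"
    proof
      assume "P z > 0"
      then have "2 * P z / sqrt (1 - z\<^sup>2) > 0" using one_minus_square_pos[OF z'(1,3)] by simp
      from DERIV_pos_inc_right[OF G_deriv[OF z'(1,3)] this]
      obtain d where d: "d > 0" "\<And>h. 0 < h \<Longrightarrow> h < d \<Longrightarrow> G z < G (z + h)" by blast
      define h where "h = min (d / 2) (xc - z)"
      have "0 < h" "h < d" "z + h \<in> {x0..xc}" using d z z' by (auto simp: h_def)
      then show False using d(2)[of h] zmax[of "z + h"] by simp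
    qed
    then show ?thesis using G_le_\<kappa>[of z] z' by (simp add: le_max_iff_disj)
  qed
  then show ?thesis using zmax[of x0] x0 by auto
qed

end

end

section \<open>The turning point for large degree\<close>

lemma inverse_sqrt_power_has_derivative:
  fixes x y :: real
  assumes "y < x"
  shows "((\<lambda>x. 1 / sqrt (x - y) ^ m) has_real_derivative - (real m / 2) / sqrt (x - y) ^ (m + 2)) (at x)"
proof (cases m)
  case (Suc j)
  define t where "t = sqrt (x - y)"
  have t: "t > 0" using assms by (simp add: t_def)
  have "((\<lambda>x. sqrt (x - y)) has_real_derivative 1 / (2 * t)) (at x)"
    using assms by (auto intro!: derivative_eq_intros simp: t_def field_simps)
  then have "((\<lambda>x. sqrt (x - y) ^ m) has_real_derivative real m * (1 / (2 * t) * t ^ (m - Suc 0))) (at x)"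
    unfolding t_def by (rule DERIV_power)
  from DERIV_inverse'[OF this]
  have "((\<lambda>x. inverse (sqrt (x - y) ^ m)) has_real_derivative
      - (inverse (t ^ m) * (real m * (1 / (2 * t) * t ^ (m - Suc 0))) * inverse (t ^ m))) (at x)"
    using t by (simp add: t_def)
  moreover have "- (inverse (t ^ m) * (real m * (1 / (2 * t) * t ^ (m - Suc 0))) * inverse (t ^ m))
      = - (real m / 2) / t ^ (m + 2)"
    using t by (simp add: Suc field_simps)
  ultimately show ?thesis by (simp add: t_def inverse_eq_divide)
qed simp

text \<open>The terms of the rate for h = X^(-1/2) that do not involve \<open>Qhat\<close>, times
  X^(7/2), re-expanded about y: only powers of X with coefficients in y remain.\<close>

lemma airy_rate_identity:
  fixes y X :: real
  assumes "X \<noteq> 0"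
  shows "(- (15/8) * (1 - (y + X)\<^sup>2)\<^sup>2 - 9/2 * (y + X) * (1 - (y + X)\<^sup>2) * X - (6 * (y + X)\<^sup>2 - 2) / 2 * X\<^sup>2) / 2
    = X\<^sup>2 * (- 1/4 + 3/8 * (1 - y\<^sup>2)) - 3/4 * (1 - y\<^sup>2) * (- 2 * y) * X - 15/16 * (1 - y\<^sup>2)\<^sup>2 - 3/16 * (X\<^sup>2)\<^sup>2"
  by (simp add: power2_eq_square field_simps)

context jacobi_solution_pos begin

lemma \<Psi>_ge_1: "\<Psi> \<ge> 1" by (simp add: \<Psi>_def)

text \<open>These lower bounds retain \<Psi> to cancel the one in \<open>A_le\<close>; thus A r^2
  and \<mu>^2 / A grow with n uniformly in S.\<close>

lemma T_ge_\<Psi>: "\<mu> + \<alpha> * \<beta> \<ge> ((real n)\<^sup>2 - 1/4) * \<Psi>" and \<mu>_ge_\<Psi>: "\<mu> \<ge> (real n)\<^sup>2 / 2 * \<Psi>"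
proof -
  define \<nu> where "\<nu> = real n"
  have \<nu>: "\<nu> \<ge> 1" using n by (simp add: \<nu>_def)
  have S0: "S \<ge> 0" by (rule S_nonneg)
  have \<nu>2: "\<nu>\<^sup>2 \<ge> 1" using \<nu> by simp
  have m1: "\<nu>\<^sup>2 * (S / (\<nu> + 1)) \<le> \<nu> * S"
  proof -
    have "\<nu>\<^sup>2 * S \<le> \<nu> * S * (\<nu> + 1)" using \<nu> S0 by (simp add: power2_eq_square algebra_simps)
    then show ?thesis using \<nu> by (simp add: pos_divide_le_eq)
  qed
  have m2: "S / (\<nu> + 1) \<ge> 0" using \<nu> S0 by simp
  have m3: "\<nu> * S \<ge> 0" using \<nu> S0 by simp
  have "\<mu> + \<alpha> * \<beta> \<ge> \<nu>\<^sup>2 - 1/4 + \<nu> * S" using T_ge by (simp add: \<nu>_def)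
  moreover have "(\<nu>\<^sup>2 - 1/4) * \<Psi> \<le> \<nu>\<^sup>2 - 1/4 + \<nu> * S"
  proof (cases "S / (\<nu> + 1) \<le> 1")
    case True
    then have "\<Psi> = 1" by (simp add: \<Psi>_def \<nu>_def)
    then show ?thesis using m3 by simp
  next
    case False
    then have "\<Psi> = S / (\<nu> + 1)" by (simp add: \<Psi>_def \<nu>_def)
    then have "(\<nu>\<^sup>2 - 1/4) * \<Psi> \<le> \<nu>\<^sup>2 * (S / (\<nu> + 1))"
      using m2 by (simp only:) (intro mult_right_mono; simp)
    also have "\<dots> \<le> \<nu> * S" by (rule m1)
    also have "\<dots> \<le> \<nu>\<^sup>2 - 1/4 + \<nu> * S" using \<nu>2 by simp
    finally show ?thesis .
  qed
  ultimately show "\<mu> + \<alpha> * \<beta> \<ge> ((real n)\<^sup>2 - 1/4) * \<Psi>" by (simp add: \<nu>_def)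
  have "\<mu> \<ge> \<nu>\<^sup>2 / 2 + 3/4 * (\<nu> + 1) * S" using \<mu>_ge_n by (simp add: \<nu>_def)
  moreover have "3/4 * (\<nu> + 1) * S \<ge> \<nu> * S / 2" using \<nu> S0 m3 by (simp add: algebra_simps)
  moreover have "\<nu>\<^sup>2 / 2 * \<Psi> \<le> \<nu>\<^sup>2 / 2 + \<nu> * S / 2"
  proof (cases "S / (\<nu> + 1) \<le> 1")
    case True
    then have "\<Psi> = 1" by (simp add: \<Psi>_def \<nu>_def)
    then show ?thesis using m3 by simp
  next
    case False
    then have "\<Psi> = S / (\<nu> + 1)" by (simp add: \<Psi>_def \<nu>_def)
    then have "\<nu>\<^sup>2 / 2 * \<Psi> = \<nu>\<^sup>2 * (S / (\<nu> + 1)) / 2" by simp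
    also have "\<dots> \<le> \<nu> * S / 2" using m1 by (rule divide_right_mono) simp
    also have "\<dots> \<le> \<nu>\<^sup>2 / 2 + \<nu> * S / 2" by simp
    finally show ?thesis .
  qed
  ultimately show "\<mu> \<ge> (real n)\<^sup>2 / 2 * \<Psi>" by (simp add: \<nu>_def)
qed

lemma A_r_square_ge_n: "A * r\<^sup>2 \<ge> (real n)\<^sup>2 / 4"
proof -
  have n2: "(real n)\<^sup>2 \<ge> 1" using n by simp
  have "(real n)\<^sup>2 / 4 * A \<le> (real n)\<^sup>2 / 4 * (2 * \<mu> * \<Psi>)"
    using A_le by (intro mult_left_mono) auto
  also have "\<dots> = \<mu> * ((real n)\<^sup>2 / 2 * \<Psi>)" by simp
  also have "\<dots> \<le> \<mu> * (((real n)\<^sup>2 - 1/4) * \<Psi>)"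
    using n2 \<mu>_pos \<Psi>_ge_1 by (intro mult_left_mono mult_right_mono) auto
  also have "\<dots> \<le> \<mu> * (\<mu> + \<alpha> * \<beta>)" using T_ge_\<Psi> \<mu>_pos by (intro mult_left_mono) auto
  finally show ?thesis unfolding A_r_square using A_ge by (simp add: pos_le_divide_eq)
qed

lemma \<mu>_square_ge: "\<mu>\<^sup>2 \<ge> (real n)\<^sup>2 / 4 * A"
proof -
  have "(real n)\<^sup>2 / 4 * A \<le> (real n)\<^sup>2 / 4 * (2 * \<mu> * \<Psi>)"
    using A_le by (intro mult_left_mono) auto
  also have "\<dots> = \<mu> * ((real n)\<^sup>2 / 2 * \<Psi>)" by simp
  also have "\<dots> \<le> \<mu> * \<mu>" using \<mu>_ge_\<Psi> \<mu>_pos by (intro mult_left_mono) auto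
  finally show ?thesis by (simp add: power2_eq_square)
qed

lemma r_ge: "r \<ge> 2/3 * \<mu> / A"
proof (rule power2_le_imp_le)
  have "\<mu> * (\<mu> / 2) \<le> \<mu> * (\<mu> + \<alpha> * \<beta>)" using T_ge_half_\<mu> \<mu>_pos by (intro mult_left_mono) auto
  moreover have "4/9 * \<mu>\<^sup>2 \<le> \<mu> * (\<mu> / 2)" using zero_le_power2[of \<mu>] by (simp add: power2_eq_square)
  ultimately have "4/9 * \<mu>\<^sup>2 / A\<^sup>2 \<le> \<mu> * (\<mu> + \<alpha> * \<beta>) / A\<^sup>2" by (intro divide_right_mono) auto
  then show "(2/3 * \<mu> / A)\<^sup>2 \<le> r\<^sup>2" by (simp add: r_square power_divide power_mult_distrib)
qed (use r_pos in simp)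

lemma r_\<mu>_ge: "r * \<mu> \<ge> (real n)\<^sup>2 / 6"
proof -
  have "(real n)\<^sup>2 / 6 = 2/3 * ((real n)\<^sup>2 / 4 * A) / A" using A_ge by simp
  also have "\<dots> \<le> 2/3 * \<mu>\<^sup>2 / A" using \<mu>_square_ge A_ge by (intro divide_right_mono mult_left_mono) auto
  also have "\<dots> = 2/3 * \<mu> / A * \<mu>" by (simp add: power2_eq_square)
  also have "\<dots> \<le> r * \<mu>" using r_ge \<mu>_pos by (intro mult_right_mono) auto
  finally show ?thesis .
qed

lemma r_le_1: "r \<le> 1" using r_le by linarith

lemma Q_alt: "Q x = (A + 1/4) * (1 - x\<^sup>2) - (\<alpha>\<^sup>2 - 1/4) / 2 * (1 + x) - (\<beta>\<^sup>2 - 1/4) / 2 * (1 - x)"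
  by (simp add: Q_def Qhat_def A_def ell_def \<sigma>_def \<delta>_def power2_eq_square field_simps)

lemma Q_center: "Q x = A * (r\<^sup>2 - (x - xc)\<^sup>2) + (1 - x\<^sup>2) / 4 + 1/4"
  by (simp add: Q_def Qhat_eq)

section \<open>The left turning point and its Airy scale\<close>

context
  fixes xm :: real
  assumes \<beta>: "\<beta> \<ge> 1/2" and n_large: "n \<ge> 10 ^ 6"
    and xm: "-1 \<le> xm" "xm < xc" "Q xm = 0"
begin

text \<open>The slope of the chord of the concave quadratic \<open>Q\<close> from its zero xm to the
  centre: Q lies above the line k (x - xm) between them and below it to the left of xm.\<close>

definition "k = Q xc / (xc - xm)"

lemma n2_large: "(real n)\<^sup>2 \<ge> 10 ^ 12"
proof -
  have "real n \<ge> 10 ^ 6" using n_large by (metis of_nat_le_iff of_nat_numeral of_nat_power)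
  then have "(real n)\<^sup>2 \<ge> (10 ^ 6)\<^sup>2" by (intro power_mono) auto
  then show ?thesis by simp
qed

lemma Q_factor: "Q x = (x - xm) * (k + (A + 1/4) * (xc - x))"
proof -
  have "Q y - Q xm = (y - xm) * (2 * A * xc - (A + 1/4) * (y + xm))" for y
    by (simp add: Q_center power2_eq_square field_simps)
  then have Q: "Q y = (y - xm) * (2 * A * xc - (A + 1/4) * (y + xm))" for y
    by (simp add: xm)
  have "k = 2 * A * xc - (A + 1/4) * (xc + xm)"
    unfolding k_def Q[of xc] using xm by simp
  then have "k + (A + 1/4) * (xc - x) = 2 * A * xc - (A + 1/4) * (x + xm)" by algebra
  then show ?thesis unfolding Q[of x] by (simp only:)
qed

text \<open>The zero xm of \<open>Q\<close> replaces the zero xc - r of \<open>Qhat\<close>; the two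
  quadratics differ by at most 1/2, little against A r^2 for large n.\<close>

lemma L_bounds: "r \<le> xc - xm" "xc - xm \<le> 11/10 * r"
proof -
  have W: "0 \<le> 1 - xm\<^sup>2" "1 - xm\<^sup>2 \<le> 1"
    using xm xc_bounds by (auto simp: abs_square_le_1 abs_le_iff)
  have L: "A * (xc - xm)\<^sup>2 = A * r\<^sup>2 + (1 - xm\<^sup>2) / 4 + 1/4"
    using xm(3) unfolding Q_center by (simp add: power2_eq_square algebra_simps)
  then have "A * r\<^sup>2 \<le> A * (xc - xm)\<^sup>2" using W by simp
  then have "r\<^sup>2 \<le> (xc - xm)\<^sup>2" using A_ge by simp
  then show "r \<le> xc - xm" using xm by (auto elim!: power2_le_imp_le)
  have "(1 - xm\<^sup>2) / 4 \<le> 1/4" using W by (simp only: divide_right_mono)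
  moreover have "a + u + 1/4 \<le> a + 1/2" if "u \<le> 1/4" for a u :: real using that by simp
  ultimately have "A * (xc - xm)\<^sup>2 \<le> A * r\<^sup>2 + 1/2" unfolding L by blast
  also have "1/2 \<le> 21/100 * (A * r\<^sup>2)" using A_r_square_ge_n n2_large by simp
  finally have "A * (xc - xm)\<^sup>2 \<le> A * (121/100 * r\<^sup>2)" by simp
  then have "(xc - xm)\<^sup>2 \<le> 121/100 * r\<^sup>2" using A_ge by simp
  also have "\<dots> = (11/10 * r)\<^sup>2" by (simp add: power_mult_distrib power_divide)
  finally have "(xc - xm)\<^sup>2 \<le> (11/10 * r)\<^sup>2" .
  then show "xc - xm \<le> 11/10 * r" by (rule power2_le_imp_le) (use r_pos in simp)
qed

lemma k_bounds: "k \<ge> 9/10 * A * r" "k \<le> 2 * A * r" "k \<ge> 10 ^ 10"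
proof -
  have Qc: "A * r\<^sup>2 \<le> Q xc" "Q xc \<le> A * r\<^sup>2 + 1/2"
    using one_minus_square_pos[OF xc_bounds] zero_le_power2[of xc] by (auto simp: Q_center field_simps)
  have "9/10 * A * r * (xc - xm) \<le> 9/10 * A * r * (11/10 * r)"
    using L_bounds A_ge r_pos by (intro mult_left_mono) auto
  also have "\<dots> \<le> A * r\<^sup>2" using A_ge r_pos by (simp add: power2_eq_square)
  finally show 1: "k \<ge> 9/10 * A * r" using Qc xm unfolding k_def by (simp add: pos_le_divide_eq)
  have "Q xc \<le> 2 * (A * r\<^sup>2)" using Qc A_r_square_ge by simp
  also have "\<dots> = 2 * A * r * r" by (simp add: power2_eq_square)
  also have "\<dots> \<le> 2 * A * r * (xc - xm)" using L_bounds A_ge r_pos by (intro mult_left_mono) auto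
  finally show "k \<le> 2 * A * r" using xm unfolding k_def by (simp add: pos_divide_le_eq)
  have "A * r * r \<le> A * r * 1" using r_le_1 A_ge r_pos by (intro mult_left_mono) auto
  then have "A * r \<ge> 10 ^ 12 / 4" using A_r_square_ge_n n2_large by (simp add: power2_eq_square)
  then show "k \<ge> 10 ^ 10" using 1 by simp
qed

text \<open>The equation makes \<open>- Q (xm - c) \<ge> k c\<close> just large enough to dominate the negative terms
  that the third derivative of \<open>1 / sqrt (x - (xm - c))\<close> contributes to the energy rate.\<close>

lemma airy_scale:
  obtains c where "0 \<le> c" "c \<le> 1 + xm" "c \<le> r / 2"
    "k * c ^ 3 = (1 - (xm - c)\<^sup>2)\<^sup>2 + 2 * (1 - (xm - c)\<^sup>2) * c"
proof -
  define f where "f c = k * c ^ 3 - ((1 - (xm - c)\<^sup>2)\<^sup>2 + 2 * (1 - (xm - c)\<^sup>2) * c)" for c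
  \<comment> \<open>The intermediate value theorem is applied on [0, m]: the point xm - c may
    neither pass -1 nor move more than r/2 from xm.\<close>
  define m where "m = min (1 + xm) (r / 2)"
  have m: "0 \<le> m" using xm r_pos by (simp add: m_def)
  have "f 0 \<le> 0" by (simp add: f_def)
  moreover have "f m \<ge> 0"
  proof (cases "1 + xm \<le> r / 2")
    case True
    then have "m = 1 + xm" by (simp add: m_def)
    \<comment> \<open>Here xm - m = -1, so both subtracted terms vanish.\<close>
    then show ?thesis using k_bounds xm by (simp add: f_def)
  next
    case False
    then have m: "m = r / 2" by (simp add: m_def)
    \<comment> \<open>Each subtracted term is at most A r^4 / 100 for large n, whereas k m^3 is at
      least A r^4 / 50.\<close>
    define w where "w = 1 - (xm - m)\<^sup>2"
    define B where "B = r\<^sup>2 * A / \<mu>"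
    have B0: "B > 0" using r_pos A_ge \<mu>_pos by (simp add: B_def)
    have y: "xm - m \<ge> -1" using False m by simp
    have w: "w = (1 + (xm - m)) * (1 - (xm - m))" by (simp add: w_def power2_eq_square algebra_simps)
    have w0: "w \<ge> 0" unfolding w using y xm m r_pos xc_bounds by (intro mult_nonneg_nonneg) auto
    have "w \<le> (1 + xc) * (26/10 * (1 - xc))"
      unfolding w using y xm m r_pos L_bounds r_le xc_bounds by (intro mult_mono) auto
    also have "\<dots> = 26/10 * (1 - xc\<^sup>2)" by (simp add: power2_eq_square field_simps)
    also have "\<dots> \<le> 16 * B" using W_xc_le B0 by (simp add: B_def)
    finally have wB: "w \<le> 16 * B" .
    have "w\<^sup>2 \<le> (16 * B)\<^sup>2" using wB w0 by (intro power_mono)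
    then have 1: "w\<^sup>2 \<le> 256 * B\<^sup>2" by (simp add: power_mult_distrib)
    have 2: "2 * w * m \<le> 16 * B * r" using wB r_pos by (simp add: m)
    have 3: "256 * B\<^sup>2 \<le> A * r ^ 4 / 100"
    proof -
      have "25600 * A \<le> \<mu>\<^sup>2"
      proof -
        have "25600 * A \<le> (real n)\<^sup>2 / 4 * A" using n2_large A_ge by (intro mult_right_mono) auto
        then show ?thesis using \<mu>_square_ge by simp
      qed
      then have "A / \<mu>\<^sup>2 \<le> 1 / 25600" using \<mu>_pos by (simp add: divide_le_eq)
      then have "256 * (A * r ^ 4) * (A / \<mu>\<^sup>2) \<le> 256 * (A * r ^ 4) * (1 / 25600)"
        using A_ge r_pos by (intro mult_left_mono) auto
      moreover have "256 * B\<^sup>2 = 256 * (A * r ^ 4) * (A / \<mu>\<^sup>2)"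
        by (simp add: B_def power_mult_distrib power_divide power2_eq_square power4_eq_xxxx)
      ultimately show ?thesis by simp
    qed
    have 4: "16 * B * r \<le> A * r ^ 4 / 100"
    proof -
      have "1600 \<le> r * \<mu>" using r_\<mu>_ge n2_large by simp
      then have "16 / \<mu> \<le> r / 100" using \<mu>_pos by (simp add: field_simps)
      then have "(A * r ^ 3) * (16 / \<mu>) \<le> (A * r ^ 3) * (r / 100)"
        using A_ge r_pos by (intro mult_left_mono) auto
      moreover have "16 * B * r = (A * r ^ 3) * (16 / \<mu>)" "A * r ^ 4 / 100 = (A * r ^ 3) * (r / 100)"
        by (simp_all add: B_def power2_eq_square power3_eq_cube power4_eq_xxxx)
      ultimately show ?thesis by (simp only:)
    qed
    have "9/10 * A * r * (r / 2) ^ 3 \<le> k * (r / 2) ^ 3"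
      using k_bounds r_pos by (intro mult_right_mono) auto
    moreover have "A * r ^ 4 / 50 \<le> 9/10 * A * r * (r / 2) ^ 3"
      using A_ge r_pos by (simp add: eval_nat_numeral)
    ultimately have "A * r ^ 4 / 50 \<le> k * m ^ 3" by (simp only: m)
    then show ?thesis unfolding f_def w_def[symmetric] using 1 2 3 4 by linarith
  qed
  moreover have "continuous_on {0..m} f" unfolding f_def by (intro continuous_intros)
  ultimately obtain c where "0 \<le> c" "c \<le> m" "f c = 0" using IVT'[of f 0 0 m] m by auto
  then show ?thesis using that[of c] by (auto simp: f_def m_def)
qed

text \<open>Two bounds for two regimes: the one through 1 - xc^2 serves S above n. The one through
  S^2 serves S at most n; it is read off from Q xm = 0 written in terms of \<alpha> and
  \<beta>.\<close>

lemma square_le_of_near_root: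
  assumes "0 \<le> c" "c \<le> r / 2" "-1 \<le> xm - c"
  shows "0 \<le> 1 - (xm - c)\<^sup>2" "1 - (xm - c)\<^sup>2 \<le> 26/10 * (1 - xc\<^sup>2)"
    "(1 - (xm - c)\<^sup>2) * (A + 1/4) \<le> 3/2 * S\<^sup>2"
proof -
  define y where "y = xm - c"
  have w: "1 - y\<^sup>2 = (1 + y) * (1 - y)" by (simp add: power2_eq_square algebra_simps)
  have y: "-1 \<le> y" "y \<le> xm" "1 - y \<le> 26/10 * (1 - xc)" "1 - y \<le> 3/2 * (1 - xm)" "y < 1"
    using assms L_bounds r_le xc_bounds xm by (auto simp: y_def)
  show "0 \<le> 1 - (xm - c)\<^sup>2" unfolding y_def[symmetric] w using y by (intro mult_nonneg_nonneg) auto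
  have "1 - y\<^sup>2 \<le> (1 + xc) * (26/10 * (1 - xc))"
    unfolding w using y xm xc_bounds by (intro mult_mono) auto
  then show "1 - (xm - c)\<^sup>2 \<le> 26/10 * (1 - xc\<^sup>2)"
    by (simp add: y_def power2_eq_square field_simps)
  have "1 - y\<^sup>2 \<le> (1 + xm) * (3/2 * (1 - xm))"
    unfolding w using y xm xc_bounds by (intro mult_mono) auto
  also have "\<dots> = 3/2 * (1 - xm\<^sup>2)" by (simp add: power2_eq_square field_simps)
  finally have "(1 - y\<^sup>2) * (A + 1/4) \<le> 3/2 * (1 - xm\<^sup>2) * (A + 1/4)"
    using A_ge by (intro mult_right_mono) auto
  also have "\<dots> = 3/2 * ((\<alpha>\<^sup>2 - 1/4) / 2 * (1 + xm) + (\<beta>\<^sup>2 - 1/4) / 2 * (1 - xm))"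
  proof -
    have *: "t = a + b" if "t - a - b = 0" for t a b :: real using that by simp
    have "(A + 1/4) * (1 - xm\<^sup>2) = (\<alpha>\<^sup>2 - 1/4) / 2 * (1 + xm) + (\<beta>\<^sup>2 - 1/4) / 2 * (1 - xm)"
      by (rule *) (use xm(3) in \<open>unfold Q_alt\<close>)
    moreover have "3/2 * z * a = 3/2 * (a * z)" for a z :: real by simp
    ultimately show ?thesis by (simp only:)
  qed
  also have "\<dots> \<le> 3/2 * (S\<^sup>2 / 2 * (1 + xm) + S\<^sup>2 / 2 * (1 - xm))"
  proof -
    have "\<bar>\<alpha>\<bar> \<le> \<bar>S\<bar>" "\<bar>\<beta>\<bar> \<le> \<bar>S\<bar>" using \<beta> \<alpha>_ge by (auto simp: S_def abs_le_iff)
    then have "\<alpha>\<^sup>2 \<le> S\<^sup>2" "\<beta>\<^sup>2 \<le> S\<^sup>2" by (simp_all add: abs_le_square_iff)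
    then show ?thesis using xm xc_bounds by (intro mult_left_mono add_mono mult_right_mono) auto
  qed
  also have "\<dots> = 3/2 * S\<^sup>2" by (simp add: field_simps)
  finally show "(1 - (xm - c)\<^sup>2) * (A + 1/4) \<le> 3/2 * S\<^sup>2" by (simp add: y_def)
qed

text \<open>The energy for h = (x - y0)^(-1/2) yields r X v^2 at most 2048^2 at x0, where X = x0 -
  y0. As 1 - x0^2 is at most w0 + 2 X, the square of G splits into u = w0 / (X r) and 2 / r; the
  cubic bound on u is w0^2 at most k c^3 at most k X^3.\<close>

lemma airy_bound:
  assumes x0: "-1 < x0" "xm \<le> x0" "x0 \<le> xc"
  obtains u w0 where "0 \<le> u" "0 \<le> w0" "(G x0)\<^sup>2 \<le> 2048\<^sup>2 * (u + 2 / r)" "u ^ 3 \<le> 2 * A * w0 / r\<^sup>2"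
    "w0 \<le> 26/10 * (1 - xc\<^sup>2)" "w0 * (A + 1/4) \<le> 3/2 * S\<^sup>2"
proof -
  obtain c where c: "0 \<le> c" "c \<le> 1 + xm" "c \<le> r / 2"
    and kc: "k * c ^ 3 = (1 - (xm - c)\<^sup>2)\<^sup>2 + 2 * (1 - (xm - c)\<^sup>2) * c"
    using airy_scale by blast
  define y0 where "y0 = xm - c"
  define w0 where "w0 = 1 - y0\<^sup>2"
  define X where "X = x0 - y0"
  define W where "W = 1 - x0\<^sup>2"
  define t where "t = sqrt X"
  have kc: "k * c ^ 3 = w0\<^sup>2 + 2 * w0 * c" using kc by (simp add: w0_def y0_def)
  have y0: "-1 \<le> y0" "y0 \<le> xm" "y0 \<le> x0" "y0 < 1" using c x0 xm xc_bounds by (auto simp: y0_def)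
  have w0: "0 \<le> w0" "w0 \<le> 26/10 * (1 - xc\<^sup>2)" "w0 * (A + 1/4) \<le> 3/2 * S\<^sup>2"
    using square_le_of_near_root[of c] c y0 by (auto simp: w0_def y0_def)
  have k0: "k > 0" using k_bounds by simp
  have x1: "x0 < 1" using x0 xc_bounds by simp
  have X: "X > 0" "c \<le> X" "X \<le> 2"
  proof -
    show "c \<le> X" "X \<le> 2" using x0 x1 y0 by (auto simp: X_def y0_def)
    \<comment> \<open>X = 0 would force c = 0, then w0 = 0 by the equation for c, and x0 would be an
      endpoint.\<close>
    have "X \<noteq> 0"
    proof
      assume "X = 0"
      then have "c = 0" "x0 = y0" using \<open>c \<le> X\<close> c by (auto simp: X_def)
      then have "1 - x0\<^sup>2 = 0" using kc by (simp add: w0_def)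
      then show False using one_minus_square_pos[OF x0(1) x1] by simp
    qed
    then show "X > 0" using \<open>c \<le> X\<close> c by simp
  qed
  have t: "t > 0" "t * t = X" using X by (auto simp: t_def)
  \<comment> \<open>The equation for c is scaled up to every z at least c; for c = 0 it forces w0 =
    0.\<close>
  have kcX: "w0\<^sup>2 + 2 * w0 * z \<le> k * c * z\<^sup>2" if z: "z > 0" "c \<le> z" for z
  proof (cases "c = 0")
    case True
    then show ?thesis using kc by simp
  next
    case False
    then have c0: "c > 0" using c by simp
    have "c\<^sup>2 * (w0\<^sup>2 + 2 * w0 * z) = w0\<^sup>2 * c\<^sup>2 + 2 * w0 * c * (c * z)"
      by (simp add: power2_eq_square algebra_simps)
    also have "\<dots> \<le> w0\<^sup>2 * z\<^sup>2 + 2 * w0 * c * (z * z)"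
      using z c0 w0 by (intro add_mono mult_left_mono mult_right_mono power_mono) auto
    also have "\<dots> = (w0\<^sup>2 + 2 * w0 * c) * z\<^sup>2" by (simp add: power2_eq_square algebra_simps)
    also have "\<dots> = c\<^sup>2 * (k * c * z\<^sup>2)"
      unfolding kc[symmetric] by (simp add: power2_eq_square power3_eq_cube)
    finally show ?thesis using c0 by simp
  qed
  define h where "h m x = 1 / sqrt (x - y0) ^ m" for m x
  have hd: "(h m has_real_derivative - (real m / 2) * h (m + 2) x) (at x)" if "x0 \<le> x" for m x
    using inverse_sqrt_power_has_derivative[of y0 x m] that X unfolding h_def[abs_def] by (simp add: X_def)
  have hlim: "(h m \<longlongrightarrow> h m 1) (at_left 1)" for m
    unfolding h_def[abs_def] using y0 by (intro tendsto_intros) auto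
  have "energy (h 1 x0) (- (1/2) * h 3 x0) (3/4 * h 5 x0) x0 \<le> 3 * A * sqrt r"
  proof (rule energy_le[where h = "h 1" and ?h1.0 = "\<lambda>x. - (1/2) * h 3 x" and ?h2.0 = "\<lambda>x. 3/4 * h 5 x"
        and ?h3.0 = "\<lambda>x. - (15/8) * h 7 x" and g = "\<lambda>x. (A + 3/16) * sqrt (x - y0)"])
    fix x :: real assume x: "x0 \<le> x" "x < 1"
    show "(h 1 has_real_derivative - (1/2) * h 3 x) (at x)"
      using hd[OF x(1), of 1] by (simp add: numeral_3_eq_3)
    show "((\<lambda>x. - (1/2) * h 3 x) has_real_derivative 3/4 * h 5 x) (at x)"
      by (rule DERIV_cong[OF DERIV_cmult[OF hd[OF x(1), of 3]]]) simp
    show "((\<lambda>x. 3/4 * h 5 x) has_real_derivative - (15/8) * h 7 x) (at x)"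
      by (rule DERIV_cong[OF DERIV_cmult[OF hd[OF x(1), of 5]]]) simp
    define Z where "Z = x - y0"
    define s where "s = sqrt Z"
    have Z: "Z > 0" "c \<le> Z" using x X by (auto simp: Z_def X_def)
    have s: "s > 0" "s * s = Z" using Z by (auto simp: s_def)
    have hs: "h m x = 1 / s ^ m" for m by (simp add: h_def s_def Z_def)
    have xZ: "x = y0 + Z" by (simp add: Z_def)
    \<comment> \<open>\<open>B\<close> is the rate multiplied by (x - y0)^(7/2).\<close>
    define B where "B = Z\<^sup>2 * (- Q y0 + 5/8 * w0) + 3/2 * w0 * y0 * Z - 15/16 * w0\<^sup>2 - (A + 3/16) * (Z\<^sup>2)\<^sup>2"
    have "2 * Qhat x * (- (1/2) * h 3 x) + Qhat' x * h 1 x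
      + ((1 - x\<^sup>2)\<^sup>2 * (- (15/8) * h 7 x) - 6 * x * (1 - x\<^sup>2) * (3/4 * h 5 x) + (6 * x\<^sup>2 - 2) * (- (1/2) * h 3 x)) / 2
      = (- Qhat x * Z\<^sup>2 + Qhat' x * (Z\<^sup>2 * Z)
        + (- (15/8) * (1 - x\<^sup>2)\<^sup>2 - 9/2 * x * (1 - x\<^sup>2) * Z - (6 * x\<^sup>2 - 2) / 2 * Z\<^sup>2) / 2) / s ^ 7"
      unfolding hs s(2)[symmetric] using s(1) by (simp add: field_simps eval_nat_numeral)
    also have "- Qhat x * Z\<^sup>2 + Qhat' x * (Z\<^sup>2 * Z)
        + (- (15/8) * (1 - x\<^sup>2)\<^sup>2 - 9/2 * x * (1 - x\<^sup>2) * Z - (6 * x\<^sup>2 - 2) / 2 * Z\<^sup>2) / 2 = B"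
    proof -
      have 1: "- Qhat x + Qhat' x * Z = - Qhat y0 - A * Z\<^sup>2"
        unfolding Qhat_eq Qhat'_eq xZ by (simp add: power2_eq_square algebra_simps)
      have "- Qhat x * Z\<^sup>2 + Qhat' x * (Z\<^sup>2 * Z) = (- Qhat x + Qhat' x * Z) * Z\<^sup>2" by (simp add: algebra_simps)
      then have 2: "- Qhat x * Z\<^sup>2 + Qhat' x * (Z\<^sup>2 * Z) = (- Qhat y0 - A * Z\<^sup>2) * Z\<^sup>2" unfolding 1 .
      have 3: "(- (15/8) * (1 - x\<^sup>2)\<^sup>2 - 9/2 * x * (1 - x\<^sup>2) * Z - (6 * x\<^sup>2 - 2) / 2 * Z\<^sup>2) / 2
        = Z\<^sup>2 * (- 1/4 + 3/8 * w0) - 3/4 * w0 * (- 2 * y0) * Z - 15/16 * w0\<^sup>2 - 3/16 * (Z\<^sup>2)\<^sup>2"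
        unfolding xZ w0_def using Z by (intro airy_rate_identity) simp
      have 4: "Qhat y0 = Q y0 - w0 / 4 - 1/4" by (simp add: Q_def w0_def)
      show ?thesis unfolding 2 3 4 B_def by (simp add: power2_eq_square field_simps)
    qed
    finally have rate: "2 * Qhat x * (- (1/2) * h 3 x) + Qhat' x * h 1 x
      + ((1 - x\<^sup>2)\<^sup>2 * (- (15/8) * h 7 x) - 6 * x * (1 - x\<^sup>2) * (3/4 * h 5 x) + (6 * x\<^sup>2 - 2) * (- (1/2) * h 3 x)) / 2
      = B / s ^ 7" .
    \<comment> \<open>- Q y0 is at least k c, and Z^2 k c pays for all negative terms with w0, by
      the choice of c.\<close>
    have "B \<ge> - (A + 3/16) * (Z\<^sup>2)\<^sup>2"
    proof -
      have "Q y0 \<le> - (k * c)"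
      proof -
        have "Q y0 = - (k * c) - c * ((A + 1/4) * (xc - y0))"
        proof -
          have "- c * (k + z) = - (k * c) - c * z" for z by (simp add: algebra_simps)
          moreover have "y0 - xm = - c" by (simp add: y0_def)
          ultimately show ?thesis using Q_factor[of y0] by (simp only:)
        qed
        moreover have "c * ((A + 1/4) * (xc - y0)) \<ge> 0" using c A_ge y0 xm by (intro mult_nonneg_nonneg) auto
        ultimately show ?thesis by simp
      qed
      then have "Z\<^sup>2 * (k * c) \<le> Z\<^sup>2 * (- Q y0 + 5/8 * w0)" using w0 by (intro mult_left_mono) auto
      moreover have "w0\<^sup>2 + 2 * w0 * Z \<le> Z\<^sup>2 * (k * c)" using kcX[OF Z] by (simp add: mult_ac)
      moreover have "- (2 * w0 * Z) \<le> 3/2 * w0 * y0 * Z"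
      proof -
        have "3/2 * (w0 * Z) * (-1) \<le> 3/2 * (w0 * Z) * y0" using w0 Z y0 by (intro mult_left_mono) auto
        moreover have "w0 * Z \<ge> 0" using w0 Z by simp
        ultimately show ?thesis by (simp add: mult_ac)
      qed
      moreover have "w0\<^sup>2 \<ge> 0" by simp
      ultimately have "Z\<^sup>2 * (- Q y0 + 5/8 * w0) + 3/2 * w0 * y0 * Z - 15/16 * w0\<^sup>2 \<ge> 0" by linarith
      moreover have "- a * z \<le> t - a * z" if "t \<ge> 0" for a t z :: real using that by simp
      ultimately show ?thesis unfolding B_def by blast
    qed
    then have "- (A + 3/16) * (Z\<^sup>2)\<^sup>2 / s ^ 7 \<le> B / s ^ 7" using s by (intro divide_right_mono) auto
    moreover have "- (A + 3/16) * (Z\<^sup>2)\<^sup>2 / s ^ 7 = - ((A + 3/16) * s)"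
      unfolding s(2)[symmetric] using s(1) by (simp add: field_simps eval_nat_numeral)
    ultimately show "- ((A + 3/16) * sqrt (x - y0)) \<le> 2 * Qhat x * (- (1/2) * h 3 x) + Qhat' x * h 1 x
      + ((1 - x\<^sup>2)\<^sup>2 * (- (15/8) * h 7 x) - 6 * x * (1 - x\<^sup>2) * (3/4 * h 5 x) + (6 * x\<^sup>2 - 2) * (- (1/2) * h 3 x)) / 2"
      unfolding rate by (simp add: s_def Z_def)
  next
    show "((\<lambda>x. - (1/2) * h 3 x) \<longlongrightarrow> - (1/2) * h 3 1) (at_left 1)"
      "((\<lambda>x. 3/4 * h 5 x) \<longlongrightarrow> 3/4 * h 5 1) (at_left 1)"
      by (intro tendsto_intros hlim)+
    show "continuous_on {x0..<1} (\<lambda>x. (A + 3/16) * sqrt (x - y0))"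
      by (intro continuous_intros)
    fix b assume b: "x0 < b" "b < 1"
    \<comment> \<open>AM-GM used twice majorises sqrt (\<rho>^2 + z) by 5/4 \<rho> + z^2 / (4
      \<rho>^3), a quadratic about the centre; mass and second moment then contribute 5/4 and
      3/8.\<close>
    define \<rho> where "\<rho> = sqrt (xc - y0)"
    have \<rho>2: "\<rho> * \<rho> = xc - y0" "\<rho> > 0" using y0 xm by (auto simp: \<rho>_def)
    have \<rho>r: "r \<le> \<rho> * \<rho>" "\<rho> * \<rho> \<le> 16/10 * r" unfolding \<rho>2 using L_bounds c by (auto simp: y0_def)
    have "integral {x0..b} (\<lambda>x. (A + 3/16) * sqrt (x - y0) * v x)
        \<le> (A + 3/16) * (5/4 * \<rho>) + (A + 3/16) / (4 * \<rho> ^ 3) * (3/2 * r\<^sup>2)"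
    proof (rule integral_v_quadratic_le)
      fix x assume x: "x \<in> {x0..b}"
      define z where "z = x - xc"
      have Z: "x - y0 = \<rho> * \<rho> + z" "x - y0 \<ge> 0" using x y0 by (auto simp: z_def \<rho>2)
      define s where "s = sqrt (x - y0)"
      have s: "s * s = \<rho> * \<rho> + z" "s \<ge> 0" using Z by (auto simp: s_def)
      have "0 \<le> (s - \<rho>)\<^sup>2" "0 \<le> (z - \<rho> * \<rho>)\<^sup>2" by simp_all
      then have 1: "2 * \<rho> * s \<le> \<rho> * \<rho> + (\<rho> * \<rho> + z)" and 2: "2 * (z * (\<rho> * \<rho>)) \<le> z\<^sup>2 + \<rho> ^ 4"
        using s by (auto simp: power2_eq_square power4_eq_xxxx algebra_simps)
      have "4 * \<rho> ^ 3 * s = 2 * (\<rho> * \<rho>) * (2 * \<rho> * s)" by (simp add: power3_eq_cube)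
      also have "\<dots> \<le> 2 * (\<rho> * \<rho>) * (\<rho> * \<rho> + (\<rho> * \<rho> + z))" using 1 by (intro mult_left_mono) simp_all
      also have "\<dots> = 4 * \<rho> ^ 4 + 2 * (z * (\<rho> * \<rho>))" by (simp add: power4_eq_xxxx algebra_simps)
      also have "\<dots> \<le> 5 * \<rho> ^ 4 + z\<^sup>2" using 2 by simp
      finally have "s \<le> (5 * \<rho> ^ 4 + z\<^sup>2) / (4 * \<rho> ^ 3)" using \<rho>2(2) by (simp add: pos_le_divide_eq mult.commute)
      also have "\<dots> = 5/4 * \<rho> + z\<^sup>2 / (4 * \<rho> ^ 3)"
        using \<rho>2(2) by (simp add: field_simps power3_eq_cube power4_eq_xxxx)
      finally have "(A + 3/16) * s \<le> (A + 3/16) * (5/4 * \<rho> + z\<^sup>2 / (4 * \<rho> ^ 3))"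
        using A_ge by (intro mult_left_mono) auto
      then show "(A + 3/16) * sqrt (x - y0) \<le> (A + 3/16) * (5/4 * \<rho>) + (A + 3/16) / (4 * \<rho> ^ 3) * (x - xc)\<^sup>2"
        by (simp add: s_def z_def distrib_left)
    qed (use x0 b A_ge \<rho>2(2) in \<open>auto intro!: continuous_intros\<close>)
    also have "\<dots> \<le> (A + 3/16) * (5/4 * \<rho>) + (A + 3/16) * (3/8 * \<rho>)"
    proof -
      have "r * r \<le> (\<rho> * \<rho>) * (\<rho> * \<rho>)" using \<rho>r r_pos by (intro mult_mono) auto
      then have "3/2 * r\<^sup>2 / (4 * \<rho> ^ 3) \<le> 3/2 * ((\<rho> * \<rho>) * (\<rho> * \<rho>)) / (4 * \<rho> ^ 3)"
        using \<rho>2(2) by (intro divide_right_mono mult_left_mono) (auto simp: power2_eq_square)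
      also have "\<dots> = 3/8 * \<rho>" using \<rho>2(2) by (simp add: power3_eq_cube)
      finally have "(A + 3/16) * (3/2 * r\<^sup>2 / (4 * \<rho> ^ 3)) \<le> (A + 3/16) * (3/8 * \<rho>)"
        using A_ge by (intro mult_left_mono) auto
      moreover have "(A + 3/16) / (4 * \<rho> ^ 3) * (3/2 * r\<^sup>2) = (A + 3/16) * (3/2 * r\<^sup>2 / (4 * \<rho> ^ 3))" by simp
      ultimately show ?thesis by (intro add_left_mono) (simp only:)
    qed
    also have "\<dots> = 13/8 * ((A + 3/16) * \<rho>)" by (simp add: algebra_simps)
    also have "\<dots> \<le> 13/8 * (5/4 * A * (13/10 * sqrt r))"
    proof -
      have "\<rho> \<le> 13/10 * sqrt r"
      proof (rule power2_le_imp_le)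
        show "\<rho>\<^sup>2 \<le> (13/10 * sqrt r)\<^sup>2"
          using \<rho>r r_pos by (simp add: power_mult_distrib power_divide power2_eq_square)
      qed (use r_pos in simp)
      then show ?thesis using A_ge \<rho>2(2) r_pos by (intro mult_left_mono mult_mono) auto
    qed
    also have "\<dots> \<le> 3 * A * sqrt r" using A_ge r_pos by simp
    finally show "integral {x0..b} (\<lambda>x. (A + 3/16) * sqrt (x - y0) * v x) \<le> 3 * A * sqrt r" .
  qed (use x0 x1 hlim in auto)
  \<comment> \<open>b / t is the coefficient of \<open>v x0\<close> that \<open>energy_ge\<close>
    leaves.\<close>
  moreover define b where "b = Qhat x0 + 3/8 * W\<^sup>2 / X\<^sup>2 + x0 * W / (2 * X) - W\<^sup>2 / (16 * X\<^sup>2)"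
  have ht: "h m x0 = 1 / t ^ m" for m by (simp add: h_def t_def X_def)
  have "b / t * v x0 \<le> energy (h 1 x0) (- (1/2) * h 3 x0) (3/4 * h 5 x0) x0"
  proof -
    have "h 1 x0 * Qhat x0 + (W\<^sup>2 * (3/4 * h 5 x0) - 2 * x0 * W * (- (1/2) * h 3 x0)) / 2
      - (W * (- (1/2) * h 3 x0))\<^sup>2 / (4 * h 1 x0) = b / t"
      unfolding ht b_def t(2)[symmetric] using t(1) by (simp add: field_simps eval_nat_numeral)
    then show ?thesis
      using energy_ge[OF x0(1) x1, of "h 1 x0" "3/4 * h 5 x0" "- (1/2) * h 3 x0"] t unfolding W_def by (simp add: ht)
  qed
  ultimately have bv: "b / t * v x0 \<le> 3 * A * sqrt r" by simp
  have b: "b \<ge> k * X / 512"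
  proof -
    define d where "d = x0 - xm"
    have d: "d \<ge> 0" "X = c + d" using x0 by (auto simp: d_def X_def y0_def)
    \<comment> \<open>In terms of w0 the correction to Q x0 splits into (6 W - w0) w0 / (16 X^2),
      nonnegative and of Airy size, and a remainder that is negligible against k X.\<close>
    have "5 * W\<^sup>2 + 8 * x0 * W * X - 4 * X\<^sup>2 * (W + 1) = (6 * W - w0) * w0 - X\<^sup>2 * (2 * w0 + 2 * W + X\<^sup>2)"
    proof -
      have *: "w0 = 1 - (x0 - X)\<^sup>2" by (simp add: w0_def X_def)
      show ?thesis unfolding W_def * by (simp add: power2_eq_square algebra_simps)
    qed
    moreover have Qx: "Qhat x0 = Q x0 - W / 4 - 1/4" by (simp add: Q_def W_def)
    have "(5 * W\<^sup>2 + 8 * x0 * W * X - 4 * X\<^sup>2 * (W + 1)) / (16 * X\<^sup>2) = b - Q x0"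
      unfolding b_def Qx using X(1) by (simp add: field_simps power2_eq_square)
    moreover have "(a - X\<^sup>2 * z) / (16 * X\<^sup>2) = a / (16 * X\<^sup>2) - z / 16" for a z
      using X by (simp add: field_simps power2_eq_square)
    ultimately have bQ: "b = Q x0 + (6 * W - w0) * w0 / (16 * X\<^sup>2) - (2 * w0 + 2 * W + X\<^sup>2) / 16"
      by simp
    have "d * k \<le> d * (k + (A + 1/4) * (xc - x0))" using d A_ge x0 by (intro mult_left_mono) auto
    then have Qd: "Q x0 \<ge> k * d" by (simp add: Q_factor[of x0] d_def mult.commute)
    have W: "W = (1 - x0) * (1 + x0)" by (simp add: W_def power2_eq_square algebra_simps)
    have w: "w0 = (1 - y0) * (1 + y0)" by (simp add: w0_def power2_eq_square algebra_simps)
    have x0': "1 - y0 \<le> 3 * (1 - x0)"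
      using L_bounds c r_le x0 by (simp add: y0_def)
    have W3: "w0 \<le> 3 * W"
    proof -
      have "(1 - y0) * (1 + y0) \<le> 3 * (1 - x0) * (1 + x0)"
        using x0' y0 x1 by (intro mult_mono) auto
      then show ?thesis unfolding w W by (simp only: mult.assoc)
    qed
    \<comment> \<open>Multiplied by w0, this turns the equation for c into the term k c^3 / (32
      X^2).\<close>
    have "6 * W - w0 \<ge> w0 / 2 + c"
    proof (cases "y0 \<le> 0")
      case True
      have "(1 - y0) * (1 + y0) \<le> 2 * (1 + y0)" using y0 by (intro mult_right_mono) auto
      then have "w0 / 2 + c \<le> 1 + x0" using X by (simp add: w X_def)
      moreover have "1 * (1 + x0) \<le> 3 * (1 - x0) * (1 + x0)" using x0' True x0(1) by (intro mult_right_mono) auto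
      then have "1 + x0 \<le> 3 * W" unfolding W by (simp only: mult.assoc mult_1)
      ultimately have "w0 / 2 + c \<le> 3 * W" by (rule order_trans)
      then show ?thesis using W3 by linarith
    next
      case False
      have "(1 - y0) * 1 \<le> (1 - y0) * (1 + y0)" using y0 False by (intro mult_left_mono) auto
      moreover have "2 * c \<le> 1 - y0" using c r_le x0 y0 xm by linarith
      ultimately have "2 * c \<le> w0" by (simp add: w)
      then show ?thesis using W3 by linarith
    qed
    then have "(w0 / 2 + c) * w0 \<le> (6 * W - w0) * w0" using w0 by (intro mult_right_mono) auto
    moreover have "(w0 / 2 + c) * w0 = k * c ^ 3 / 2" unfolding kc by (simp add: power2_eq_square algebra_simps)
    ultimately have "k * c ^ 3 / 2 / (16 * X\<^sup>2) \<le> (6 * W - w0) * w0 / (16 * X\<^sup>2)"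
      by (intro divide_right_mono) auto
    then have main: "k * d + k * c ^ 3 / (32 * X\<^sup>2) \<le> Q x0 + (6 * W - w0) * w0 / (16 * X\<^sup>2)"
      using Qd by simp
    \<comment> \<open>As X = c + d, either d is at least X/2 and Q x0 suffices, or c is at least X/2
      and the cubic term does.\<close>
    have pos: "k * X / 256 \<le> k * d + k * c ^ 3 / (32 * X\<^sup>2)"
    proof (cases "X / 2 \<le> d")
      case True
      have "k * (X / 2) \<le> k * d" using True k0 by (intro mult_left_mono) auto
      then have "k * X / 2 \<le> k * d" by simp
      moreover have "k * X \<ge> 0" "k * c ^ 3 / (32 * X\<^sup>2) \<ge> 0" using k0 X c by auto
      moreover have "K / 256 \<le> a + f" if "K / 2 \<le> a" "0 \<le> K" "0 \<le> f" for K a f :: real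
        using that by linarith
      ultimately show ?thesis by blast
    next
      case False
      then have "(X / 2) ^ 3 \<le> c ^ 3" using d X by (intro power_mono) auto
      then have "k * (X / 2) ^ 3 / (32 * X\<^sup>2) \<le> k * c ^ 3 / (32 * X\<^sup>2)"
        using k0 by (intro divide_right_mono mult_left_mono) auto
      moreover have "k * (X / 2) ^ 3 / (32 * X\<^sup>2) = k * X / 256"
        using X by (simp add: field_simps power2_eq_square power3_eq_cube)
      moreover have "k * d \<ge> 0" using k0 d by simp
      ultimately show ?thesis by simp
    qed
    \<comment> \<open>With k at least 10^10 and X at most 2, w0^2 at most k X^3 makes w0 small
      against k X.\<close>
    have wX: "w0 \<le> k * X / 1000"
    proof (rule power2_le_imp_le)
      have "w0\<^sup>2 \<le> k * c ^ 3" unfolding kc using w0 c by simp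
      also have "\<dots> \<le> k * X ^ 3" using k0 c X by (intro mult_left_mono power_mono) auto
      also have "\<dots> = k * X\<^sup>2 * X" by (simp add: power2_eq_square power3_eq_cube)
      also have "\<dots> \<le> k * X\<^sup>2 * (k / 1000000)" using k0 X k_bounds(3) by (intro mult_left_mono) auto
      also have "\<dots> = (k * X / 1000)\<^sup>2" by (simp add: power2_eq_square)
      finally show "w0\<^sup>2 \<le> (k * X / 1000)\<^sup>2" .
    qed (use k0 X in simp)
    have "6 * X \<le> k / 1000 * X" using k_bounds(3) X by (intro mult_right_mono) auto
    then have "6 * X \<le> k * X / 1000" by simp
    moreover have "X\<^sup>2 \<le> 2 * X" using X by (simp add: power2_eq_square)
    moreover have "W \<le> w0 + 2 * X"
    proof -
      have "W = w0 + 2 * ((- y0) * X) - X\<^sup>2" by (simp add: W_def w0_def X_def power2_eq_square algebra_simps)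
      moreover have "(- y0) * X \<le> 1 * X" using y0 X by (intro mult_right_mono) auto
      ultimately show ?thesis using zero_le_power2[of X] by linarith
    qed
    ultimately have "2 * w0 + 2 * W + X\<^sup>2 \<le> 5 * (k * X / 1000)" using wX by linarith
    moreover have "K / 512 \<le> z" if "g \<le> 5 * (K / 1000)" "z = a + f - g / 16" "M \<le> a + f" "K / 256 \<le> M" "0 < K"
      for K z a f g M :: real using that by linarith
    ultimately show ?thesis using bQ main pos mult_pos_pos[OF k0 X(1)] by blast
  qed
  have v0: "v x0 \<ge> 0" using x0(1) x1 by (rule v_nonneg)
  \<comment> \<open>1536 = 3 * 512; division by 9/10 below leaves a number under 2048.\<close>
  have "k * t * v x0 \<le> 1536 * A * sqrt r"
  proof -
    have "k * t * v x0 / 512 = k * X / 512 / t * v x0" unfolding t(2)[symmetric] using t(1) by simp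
    also have "\<dots> \<le> b / t * v x0"
      using b t v0 by (intro mult_right_mono divide_right_mono) auto
    also note bv
    finally show ?thesis by simp
  qed
  moreover have "9/10 * A * r * (t * v x0) \<le> k * (t * v x0)"
    using k_bounds t v0 by (intro mult_right_mono) auto
  ultimately have "A * (9/10 * r * (t * v x0)) \<le> A * (1536 * sqrt r)" by (simp add: mult_ac)
  then have "9/10 * r * (t * v x0) \<le> 1536 * sqrt r" using A_ge by simp
  then have "(9/10 * r * (t * v x0))\<^sup>2 \<le> (1536 * sqrt r)\<^sup>2"
    using r_pos t v0 by (intro power_mono) auto
  then have "r * (81/100 * r * X * (v x0)\<^sup>2) \<le> r * 1536\<^sup>2"
    using r_pos by (simp add: power_mult_distrib power_divide t(2)[symmetric] power2_eq_square mult_ac)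
  then have Xv: "r * X * (v x0)\<^sup>2 \<le> 2048\<^sup>2" using r_pos by (simp add: mult_ac)
  define u where "u = w0 / (X * r)"
  have "(G x0)\<^sup>2 = W * (v x0)\<^sup>2"
    using one_minus_square_pos[OF x0(1) x1] by (simp add: G_def W_def power_mult_distrib)
  also have "\<dots> \<le> (w0 + 2 * X) * (v x0)\<^sup>2"
  proof (rule mult_right_mono)
    have "W = w0 + 2 * (- y0) * X - X\<^sup>2" by (simp add: W_def w0_def X_def power2_eq_square algebra_simps)
    moreover have "(- y0) * X \<le> 1 * X" using y0 X by (intro mult_right_mono) auto
    ultimately show "W \<le> w0 + 2 * X" using zero_le_power2[of X] by linarith
  qed simp
  also have "\<dots> = (u + 2 / r) * (r * X * (v x0)\<^sup>2)"
    using X r_pos by (simp add: u_def field_simps)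
  also have "\<dots> \<le> (u + 2 / r) * 2048\<^sup>2"
    using Xv w0 X r_pos by (intro mult_left_mono) (auto simp: u_def)
  finally have G2: "(G x0)\<^sup>2 \<le> 2048\<^sup>2 * (u + 2 / r)" by (simp add: mult.commute)
  have "u ^ 3 \<le> 2 * A * w0 / r\<^sup>2"
  proof -
    have "w0\<^sup>2 \<le> k * c ^ 3" unfolding kc using w0 c by simp
    also have "\<dots> \<le> k * X ^ 3" using k0 c X by (intro mult_left_mono power_mono) auto
    finally have "w0\<^sup>2 * w0 \<le> k * X ^ 3 * w0" using w0 by (intro mult_right_mono) auto
    then have "u ^ 3 \<le> k * X ^ 3 * w0 / (X * r) ^ 3"
      unfolding u_def power_divide using X r_pos by (intro divide_right_mono) (auto simp: power2_eq_square power3_eq_cube)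
    also have "\<dots> = k * w0 / r ^ 3" using X by (simp add: power_mult_distrib)
    also have "\<dots> \<le> 2 * A * r * w0 / r ^ 3"
      using k_bounds w0 r_pos by (intro divide_right_mono mult_right_mono) auto
    also have "\<dots> = 2 * A * w0 / r\<^sup>2" using r_pos by (simp add: power2_eq_square power3_eq_cube)
    finally show ?thesis .
  qed
  then show ?thesis using that[of u w0] G2 w0 X r_pos by (simp add: u_def)
qed

end

end

section \<open>Degree zero and the final bound\<close>

lemma Phi_ge:
  assumes "S \<ge> 0"
  shows "1 \<le> Phi n S" "S \<le> Phi n S ^ 3" "S ^ 3 \<le> Phi n S ^ 6 * (real n + 1)"
proof -
  show 1: "1 \<le> Phi n S" unfolding Phi_def by (intro Max_ge) auto
  have pw: "(t powr (1 / real m)) ^ m = t" if "t \<ge> 0" "m > 0" for t :: real and m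
    using that by (cases "t = 0") (simp_all add: powr_powr flip: powr_realpow)
  have "S powr (1/3) \<le> Phi n S" unfolding Phi_def by (intro Max_ge) auto
  then have "(S powr (1/3)) ^ 3 \<le> Phi n S ^ 3" by (intro power_mono) auto
  then show "S \<le> Phi n S ^ 3" using pw[OF assms, of 3] by simp
  define N where "N = real n + 1"
  have N: "N > 0" by (simp add: N_def)
  have "S powr (1/2) / N powr (1/6) \<le> Phi n S" unfolding Phi_def N_def by (intro Max_ge) auto
  then have "(S powr (1/2) / N powr (1/6)) ^ 6 \<le> Phi n S ^ 6" by (intro power_mono) auto
  moreover have "(S powr (1/2) / N powr (1/6)) ^ 6 = S ^ 3 / N"
  proof -
    have "(S powr (1/2)) ^ 6 = ((S powr (1/2)) ^ 2) ^ 3" by (simp flip: power_mult)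
    moreover have "(S powr (1/2)) ^ 2 = S" using pw[OF assms, of 2] by simp
    ultimately have "(S powr (1/2)) ^ 6 = S ^ 3" by (simp only:)
    then show ?thesis using pw[of N 6] N by (simp add: power_divide)
  qed
  ultimately show "S ^ 3 \<le> Phi n S ^ 6 * (real n + 1)"
    using N by (simp add: pos_divide_le_eq N_def)
qed

context jacobi_solution_pos begin

abbreviation "\<phi> \<equiv> Phi n S"

lemma \<phi>_ge: "1 \<le> \<phi>" "S \<le> \<phi> ^ 3" "S ^ 3 \<le> \<phi> ^ 6 * (real n + 1)"
  using Phi_ge[OF S_nonneg] by auto

text \<open>The cube of S / (n + 1) is at most S^3 / (n + 1), which the third entry of
  \<open>Phi\<close> controls.\<close>

lemma \<Psi>_le_\<phi>: "\<Psi> \<le> \<phi>\<^sup>2"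
proof -
  have "S / (real n + 1) \<le> \<phi>\<^sup>2"
  proof (rule power_le_imp_le_base)
    have "(S / (real n + 1)) ^ Suc 2 = S ^ 3 / (real n + 1) / (real n + 1)\<^sup>2"
      by (simp add: power_divide power3_eq_cube power2_eq_square)
    also have "\<dots> \<le> S ^ 3 / (real n + 1) / 1"
    proof (rule divide_left_mono)
      show "1 \<le> (real n + 1)\<^sup>2" by (rule one_le_power) simp
    qed (use S_nonneg in auto)
    also have "\<dots> \<le> \<phi> ^ 6" using \<phi>_ge(3) by (simp add: pos_divide_le_eq)
    also have "\<dots> = (\<phi>\<^sup>2) ^ Suc 2" by (simp flip: power_mult)
    finally show "(S / (real n + 1)) ^ Suc 2 \<le> (\<phi>\<^sup>2) ^ Suc 2" .
  qed simp
  moreover have "1 \<le> \<phi>\<^sup>2" using \<phi>_ge(1) by simp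
  ultimately show ?thesis by (simp add: \<Psi>_def)
qed

lemma sqrt_\<Psi>_le: "sqrt \<Psi> \<le> \<phi>"
  using \<Psi>_le_\<phi> \<phi>_ge(1) by (intro real_le_lsqrt) auto

text \<open>N S is only of order N^(4/3) \<phi>^2, a loss that grows with the degree and is
  tolerable only below a fixed threshold. The constant comes from 8 (10^13 + 10^9), at most (4 *
  10^7)^2.\<close>

lemma \<kappa>_le:
  assumes "n \<le> 10 ^ 6"
  shows "2 * \<kappa> \<le> 4 * 10 ^ 7 * \<phi>"
proof -
  define N where "N = real n + 1"
  have "real n \<le> 10 ^ 6" using assms by (metis of_nat_le_iff of_nat_numeral of_nat_power)
  then have N: "1 \<le> N" "N \<le> 2 * 10 ^ 6" by (auto simp: N_def)
  have "N * S \<le> 10 ^ 9 * \<phi>\<^sup>2"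
  proof (rule power_le_imp_le_base)
    have "(N * S) ^ Suc 2 = N ^ 3 * S ^ 3" by (simp add: power_mult_distrib)
    also have "\<dots> \<le> N ^ 3 * (\<phi> ^ 6 * N)" using \<phi>_ge(3) N by (intro mult_left_mono) (auto simp: N_def)
    also have "\<dots> = N ^ 4 * \<phi> ^ 6" by (simp add: eval_nat_numeral)
    also have "\<dots> \<le> (2 * 10 ^ 6) ^ 4 * \<phi> ^ 6" using N \<phi>_ge(1) by (intro mult_right_mono power_mono) auto
    also have "\<dots> \<le> 10 ^ 27 * \<phi> ^ 6" using \<phi>_ge(1) by (intro mult_right_mono) auto
    also have "\<dots> = (10 ^ 9 * \<phi>\<^sup>2) ^ Suc 2" by (simp add: power_mult_distrib flip: power_mult)
    finally show "(N * S) ^ Suc 2 \<le> (10 ^ 9 * \<phi>\<^sup>2) ^ Suc 2" .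
  qed simp
  moreover have "N * N \<le> 10 ^ 13 * \<phi>\<^sup>2"
  proof -
    have "N * N \<le> (2 * 10 ^ 6) * (2 * 10 ^ 6)" using N by (intro mult_mono) auto
    also have "\<dots> \<le> 10 ^ 13 * 1" by simp
    also have "\<dots> \<le> 10 ^ 13 * \<phi>\<^sup>2" using \<phi>_ge(1) by (intro mult_left_mono) auto
    finally show ?thesis .
  qed
  ultimately have "8 * (N * N + N * S) \<le> 16 * 10 ^ 14 * \<phi>\<^sup>2"
  proof -
    have "8 * (a + b) \<le> 16 * 10 ^ 14 * f" if "b \<le> 10 ^ 9 * f" "a \<le> 10 ^ 13 * f" "0 \<le> f" for a b f :: real
      using that by simp
    then show ?thesis using \<open>N * S \<le> 10 ^ 9 * \<phi>\<^sup>2\<close> \<open>N * N \<le> 10 ^ 13 * \<phi>\<^sup>2\<close> zero_le_power2 by blast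
  qed
  moreover have "(2 * \<kappa>)\<^sup>2 = 8 * (N * N + N * S)"
    using S_nonneg by (simp add: \<kappa>_def power_mult_distrib N_def algebra_simps)
  ultimately have "(2 * \<kappa>)\<^sup>2 \<le> (4 * 10 ^ 7 * \<phi>)\<^sup>2" by (simp add: power_mult_distrib)
  then show ?thesis using \<phi>_ge(1) by (elim power2_le_imp_le) simp
qed

lemma one_over_r_le: "1 / r \<le> 3 * \<Psi>"
proof -
  have "1 = (2/3 * \<mu> / A) * (3/2 * A / \<mu>)" using \<mu>_pos A_ge by simp
  also have "\<dots> \<le> r * (3/2 * A / \<mu>)" using r_ge A_ge \<mu>_pos by (intro mult_right_mono) auto
  finally have "1 / r \<le> 3/2 * A / \<mu>" using r_pos by (simp add: pos_divide_le_eq mult.commute)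
  also have "\<dots> \<le> 3 * \<Psi>" using A_le \<mu>_pos by (simp add: pos_divide_le_eq mult_ac)
  finally show ?thesis .
qed

text \<open>For S at most n, r is at least 1/3 and the quotient at most 27 S^2; for S above n it is
  at most 288 S^3 / (n + 1). 343 = 7^3 is a cube above both constants.\<close>

lemma airy_factor_le:
  assumes "0 \<le> w0" "w0 \<le> 26/10 * (1 - xc\<^sup>2)" "w0 * (A + 1/4) \<le> 3/2 * S\<^sup>2" "S \<ge> 1"
  shows "2 * A * w0 / r\<^sup>2 \<le> 343 * \<phi> ^ 6"
proof (cases "S \<le> real n")
  case True
  then have "\<Psi> = 1" by (simp add: \<Psi>_def)
  then have "1 / r \<le> 3" using one_over_r_le by simp
  then have "(1 / r)\<^sup>2 \<le> 3\<^sup>2" using r_pos by (intro power_mono) auto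
  then have r: "1 / r\<^sup>2 \<le> 9" by (simp add: power_divide)
  have "A * w0 \<le> w0 * (A + 1/4)" using assms(1) by (simp add: algebra_simps)
  then have "2 * A * w0 \<le> 3 * S\<^sup>2" using assms(3) by simp
  then have "2 * A * w0 * (1 / r\<^sup>2) \<le> 3 * S\<^sup>2 * 9" using r assms(1) A_ge by (intro mult_mono[of "2 * A * w0" _ "1 / r\<^sup>2" 9]) auto
  also have "S\<^sup>2 \<le> (\<phi> ^ 3)\<^sup>2" using \<phi>_ge(2) S_nonneg by (intro power_mono)
  then have "S\<^sup>2 \<le> \<phi> ^ 6" by (simp flip: power_mult)
  then have "3 * S\<^sup>2 * 9 \<le> 343 * \<phi> ^ 6" using zero_le_power2[of S] by linarith
  finally show ?thesis by simp
next
  case False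
  have n0: "real n + 1 > 0" by simp
  have "2 * A * w0 / r\<^sup>2 \<le> 2 * A * (16 * r\<^sup>2 * A / \<mu>) / r\<^sup>2"
  proof (intro divide_right_mono mult_left_mono)
    have "0 \<le> r\<^sup>2 * A / \<mu>" using A_ge \<mu>_pos by simp
    then show "w0 \<le> 16 * r\<^sup>2 * A / \<mu>" using assms(2) W_xc_le by simp
  qed (use A_ge in auto)
  also have "\<dots> = 32 * A * (A / \<mu>)" using r_pos by simp
  also have "\<dots> \<le> 32 * (9/4 * S\<^sup>2) * (4 * S / (real n + 1))"
  proof (rule mult_mono)
    have "(real n + S / 2)\<^sup>2 \<le> (3/2 * S)\<^sup>2" using False S_nonneg by (intro power_mono) auto
    then show "32 * A \<le> 32 * (9/4 * S\<^sup>2)" by (simp add: A_eq power_mult_distrib power_divide)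
    have "A / \<mu> \<le> 2 * \<Psi>" using A_le \<mu>_pos by (simp add: pos_divide_le_eq mult_ac)
    also have "\<Psi> \<le> 2 * S / (real n + 1)"
      using False assms(4) by (simp add: \<Psi>_def pos_le_divide_eq divide_right_mono)
    finally show "A / \<mu> \<le> 4 * S / (real n + 1)" by simp
  qed (use A_ge \<mu>_pos S_nonneg in auto)
  also have "\<dots> = 288 * (S ^ 3 / (real n + 1))" by (simp add: power2_eq_square power3_eq_cube)
  also have "\<dots> \<le> 288 * \<phi> ^ 6" using \<phi>_ge(3) n0 by (intro mult_left_mono) (auto simp: pos_divide_le_eq)
  also have "\<dots> \<le> 343 * \<phi> ^ 6" by simp
  finally show ?thesis .
qed

text \<open>Left of the turning point G increases, so [xm, xc] suffices. There u + 2 / r is at most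
  (7 + 6) \<phi>^2, rounded up to 16 \<phi>^2, and 8192 = 2048 * 4.\<close>

lemma G_le_airy:
  assumes \<beta>: "\<beta> \<ge> 1/2" and n_large: "n \<ge> 10 ^ 6" and x0: "-1 < x0" "x0 \<le> xc"
  shows "G x0 \<le> 8192 * \<phi>"
proof -
  have "Q (-1) \<le> 0"
  proof -
    have "(1/2)\<^sup>2 \<le> \<beta>\<^sup>2" using \<beta> by (intro power_mono) auto
    then show ?thesis by (simp add: Q_alt power_divide)
  qed
  moreover have "Q xc > 0" using Q_xc_ge A_r_square_ge by simp
  moreover have "continuous_on {-1..xc} Q"
    unfolding Q_alt[abs_def] by (intro continuous_intros)
  ultimately obtain xm where xm: "-1 \<le> xm" "xm \<le> xc" "Q xm = 0"
    using IVT'[of Q "-1" 0 xc] xc_bounds by auto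
  then have xm': "xm < xc" using \<open>Q xc > 0\<close> by (cases "xm = xc") auto
  have S1: "S \<ge> 1" using \<beta> \<alpha>_ge by (simp add: S_def)
  have right: "G x \<le> 8192 * \<phi>" if x: "-1 < x" "xm \<le> x" "x \<le> xc" for x
  proof -
    obtain u w0 where u: "0 \<le> u" "0 \<le> w0" "(G x)\<^sup>2 \<le> 2048\<^sup>2 * (u + 2 / r)" "u ^ 3 \<le> 2 * A * w0 / r\<^sup>2"
      "w0 \<le> 26/10 * (1 - xc\<^sup>2)" "w0 * (A + 1/4) \<le> 3/2 * S\<^sup>2"
      using airy_bound[OF \<beta> n_large xm(1) xm' xm(3) x] by blast
    have "u \<le> 7 * \<phi>\<^sup>2"
    proof (rule power_le_imp_le_base)
      have "u ^ Suc 2 \<le> 343 * \<phi> ^ 6" using u(4) airy_factor_le[OF u(2,5,6) S1] by simp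
      also have "\<dots> = (7 * \<phi>\<^sup>2) ^ Suc 2" by (simp add: power_mult_distrib flip: power_mult)
      finally show "u ^ Suc 2 \<le> (7 * \<phi>\<^sup>2) ^ Suc 2" .
    qed simp
    moreover have "2 / r \<le> 6 * \<phi>\<^sup>2" using one_over_r_le \<Psi>_le_\<phi> by simp
    ultimately have "u + 2 / r \<le> 16 * \<phi>\<^sup>2" using zero_le_power2[of \<phi>] by linarith
    then have "2048\<^sup>2 * (u + 2 / r) \<le> 2048\<^sup>2 * (16 * \<phi>\<^sup>2)" by (rule mult_left_mono) simp
    also have "\<dots> = (8192 * \<phi>)\<^sup>2" by (simp add: power_mult_distrib)
    finally have "(G x)\<^sup>2 \<le> (8192 * \<phi>)\<^sup>2" using u(3) by (rule order_trans[rotated])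
    then show ?thesis using \<phi>_ge(1) by (elim power2_le_imp_le) simp
  qed
  show ?thesis
  proof (cases "xm \<le> x0")
    case True
    then show ?thesis using right x0 by simp
  next
    case False
    have "G x0 \<le> G xm"
    proof (rule G_mono_of_Q_nonpos[OF \<beta>])
      fix x assume x: "-1 < x" "x \<le> xm"
      have "k xm + (A + 1/4) * (xc - x) \<ge> 0"
        using k_bounds(3)[OF \<beta> n_large xm(1) xm' xm(3)] A_ge x xm' by simp
      then show "Q x \<le> 0"
        unfolding Q_factor[OF \<beta> n_large xm(1) xm' xm(3)] using x by (simp add: mult_nonpos_nonneg)
    qed (use False x0 xm' xc_bounds in auto)
    also have "\<dots> \<le> 8192 * \<phi>" using False x0 xm' by (intro right) auto
    finally show ?thesis .
  qed
qed

lemma G_le_left: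
  assumes x0: "-1 < x0" "x0 \<le> xc"
  shows "G x0 \<le> 4 * 10 ^ 7 * \<phi>"
proof -
  have \<phi>: "\<phi> \<ge> 0" using \<phi>_ge(1) by simp
  consider "\<beta> \<le> 1/2" | "\<beta> \<ge> 1/2" "n \<le> 10 ^ 6" | "\<beta> \<ge> 1/2" "n \<ge> 10 ^ 6" by linarith
  then show ?thesis
  proof cases
    case 1
    then show ?thesis using G_le_small_\<beta>[OF _ x0] sqrt_\<Psi>_le \<phi> by fastforce
  next
    case 2
    then show ?thesis using G_le_max[OF _ x0] sqrt_\<Psi>_le \<kappa>_le \<phi> by fastforce
  next
    case 3
    then show ?thesis using G_le_airy[OF _ _ x0] \<phi> by fastforce
  qed
qed

end

section \<open>Degree zero: an explicit profile\<close>

context jacobi_solution begin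

text \<open>G is a multiple of (1 - x)^(\<alpha> + 1/2) (1 + x)^(\<beta> + 1/2). From a suitable y
  with G y at least G x0, G stays above G y / 2 on an interval of length \<eta>, whose mass of at
  most 1 bounds G y. The order of the exponents puts the peak z at or left of 0, so this interval
  stays away from 1.\<close>

lemma G_le_of_const_left:
  assumes p: "p = [:c:]" and "\<beta> \<le> \<alpha>" and x0: "-1 < x0" "x0 < 1"
  shows "(G x0)\<^sup>2 \<le> 64 * max 1 S"
proof -
  \<comment> \<open>S = 0 means that both exponents are -1/2; then 0 / 0 = 0 gives z = 0, and G is
    constant.\<close>
  define z where "z = (\<beta> - \<alpha>) / S"
  define T where "T = max 1 S"
  have T: "T \<ge> 1" "S \<le> T" by (auto simp: T_def)
  have Sz: "S * z = \<beta> - \<alpha>" using \<alpha>_ge \<beta>_ge by (cases "S = 0") (auto simp: z_def S_def)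
  have zb: "-1 \<le> z" "z \<le> 0"
  proof -
    show "z \<le> 0" using \<open>\<beta> \<le> \<alpha>\<close> S_nonneg by (simp add: z_def divide_nonpos_nonneg)
    show "-1 \<le> z" using \<beta>_ge S_nonneg by (cases "S = 0") (auto simp: z_def pos_le_divide_eq S_def)
  qed
  have Gd: "(G has_real_derivative S * (z - x) / (1 - x\<^sup>2) * G x) (at x)" if x: "-1 < x" "x < 1" for x
  proof -
    define s where "s = sqrt (1 - x\<^sup>2)"
    have s: "s > 0" "1 - x\<^sup>2 = s * s" using one_minus_square_pos[OF x] by (auto simp: s_def)
    have "2 * ell x - x = S * (z - x)"
      unfolding right_diff_distrib Sz by (simp add: ell_def \<sigma>_def \<delta>_def S_def field_simps)
    moreover have pc: "p0 x = c" "p1 x = 0" by (simp_all add: p pderiv_pCons)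
    have "2 * P x = w x * c * c * (2 * ell x - x)"
      unfolding P_def Y_def pc by (simp add: algebra_simps)
    ultimately have eqP: "2 * P x = w x * c * c * (S * (z - x))" by (simp only:)
    have eqG: "G x = s * (w x * c * c)"
      unfolding G_def v_def s_def pc by (simp add: power2_eq_square)
    have "2 * P x / s = S * (z - x) / (1 - x\<^sup>2) * G x"
      unfolding s(2) eqP eqG using s(1) by simp
    then show ?thesis using G_deriv[OF x] by (simp add: s_def)
  qed
  have slope: "S * (x - z) / (1 - x\<^sup>2) \<ge> 0" if "z \<le> x" "-1 < x" "x < 1" for x
    using that one_minus_square_pos[of x] S_nonneg by simp
  have sum_nonneg: "0 \<le> S * (z - x) / (1 - x\<^sup>2) * g + b" if "S * (x - z) / (1 - x\<^sup>2) * g \<le> b" for x g b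
  proof -
    have "S * (z - x) / (1 - x\<^sup>2) * g = - (S * (x - z) / (1 - x\<^sup>2) * g)" by (simp add: algebra_simps divide_simps)
    then show ?thesis using that by simp
  qed
  have dec: "G b \<le> G a" if "z \<le> a" "-1 < a" "a \<le> b" "b < 1" for a b
  proof (rule DERIV_nonpos_imp_nonincreasing[of a b G])
    fix x assume "a \<le> x" "x \<le> b"
    then have x: "z \<le> x" "-1 < x" "x < 1" using that by auto
    have "S * (z - x) / (1 - x\<^sup>2) * G x = - (S * (x - z) / (1 - x\<^sup>2) * G x)" by (simp add: algebra_simps divide_simps)
    then have "S * (z - x) / (1 - x\<^sup>2) * G x \<le> 0"
      using mult_nonneg_nonneg[OF slope[OF x] G_nonneg[OF x(2,3)]] by (simp only: neg_le_0_iff_le)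
    then show "\<exists>y. (G has_real_derivative y) (at x) \<and> y \<le> 0" using Gd[OF x(2,3)] by blast
  qed (use that in simp)
  have inc: "G a \<le> G b" if "-1 < a" "a \<le> b" "b \<le> z" for a b
  proof (rule DERIV_nonneg_imp_nondecreasing[of a b G])
    fix x assume "a \<le> x" "x \<le> b"
    then have x: "x \<le> z" "-1 < x" "x < 1" using that zb by auto
    have "S * (z - x) / (1 - x\<^sup>2) * G x \<ge> 0"
      using x one_minus_square_pos[of x] S_nonneg G_nonneg[OF x(2,3)] by simp
    then show "\<exists>y. (G has_real_derivative y) (at x) \<and> 0 \<le> y" using Gd[OF x(2,3)] by blast
  qed (use that in simp)
  have W: "(1 + x) / 2 \<le> 1 - x\<^sup>2" if "-1 < x" "x \<le> 1/2" for x :: real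
  proof -
    have "1/2 * (1 + x) \<le> (1 - x) * (1 + x)" using that by (intro mult_right_mono) auto
    then show ?thesis by (simp add: power2_eq_square algebra_simps)
  qed
  have main: "(G y)\<^sup>2 \<le> 64 * T" if y: "-1 < y" "y \<le> 0" "z \<le> y" and
    near: "1 + y \<le> 1 / (4 * T) \<or> y = z" for y
  proof -
    \<comment> \<open>Near -1 the relative decay rate is at most 2 T, so length 1 / (4 T) is safe;
      farther away the width of the peak at z is used.\<close>
    define \<eta> where "\<eta> = (if 1 + y \<le> 1 / (4 * T) then 1 / (4 * T) else sqrt ((1 + y) / (4 * T)))"
    have Gy: "G y \<ge> 0" using y by (intro G_nonneg) auto
    have \<eta>: "0 < \<eta>" "\<eta> \<le> 1/2" "\<eta>\<^sup>2 * (64 * T) \<ge> 8 * (1 + y + \<eta>)"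
      "\<And>x. y \<le> x \<Longrightarrow> x \<le> y + \<eta> \<Longrightarrow> G x \<ge> G y / 2"
    proof -
      consider "1 + y \<le> 1 / (4 * T)" | "1 + y > 1 / (4 * T)" "y = z" using near by linarith
      then have "0 < \<eta> \<and> \<eta> \<le> 1/2 \<and> \<eta>\<^sup>2 * (64 * T) \<ge> 8 * (1 + y + \<eta>)
        \<and> (\<forall>x. y \<le> x \<and> x \<le> y + \<eta> \<longrightarrow> G x \<ge> G y / 2)"
      proof cases
        case 1
        then have e: "\<eta> = 1 / (4 * T)" by (simp add: \<eta>_def)
        have "1 / (4 * T) \<le> 1 / (4 * 1)" using T by (intro divide_left_mono) auto
        then have e2: "\<eta> \<le> 1/4" by (simp add: e)
        have e3: "\<eta>\<^sup>2 * (64 * T) = 16 * \<eta>" using T by (simp add: e power2_eq_square)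
        have "G x \<ge> G y / 2" if x: "y \<le> x" "x \<le> y + \<eta>" for x
        proof -
          have "G y + 2 * T * G y * (y - y) \<le> G x + 2 * T * G y * (x - y)"
          proof (rule DERIV_nonneg_imp_nondecreasing[OF x(1), of "\<lambda>x. G x + 2 * T * G y * (x - y)"])
            fix u assume u: "y \<le> u" "u \<le> x"
            then have u': "-1 < u" "u < 1" "u \<le> 1/2" "z \<le> u" using y x e2 by auto
            have "((\<lambda>x. G x + 2 * T * G y * (x - y)) has_real_derivative S * (z - u) / (1 - u\<^sup>2) * G u + 2 * T * G y) (at u)"
              by (auto intro!: derivative_eq_intros Gd u')
            moreover have "S * (u - z) / (1 - u\<^sup>2) * G u \<le> 2 * T * G y"
            proof (rule mult_mono)
              have "S * (u - z) \<le> T * (1 + u)" using T u' zb by (intro mult_mono) auto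
              also have "\<dots> = 2 * T * ((1 + u) / 2)" by simp
              also have "\<dots> \<le> 2 * T * (1 - u\<^sup>2)" using W[of u] u' T by (intro mult_left_mono) auto
              finally show "S * (u - z) / (1 - u\<^sup>2) \<le> 2 * T"
                using one_minus_square_pos[OF u'(1,2)] by (simp add: pos_divide_le_eq)
            qed (use dec[of y u] y u u' T G_nonneg[of u] in auto)
            then have "0 \<le> S * (z - u) / (1 - u\<^sup>2) * G u + 2 * T * G y" by (rule sum_nonneg)
            ultimately show "\<exists>d. ((\<lambda>x. G x + 2 * T * G y * (x - y)) has_real_derivative d) (at u) \<and> 0 \<le> d"
              by blast
          qed
          moreover have "2 * T * G y * (x - y) \<le> 2 * T * G y * \<eta>" using x T Gy by (intro mult_left_mono) auto
          moreover have "2 * T * G y * \<eta> = G y / 2" using T by (simp add: e)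
          ultimately show ?thesis by simp
        qed
        then show ?thesis using 1 e T e2 e3 by auto
      next
        case 2
        then have e: "\<eta> = sqrt ((1 + y) / (4 * T))" by (simp add: \<eta>_def)
        have e0: "\<eta> > 0" using y T by (simp add: e)
        have e1: "\<eta>\<^sup>2 = (1 + y) / (4 * T)" using y T by (simp add: e)
        have "\<eta>\<^sup>2 \<le> (1/2)\<^sup>2" unfolding e1 using y T by (simp add: pos_divide_le_eq power_divide)
        then have e2: "\<eta> \<le> 1/2" by (rule power2_le_imp_le) simp
        have "\<eta>\<^sup>2 \<le> (1 + y)\<^sup>2"
        proof -
          have "(1 + y) * (1 / (4 * T)) \<le> (1 + y) * (1 + y)" using 2 y by (intro mult_left_mono) auto
          then show ?thesis unfolding e1 by (simp add: power2_eq_square)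
        qed
        then have e3: "\<eta> \<le> 1 + y" by (rule power2_le_imp_le) (use y in simp)
        have e4: "\<eta>\<^sup>2 * (64 * T) = 16 * (1 + y)" using T by (simp add: e1)
        have "G x \<ge> G y / 2" if x: "y \<le> x" "x \<le> y + \<eta>" for x
        proof -
          \<comment> \<open>From the peak y = z the slope starts at zero, so the loss is quadratic
            and at most C \<eta>^2 G y = G y / 4.\<close>
          define C where "C = T / (1 + y)"
          have C: "C \<ge> 0" using T y by (simp add: C_def)
          have "G y + C * G y * (y - y)\<^sup>2 \<le> G x + C * G y * (x - y)\<^sup>2"
          proof (rule DERIV_nonneg_imp_nondecreasing[OF x(1), of "\<lambda>x. G x + C * G y * (x - y)\<^sup>2"])
            fix u assume u: "y \<le> u" "u \<le> x"
            then have u': "-1 < u" "u < 1" "u \<le> 1/2" "z \<le> u" using y x e2 by auto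
            have deriv: "((\<lambda>x. G x + C * G y * (x - y)\<^sup>2) has_real_derivative S * (z - u) / (1 - u\<^sup>2) * G u + C * G y * (2 * (u - y))) (at u)"
              by (auto intro!: derivative_eq_intros Gd u')
            have "S * (u - z) / (1 - u\<^sup>2) * G u \<le> (2 * C * (u - y)) * G y"
            proof (rule mult_mono)
              have "S * (u - z) \<le> T * (u - y)" using T u' 2 by (intro mult_mono) auto
              also have "\<dots> = 2 * C * (u - y) * ((1 + y) / 2)" using y by (simp add: C_def)
              also have "\<dots> \<le> 2 * C * (u - y) * (1 - u\<^sup>2)"
                using W[of u] u u' C by (intro mult_left_mono) auto
              finally show "S * (u - z) / (1 - u\<^sup>2) \<le> 2 * C * (u - y)"
                using one_minus_square_pos[OF u'(1,2)] by (simp add: pos_divide_le_eq)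
            qed (use dec[of y u] y u u' C G_nonneg[of u] in auto)
            then have "0 \<le> S * (z - u) / (1 - u\<^sup>2) * G u + (2 * C * (u - y)) * G y" by (rule sum_nonneg)
            moreover have "(2 * C * (u - y)) * G y = C * G y * (2 * (u - y))" by simp
            ultimately have "0 \<le> S * (z - u) / (1 - u\<^sup>2) * G u + C * G y * (2 * (u - y))" by (simp only:)
            with deriv show "\<exists>d. ((\<lambda>x. G x + C * G y * (x - y)\<^sup>2) has_real_derivative d) (at u) \<and> 0 \<le> d"
              by blast
          qed
          moreover have "C * G y * (x - y)\<^sup>2 \<le> C * G y * \<eta>\<^sup>2" using x C Gy by (intro mult_left_mono power_mono) auto
          moreover have "C * G y * \<eta>\<^sup>2 = G y / 4" using T y by (simp add: e1 C_def)
          ultimately show ?thesis using Gy by simp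
        qed
        then show ?thesis using e0 e2 e3 e4 by auto
      qed
      then show "0 < \<eta>" "\<eta> \<le> 1/2" "\<eta>\<^sup>2 * (64 * T) \<ge> 8 * (1 + y + \<eta>)"
        "\<And>x. y \<le> x \<Longrightarrow> x \<le> y + \<eta> \<Longrightarrow> G x \<ge> G y / 2" by auto
    qed
    define R where "R = sqrt (2 * (1 + y + \<eta>))"
    have R: "R > 0" "R\<^sup>2 = 2 * (1 + y + \<eta>)" using y \<eta>(1) by (auto simp: R_def)
    have "integral {y..y + \<eta>} (\<lambda>x. G y / 2 / R) \<le> integral {y..y + \<eta>} v"
    proof (rule integral_le)
      show "v integrable_on {y..y + \<eta>}" using integrable_times_v[of y "y + \<eta>" "\<lambda>_. 1"] y \<eta> by simp
      fix x assume x: "x \<in> {y..y + \<eta>}"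
      then have x': "-1 < x" "x < 1" using y \<eta> by auto
      have "1 - x\<^sup>2 = (1 - x) * (1 + x)" by (simp add: power2_eq_square algebra_simps)
      also have "\<dots> \<le> 2 * (1 + y + \<eta>)" using x x' by (intro mult_mono) auto
      finally have "sqrt (1 - x\<^sup>2) \<le> R" by (simp add: R_def)
      then have "G x \<le> R * v x" unfolding G_def using v_nonneg[OF x'] by (rule mult_right_mono)
      moreover have "G y / 2 \<le> G x" using \<eta>(4) x by auto
      ultimately show "G y / 2 / R \<le> v x" using R by (simp add: pos_divide_le_eq mult.commute)
    qed auto
    then have "\<eta> * (G y / 2 / R) \<le> 1" using integral_v_le_1[of y "y + \<eta>"] y \<eta> by simp
    then have "\<eta> * G y \<le> 2 * R" using R by (simp add: field_simps)
    then have "(\<eta> * G y)\<^sup>2 \<le> (2 * R)\<^sup>2" using \<eta>(1) Gy by (intro power_mono) auto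
    then have "\<eta>\<^sup>2 * (G y)\<^sup>2 \<le> 8 * (1 + y + \<eta>)" by (simp add: power_mult_distrib R(2))
    then have "\<eta>\<^sup>2 * (G y)\<^sup>2 \<le> \<eta>\<^sup>2 * (64 * T)" using \<eta>(3) by linarith
    then show ?thesis using \<eta>(1) by simp
  qed
  obtain y where y: "-1 < y" "y \<le> 0" "z \<le> y" "1 + y \<le> 1 / (4 * T) \<or> y = z" "G x0 \<le> G y"
  proof (cases "z = -1")
    case True
    \<comment> \<open>Here \<beta> = -1/2 and G has no interior peak; a point near -1 and not beyond
      x0 takes its place.\<close>
    define y where "y = min x0 (-1 + 1 / (4 * T))"
    have "1 / (4 * T) \<le> 1 / (4 * 1)" using T by (intro divide_left_mono) auto
    then have "y \<le> 0" by (simp add: y_def min_le_iff_disj)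
    moreover have "-1 < y" using x0 T by (simp add: y_def)
    ultimately show ?thesis using True x0 dec[of y x0] by (intro that[of y]) (auto simp: y_def)
  next
    case False
    then have "-1 < z" using zb by simp
    moreover have "G x0 \<le> G z"
      using \<open>-1 < z\<close> x0 dec[of z x0] inc[of x0 z] by (cases "x0 \<le> z") auto
    ultimately show ?thesis using zb by (intro that[of z]) auto
  qed
  have "(G x0)\<^sup>2 \<le> (G y)\<^sup>2" using y(5) G_nonneg[OF x0] by (intro power_mono) auto
  also have "\<dots> \<le> 64 * T" by (rule main[OF y(1-4)])
  finally show ?thesis by (simp add: T_def)
qed

end

text \<open>Right of the centre the reflected solution applies: its centre is -xc and its G at -x
  equals G x. For n = 0 the third entry of \<open>Phi\<close> is S^(1/2), the growth found for
  constants.\<close>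

lemma jacobi_solution_bound:
  assumes sol: "jacobi_solution \<alpha> \<beta> n p" and deg: "degree p = n" and x: "-1 < x" "x < 1"
  shows "sqrt (1 - x\<^sup>2) * (jacobi_weight \<alpha> \<beta> x * (poly p x)\<^sup>2) \<le> 4 * 10 ^ 7 * Phi n (\<alpha> + \<beta> + 1)"
proof -
  let ?r = "pcompose p [:0, -1:]"
  interpret jacobi_solution \<alpha> \<beta> n p by (rule sol)
  interpret R: jacobi_solution \<beta> \<alpha> n ?r by (rule jacobi_solution_reflect[OF sol])
  have G: "sqrt (1 - x\<^sup>2) * (jacobi_weight \<alpha> \<beta> x * (poly p x)\<^sup>2) = G x"
    by (simp add: G_def v_def)
  have RG: "R.G (- x) = G x"
    by (simp add: G_def v_def R.G_def R.v_def poly_pcompose jacobi_weight_def mult_ac)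
  have RS: "R.S = S" and S: "\<alpha> + \<beta> + 1 = S" by (simp_all add: S_def R.S_def)
  show ?thesis
  proof (cases "n = 0")
    case True
    then obtain c where c: "p = [:c:]" using deg by (auto elim: degree_eq_zeroE)
    then have rc: "?r = [:c:]" by simp
    have "(G x)\<^sup>2 \<le> 64 * max 1 S"
    proof (cases "\<beta> \<le> \<alpha>")
      case True
      then show ?thesis using G_le_of_const_left[OF c _ x] by simp
    next
      case False
      then show ?thesis using R.G_le_of_const_left[OF rc, of "- x"] x by (simp add: RG RS)
    qed
    moreover have "max 1 S \<le> (Phi n S)\<^sup>2"
    proof -
      have \<phi>: "1 \<le> Phi n S" "S ^ 3 \<le> Phi n S ^ 6" using Phi_ge[OF S_nonneg, of n] True by auto
      have "S \<le> (Phi n S)\<^sup>2"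
        by (rule power_le_imp_le_base[where n = 2]) (use \<phi> in \<open>simp_all add: eval_nat_numeral mult_ac\<close>)
      moreover have "1 \<le> (Phi n S)\<^sup>2" using \<phi>(1) by simp
      ultimately show ?thesis by simp
    qed
    ultimately have "(G x)\<^sup>2 \<le> 64 * (Phi n S)\<^sup>2" by linarith
    then have "(G x)\<^sup>2 \<le> (8 * Phi n S)\<^sup>2" by (simp add: power_mult_distrib)
    then have "G x \<le> 8 * Phi n S" by (rule power2_le_imp_le) (use Phi_ge(1)[OF S_nonneg, of n] in simp)
    then show ?thesis unfolding G S using Phi_ge(1)[OF S_nonneg, of n] by simp
  next
    case False
    interpret pos: jacobi_solution_pos \<alpha> \<beta> n p using False by unfold_locales simp
    interpret Rpos: jacobi_solution_pos \<beta> \<alpha> n ?r using False by unfold_locales simp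
    have \<sigma>: "R.\<sigma> = \<sigma>" by (simp add: \<sigma>_def R.\<sigma>_def add.commute)
    have \<delta>: "R.\<delta> = - \<delta>" by (simp add: \<delta>_def R.\<delta>_def field_simps)
    have "R.\<mu> = \<mu>" unfolding \<mu>_def R.\<mu>_def \<sigma> by (simp add: add_ac)
    then have "R.A = A" by (simp add: A_def R.A_def \<sigma>)
    then have "R.xc = - xc" by (simp add: xc_def R.xc_def \<sigma> \<delta>)
    then show ?thesis
      unfolding G S using pos.G_le_left[of x] Rpos.G_le_left[of "- x"] x RG RS by (cases "x \<le> xc") auto
  qed
qed

lemma jacobi_F_open_nonneg: "jacobi_F_open \<alpha> \<beta> q x \<ge> 0"
  by (simp add: jacobi_F_open_def)

lemma jacobi_F_open_le:
  assumes "jacobi_solution \<alpha> \<beta> n p" "degree p = n" "-1 < x" "x < 1"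
  shows "jacobi_F_open \<alpha> \<beta> p x \<le> 1.2 * 10 ^ 5 * E_bound n (\<alpha> + \<beta> + 1)"
proof (rule power2_le_imp_le)
  have S: "\<alpha> + \<beta> + 1 \<ge> 0"
    using assms(1) by (auto simp: jacobi_solution_def)
  have W: "1 - x\<^sup>2 > 0" using assms by (intro one_minus_square_pos)
  have half: "(t powr (1/2))\<^sup>2 = t" if "t > 0" for t :: real
    using that by (simp add: powr_half_sqrt)
  have "((1 - x\<^sup>2) powr (1/4))\<^sup>2 = sqrt (1 - x\<^sup>2)"
    using W by (simp add: powr_half_sqrt[symmetric] power2_eq_square flip: powr_add)
  then have "(jacobi_F_open \<alpha> \<beta> p x)\<^sup>2 = sqrt (1 - x\<^sup>2) * (jacobi_weight \<alpha> \<beta> x * (poly p x)\<^sup>2)"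
    using half[OF jacobi_weight_pos[OF assms(3,4)]] by (simp add: jacobi_F_open_def power_mult_distrib)
  also have "\<dots> \<le> 4 * 10 ^ 7 * Phi n (\<alpha> + \<beta> + 1)" by (rule jacobi_solution_bound[OF assms])
  \<comment> \<open>The final constant has slack: its square is 1.44 * 10^10.\<close>
  also have "\<dots> \<le> (1.2 * 10 ^ 5)\<^sup>2 * Phi n (\<alpha> + \<beta> + 1)"
    using Phi_ge(1)[OF S, of n] by (intro mult_right_mono) auto
  also have "\<dots> = (1.2 * 10 ^ 5 * E_bound n (\<alpha> + \<beta> + 1))\<^sup>2"
  proof -
    have "(E_bound n (\<alpha> + \<beta> + 1))\<^sup>2 = Phi n (\<alpha> + \<beta> + 1)"
      using half[of "Phi n (\<alpha> + \<beta> + 1)"] Phi_ge(1)[OF S, of n] by (simp add: E_bound_def)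
    then show ?thesis by (simp only: power_mult_distrib)
  qed
  finally show "(jacobi_F_open \<alpha> \<beta> p x)\<^sup>2 \<le> (1.2 * 10 ^ 5 * E_bound n (\<alpha> + \<beta> + 1))\<^sup>2" .
qed (simp add: E_bound_def)

theorem theorem1p1:
  fixes n :: nat and \<alpha> \<beta> x S :: real and p :: "nat \<Rightarrow> real poly"
  assumes "\<alpha> \<ge> -1/2" and "\<beta> \<ge> -1/2"
    and "orthonormal_jacobi \<alpha> \<beta> p"
    and "x \<in> {-1..1}"
    and "S = \<alpha> + \<beta> + 1"
  shows "jacobi_F \<alpha> \<beta> (p n) x \<le> 1.2 * 10 ^ 5 * E_bound n S
    \<and> (jacobi_F \<alpha> \<beta> (p n) x)\<^sup>2
        \<le> (1.2 * 10 ^ 5)\<^sup>2 * Max {1, S powr (1/3), S powr (1/2) / (real n + 1) powr (1/6)}"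
proof -
  interpret orthonormal_jacobi_seq \<alpha> \<beta> p using assms(1-3) by unfold_locales
  let ?F = "jacobi_F_open \<alpha> \<beta> (p n)" and ?C = "1.2 * 10 ^ 5 * E_bound n S"
  have le: "?F y \<le> ?C" if "-1 < y" "y < 1" for y
    using jacobi_F_open_le[OF jacobi_solution_p degree_p that] by (simp add: assms(5))
  have ge: "0 \<le> ?F y" for y by (rule jacobi_F_open_nonneg)
  \<comment> \<open>Endpoint values are one-sided limits, so the interior bound passes to
    them.\<close>
  consider "x = 1" | "x = -1" | "-1 < x" "x < 1" using assms(4) by force
  then have F: "0 \<le> jacobi_F \<alpha> \<beta> (p n) x \<and> jacobi_F \<alpha> \<beta> (p n) x \<le> ?C"
  proof cases
    case 1
    have "\<forall>\<^sub>F y in at_left 1. ?F y \<le> ?C"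
      using le by (auto simp: eventually_at_left_field intro!: exI[of _ 0])
    then show ?thesis
      using jacobi_F_endpoints(1)[OF assms(1,2), of "p n"] ge unfolding 1
      by (auto intro: tendsto_upperbound tendsto_lowerbound)
  next
    case 2
    have "\<forall>\<^sub>F y in at_right (-1). ?F y \<le> ?C"
      using le by (auto simp: eventually_at_right_field intro!: exI[of _ 0])
    then show ?thesis
      using jacobi_F_endpoints(2)[OF assms(1,2), of "p n"] ge unfolding 2
      by (auto intro: tendsto_upperbound tendsto_lowerbound)
  next
    case 3
    then show ?thesis using le ge by (simp add: jacobi_F_def)
  qed
  then have "(jacobi_F \<alpha> \<beta> (p n) x)\<^sup>2 \<le> ?C\<^sup>2" by (intro power_mono) auto
  also have "\<dots> = (1.2 * 10 ^ 5)\<^sup>2 * Phi n S"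
  proof -
    have "S \<ge> 0" using assms(1,2,5) by simp
    then have "(E_bound n S)\<^sup>2 = Phi n S"
      using Phi_ge(1)[of S n] by (simp add: E_bound_def powr_half_sqrt)
    then show ?thesis by (simp only: power_mult_distrib)
  qed
  finally show ?thesis using F unfolding Phi_def by blast
qed

end
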